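(* Let $S$ be a $C^2$-smooth surface in Euclidean 3-space $\mathbb{E}^3$ (respectively a $C^2$-smooth space-like surface in Lorentzian 3-space $\mathbb{E}^3_1$), and let $\Sigma$ be its oriented normal congruence, i.e. the set of oriented lines normal to $S$, considered as a surface in the space of oriented lines $\mathbb{L}^3=TS^2$ of $\mathbb{E}^3$ (respectively in the space of future-pointing time-like lines $\mathbb{L}^3_{1,-}=TH^2$ of $\mathbb{E}^3_1$). Then $S$ is Weingarten if and only if the Lorentzian metric induced on $\Sigma$ by the canonical neutral Kähler metric $\mathbb{G}$ is scalar flat.
   Context: $\mathbb{E}^3_1$ is $\mathbb{R}^3$ with the flat metric $(dx^1)^2+(dx^2)^2-(dx^3)^2$; write $z=x^1+ix^2$, $t=x^3$ (also on $\mathbb{E}^3$). Upper signs are Euclidean, lower signs Lorentzian. A surface $S$ (space-like in the Lorentzian case) is Weingarten if the eigenvalues $\lambda_1,\lambda_2$ of its second fundamental form are functionally dependent, i.e. $d\lambda_1\wedge d\lambda_2=0$. $S^2$ and $H^2$ carry the metrics $g=e^{2u}d\xi d\bar\xi$, $e^{2u}=4(1\pm\xi\bar\xi)^{-2}$ (with $|\xi|<1$ for $H^2$). Write $(\xi,\eta)$ for the tangent vector $\eta\,\partial/\partial\xi+\bar\eta\,\partial/\partial\bar\xi\in T_\xi N$, $N=S^2$ or $H^2$. It is identified with the line consisting of the points $(z,t)$, $r\in\mathbb{R}$, with $$z=\frac{2(\eta\mp\bar\eta\xi^2)+2\xi(1\pm\xi\bar\xi)r}{(1\pm\xi\bar\xi)^2},\qquad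 t=\frac{\mp2(\eta\bar\xi+\bar\eta\xi)+(1-\xi^2\bar\xi^2)r}{(1\pm\xi\bar\xi)^2},$$ oriented by increasing $r$. The canonical neutral Kähler metric on $TN$ (signature $(++--)$) and its symplectic form are $$\mathbb{G}=2\,\mathrm{Im}\left(e^{2u}d\bar\eta\, d\xi-\eta\,\partial(e^{2u})d\xi\, d\bar\xi\right),\qquad \Omega=2\,\mathrm{Re}\left(e^{2u}d\eta\wedge d\bar\xi+\eta\,\partial(e^{2u})d\xi\wedge d\bar\xi\right),\qquad \partial=\partial/\partial\xi.$$ The normal congruence of a surface is Lagrangian ($\Omega|_\Sigma=0$), and the metric induced by $\mathbb{G}$ on a Lagrangian surface is Lorentzian wherever it is non-degenerate.
   Formalization: For a merely C² surface the metric induced on Σ and the eigenvalues λ₁, λ₂ are only continuous, so scalar curvature and dλ₁∧dλ₂ are undefined; the formal theorem also assumes that Σ is C³ (equivalently S is C⁴), and tests flatness where the metric is non-degenerate. *)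

theory Defs
  imports "HOL-Analysis.Analysis"
begin

section \<open>Differentiability of finite order\<close>

text \<open>Only used on open sets.\<close>

fun Ck_on :: "nat \<Rightarrow> ('a::real_normed_vector \<Rightarrow> 'b::real_normed_vector) \<Rightarrow> 'a set \<Rightarrow> bool" where
  "Ck_on 0 f U \<longleftrightarrow> continuous_on U f"
| "Ck_on (Suc k) f U \<longleftrightarrow>
     (\<forall>x\<in>U. f differentiable (at x)) \<and> (\<forall>v. Ck_on k (\<lambda>x. frechet_derivative f (at x) v) U)"

definition pderivative :: "'n::finite \<Rightarrow> (real^'n \<Rightarrow> 'b::real_normed_vector) \<Rightarrow> real^'n \<Rightarrow> 'b" where
  "pderivative i f x = frechet_derivative f (at x) (axis i 1)"

section \<open>Scalar curvature of a metric given in coordinates\<close>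

definition christoffel ::
    "(real^'n \<Rightarrow> real^'n^'n) \<Rightarrow> 'n::finite \<Rightarrow> 'n \<Rightarrow> 'n \<Rightarrow> real^'n \<Rightarrow> real" where
  "christoffel g k i j x =
     (\<Sum>l\<in>UNIV. matrix_inv (g x) $ k $ l *
        (pderivative i (\<lambda>y. g y $ j $ l) x + pderivative j (\<lambda>y. g y $ i $ l) x
         - pderivative l (\<lambda>y. g y $ i $ j) x)) / 2"

text \<open>The component \<open>R\<^sup>l\<^sub>k\<^sub>i\<^sub>j\<close>, i.e. \<open>R(\<partial>\<^sub>i, \<partial>\<^sub>j) \<partial>\<^sub>k = \<Sum>\<^sub>l R\<^sup>l\<^sub>k\<^sub>i\<^sub>j \<partial>\<^sub>l\<close>.\<close>

definition riemann ::
    "(real^'n \<Rightarrow> real^'n^'n) \<Rightarrow> 'n::finite \<Rightarrow> 'n \<Rightarrow> 'n \<Rightarrow> 'n \<Rightarrow> real^'n \<Rightarrow> real" where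
  "riemann g l k i j x =
     pderivative i (christoffel g l j k) x - pderivative j (christoffel g l i k) x
     + (\<Sum>m\<in>UNIV. christoffel g l i m x * christoffel g m j k x
                 - christoffel g l j m x * christoffel g m i k x)"

definition ricci :: "(real^'n \<Rightarrow> real^'n^'n) \<Rightarrow> 'n::finite \<Rightarrow> 'n \<Rightarrow> real^'n \<Rightarrow> real" where
  "ricci g k j x = (\<Sum>i\<in>UNIV. riemann g i k i j x)"

definition scalar_curvature :: "(real^'n \<Rightarrow> real^'n::finite^'n) \<Rightarrow> real^'n \<Rightarrow> real" where
  "scalar_curvature g x = (\<Sum>k\<in>UNIV. \<Sum>j\<in>UNIV. matrix_inv (g x) $ k $ j * ricci g k j x)"

section \<open>The ambient spaces\<close>

datatype ambient = Euclidean | Lorentzian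

text \<open>The upper or lower sign.\<close>

fun sig :: "ambient \<Rightarrow> real" where
  "sig Euclidean = 1"
| "sig Lorentzian = -1"

definition ip :: "ambient \<Rightarrow> real^3 \<Rightarrow> real^3 \<Rightarrow> real" where
  "ip A p q = p $ 1 * q $ 1 + p $ 2 * q $ 2 + sig A * (p $ 3 * q $ 3)"

section \<open>Surfaces\<close>

definition C2_patch :: "(real^3) set \<Rightarrow> (real^2) set \<Rightarrow> (real^2 \<Rightarrow> real^3) \<Rightarrow> bool" where
  "C2_patch S U f \<longleftrightarrow>
     open U \<and> Ck_on 2 f U \<and> (\<forall>x\<in>U. inj (frechet_derivative f (at x))) \<and>
     openin (top_of_set S) (f ` U) \<and> (\<exists>f'. homeomorphism U (f ` U) f f')"

definition C2_surface :: "(real^3) set \<Rightarrow> bool" where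
  "C2_surface S \<longleftrightarrow> (\<forall>p\<in>S. \<exists>U f. C2_patch S U f \<and> p \<in> f ` U)"

definition fundamental_form_1 ::
    "ambient \<Rightarrow> (real^2 \<Rightarrow> real^3) \<Rightarrow> real^2 \<Rightarrow> real^2 \<Rightarrow> real^2 \<Rightarrow> real" where
  "fundamental_form_1 A f x v w = ip A (frechet_derivative f (at x) v) (frechet_derivative f (at x) w)"

definition space_like :: "(real^3) set \<Rightarrow> bool" where
  "space_like S \<longleftrightarrow>
     (\<forall>U f. C2_patch S U f \<longrightarrow> (\<forall>x\<in>U. \<forall>v. v \<noteq> 0 \<longrightarrow> fundamental_form_1 Lorentzian f x v v > 0))"

text \<open>
  A patch with a choice of unit normal.  In the Euclidean case both choices are allowed, so
  that \<open>S\<close> need not be orientable; in the Lorentzian case the normal is the future-pointing one.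
\<close>

definition normal_patch ::
    "ambient \<Rightarrow> (real^3) set \<Rightarrow> (real^2) set \<Rightarrow> (real^2 \<Rightarrow> real^3) \<Rightarrow> (real^2 \<Rightarrow> real^3) \<Rightarrow> bool" where
  "normal_patch A S U f n \<longleftrightarrow>
     C2_patch S U f \<and> continuous_on U n \<and>
     (\<forall>x\<in>U. ip A (n x) (n x) = sig A \<and> (\<forall>v. ip A (frechet_derivative f (at x) v) (n x) = 0) \<and>
             (A = Lorentzian \<longrightarrow> n x $ 3 > 0))"

definition fundamental_form_2 ::
    "ambient \<Rightarrow> (real^2 \<Rightarrow> real^3) \<Rightarrow> (real^2 \<Rightarrow> real^3) \<Rightarrow> real^2 \<Rightarrow> real^2 \<Rightarrow> real^2 \<Rightarrow> real" where
  "fundamental_form_2 A f n x v w =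
     ip A (frechet_derivative (\<lambda>y. frechet_derivative f (at y) v) (at x) w) (n x)"

text \<open>
  The eigenvalues are relative to the first fundamental form, which is positive definite, so
  that there are one or two of them.
\<close>

definition principal_curvatures ::
    "ambient \<Rightarrow> (real^2 \<Rightarrow> real^3) \<Rightarrow> (real^2 \<Rightarrow> real^3) \<Rightarrow> real^2 \<Rightarrow> real set" where
  "principal_curvatures A f n x =
     {l. \<exists>v. v \<noteq> 0 \<and> (\<forall>w. fundamental_form_2 A f n x v w = l * fundamental_form_1 A f x v w)}"

definition lambda1 :: "ambient \<Rightarrow> (real^2 \<Rightarrow> real^3) \<Rightarrow> (real^2 \<Rightarrow> real^3) \<Rightarrow> real^2 \<Rightarrow> real" where
  "lambda1 A f n x = Min (principal_curvatures A f n x)"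

definition lambda2 :: "ambient \<Rightarrow> (real^2 \<Rightarrow> real^3) \<Rightarrow> (real^2 \<Rightarrow> real^3) \<Rightarrow> real^2 \<Rightarrow> real" where
  "lambda2 A f n x = Max (principal_curvatures A f n x)"

definition wedge_d :: "(real^2 \<Rightarrow> real) \<Rightarrow> (real^2 \<Rightarrow> real) \<Rightarrow> real^2 \<Rightarrow> real^2 \<Rightarrow> real^2 \<Rightarrow> real" where
  "wedge_d a b x v w =
     frechet_derivative a (at x) v * frechet_derivative b (at x) w
     - frechet_derivative a (at x) w * frechet_derivative b (at x) v"

text \<open>
  The form \<open>d\<lambda>\<^sub>1 \<and> d\<lambda>\<^sub>2\<close> vanishes wherever it is defined.  Even on smooth surfaces the principal
  curvatures can fail to be differentiable at umbilic points (and where both are differentiable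
  at an umbilic point, their differentials agree there, because \<open>\<lambda>\<^sub>1 \<le> \<lambda>\<^sub>2\<close>).
\<close>

definition weingarten :: "ambient \<Rightarrow> (real^3) set \<Rightarrow> bool" where
  "weingarten A S \<longleftrightarrow>
     (\<forall>U f n. normal_patch A S U f n \<longrightarrow>
        (\<forall>x\<in>U. lambda1 A f n differentiable (at x) \<and> lambda2 A f n differentiable (at x) \<longrightarrow>
           (\<forall>v w. wedge_d (lambda1 A f n) (lambda2 A f n) x v w = 0)))"

section \<open>The space of oriented lines\<close>

text \<open>The point with parameter \<open>r\<close> on the oriented line \<open>(\<xi>, \<eta>)\<close>.\<close>

definition line_z :: "ambient \<Rightarrow> complex \<Rightarrow> complex \<Rightarrow> real \<Rightarrow> complex" where
  "line_z A \<xi> \<eta> r =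
     (2 * (\<eta> - sig A * cnj \<eta> * \<xi>\<^sup>2) + 2 * \<xi> * (1 + sig A * (\<xi> * cnj \<xi>)) * r)
     / (1 + sig A * (\<xi> * cnj \<xi>))\<^sup>2"

definition line_t :: "ambient \<Rightarrow> complex \<Rightarrow> complex \<Rightarrow> real \<Rightarrow> real" where
  "line_t A \<xi> \<eta> r =
     Re ((- sig A * 2 * (\<eta> * cnj \<xi> + cnj \<eta> * \<xi>) + (1 - \<xi>\<^sup>2 * (cnj \<xi>)\<^sup>2) * r)
         / (1 + sig A * (\<xi> * cnj \<xi>))\<^sup>2)"

definition line_point :: "ambient \<Rightarrow> complex \<Rightarrow> complex \<Rightarrow> real \<Rightarrow> real^3" where
  "line_point A \<xi> \<eta> r = vector [Re (line_z A \<xi> \<eta> r), Im (line_z A \<xi> \<eta> r), line_t A \<xi> \<eta> r]"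

text \<open>
  In the Euclidean case the coordinate \<open>\<xi>\<close> omits the direction \<open>(0, 0, -1)\<close>.  The coordinates
  \<open>\<xi>' = 1 / \<xi>\<close>, \<open>\<eta>' = - \<eta> / \<xi>\<^sup>2\<close> of \<open>TS\<^sup>2\<close> around that direction are those of the line moved by the
  half turn about the \<open>x\<^sup>1\<close>-axis.  The metric of \<open>S\<^sup>2\<close>, and hence that of \<open>TS\<^sup>2\<close>, is given by the
  same formula in both coordinate systems.
\<close>

definition half_turn :: "real^3 \<Rightarrow> real^3" where
  "half_turn p = vector [p $ 1, - (p $ 2), - (p $ 3)]"

lemma half_turn_line_point:
  assumes "\<xi> \<noteq> 0"
  shows "half_turn (line_point Euclidean (1 / \<xi>) (- \<eta> / \<xi>\<^sup>2) r) = line_point Euclidean \<xi> \<eta> r"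
proof -
  let ?N = "1 + \<xi> * cnj \<xi>"
  have c: "cnj \<xi> \<noteq> 0" using assms by simp
  have "?N = of_real (1 + (cmod \<xi>)\<^sup>2)"
    by (simp add: complex_norm_square[symmetric] del: of_real_power)
  then have N: "?N \<noteq> 0"
    by (metis add_cancel_left_right add_nonneg_eq_0_iff of_real_eq_0_iff zero_le_one zero_le_power2 zero_neq_one)
  have M: "1 + 1 / (\<xi> * cnj \<xi>) = ?N / (\<xi> * cnj \<xi>)"
    using assms c by (simp add: field_simps)
  have z: "line_z Euclidean (1 / \<xi>) (- \<eta> / \<xi>\<^sup>2) r = cnj (line_z Euclidean \<xi> \<eta> r)"
    using assms c N unfolding line_z_def
    apply (simp add: M)
    apply (simp add: divide_simps mult.commute)
    apply (simp add: algebra_simps power2_eq_square)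
    done
  have t: "line_t Euclidean (1 / \<xi>) (- \<eta> / \<xi>\<^sup>2) r = - line_t Euclidean \<xi> \<eta> r"
    unfolding line_t_def uminus_complex.sel(1)[symmetric]
    apply (rule arg_cong[where f = Re])
    using assms c N
    apply (simp add: M)
    apply (simp add: divide_simps mult.commute)
    apply (simp add: algebra_simps power2_eq_square)
    done
  show ?thesis
    unfolding half_turn_def line_point_def z t by simp
qed

fun line_charts :: "ambient \<Rightarrow> (complex \<Rightarrow> complex \<Rightarrow> real \<Rightarrow> real^3) set" where
  "line_charts Euclidean = {line_point Euclidean, \<lambda>\<xi> \<eta> r. half_turn (line_point Euclidean \<xi> \<eta> r)}"
| "line_charts Lorentzian = {line_point Lorentzian}"

fun chart_domain :: "ambient \<Rightarrow> complex set" where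
  "chart_domain Euclidean = UNIV"
| "chart_domain Lorentzian = ball 0 1"

definition e2u :: "ambient \<Rightarrow> complex \<Rightarrow> real" where
  "e2u A \<xi> = 4 / (1 + sig A * (cmod \<xi>)\<^sup>2)\<^sup>2"

text \<open>The Wirtinger derivative \<open>\<partial>/\<partial>\<xi> = (\<partial>/\<partial>x - i \<partial>/\<partial>y) / 2\<close> of a real-valued function.\<close>

definition wirtinger :: "(complex \<Rightarrow> real) \<Rightarrow> complex \<Rightarrow> complex" where
  "wirtinger F \<xi> =
     (of_real (frechet_derivative F (at \<xi>) 1) - \<i> * of_real (frechet_derivative F (at \<xi>) \<i>)) / 2"

text \<open>
  The symmetric bilinear form at \<open>(\<xi>, \<eta>)\<close> with \<open>neutral_metric A (\<xi>, \<eta>) X X = \<G>(X, X)\<close>, where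
  \<open>X = (d\<xi>, d\<eta>)\<close>.
\<close>

definition neutral_metric ::
    "ambient \<Rightarrow> complex \<times> complex \<Rightarrow> complex \<times> complex \<Rightarrow> complex \<times> complex \<Rightarrow> real" where
  "neutral_metric A = (\<lambda>(\<xi>, \<eta>) (a, b) (a', b').
     Im (e2u A \<xi> * (cnj b * a' + cnj b' * a)
         - \<eta> * wirtinger (e2u A) \<xi> * (a * cnj a' + a' * cnj a)))"

section \<open>The normal congruence\<close>

text \<open>
  \<open>h = (\<xi>, \<eta>)\<close> sends a parameter \<open>x\<close> to the coordinates, in the chart \<open>L\<close>, of the line through
  \<open>f x\<close> oriented by \<open>n x\<close>.
\<close>

definition congruence_patch ::
    "ambient \<Rightarrow> (real^3) set \<Rightarrow> (real^2) set \<Rightarrow> (real^2 \<Rightarrow> real^3) \<Rightarrow> (real^2 \<Rightarrow> real^3) \<Rightarrow>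
     (complex \<Rightarrow> complex \<Rightarrow> real \<Rightarrow> real^3) \<Rightarrow> (real^2 \<Rightarrow> complex \<times> complex) \<Rightarrow> bool" where
  "congruence_patch A S U f n L h \<longleftrightarrow>
     normal_patch A S U f n \<and> L \<in> line_charts A \<and>
     (\<forall>x\<in>U. fst (h x) \<in> chart_domain A \<and>
             (\<exists>r. \<forall>s. f x + s *\<^sub>R n x = L (fst (h x)) (snd (h x)) (r + s)))"

text \<open>
  The curvature of the induced metric involves three derivatives of \<open>h\<close>, whereas \<open>h\<close> is only
  of class \<open>C\<^sup>1\<close> for a general \<open>C\<^sup>2\<close> surface.  Existence of such patches means that \<open>S\<close> is of
  class \<open>C\<^sup>4\<close> as a subset of the ambient space.
\<close>

definition C3_normal_congruence :: "ambient \<Rightarrow> (real^3) set \<Rightarrow> bool" where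
  "C3_normal_congruence A S \<longleftrightarrow>
     (\<forall>p\<in>S. \<exists>U f n L h. congruence_patch A S U f n L h \<and> Ck_on 3 h U \<and> p \<in> f ` U)"

definition induced_metric ::
    "ambient \<Rightarrow> (real^2 \<Rightarrow> complex \<times> complex) \<Rightarrow> real^2 \<Rightarrow> real^2^2" where
  "induced_metric A h x =
     (\<chi> i j. neutral_metric A (h x) (pderivative i h x) (pderivative j h x))"

text \<open>The induced metric degenerates exactly at the umbilic points of \<open>S\<close>.\<close>

definition scalar_flat_normal_congruence :: "ambient \<Rightarrow> (real^3) set \<Rightarrow> bool" where
  "scalar_flat_normal_congruence A S \<longleftrightarrow>
     (\<forall>U f n L h. congruence_patch A S U f n L h \<and> Ck_on 3 h U \<longrightarrow>
        (\<forall>x\<in>U. det (induced_metric A h x) \<noteq> 0 \<longrightarrow> scalar_curvature (induced_metric A h) x = 0))"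

end

theory Submission
  imports Defs
begin

text \<open>
  Write the normal line at \<open>f\<close> with unit normal \<open>n\<close> as foot point plus direction.  The neutral
  metric then induces \<open>g(X, Y) = det(df X, dn Y, n) + det(df Y, dn X, n)\<close>, a form that is
  insensitive to sliding \<open>f\<close> along its normals.  In a principal orthonormal coframe
  \<open>\<theta>\<^sub>1, \<theta>\<^sub>2\<close> this is \<open>- D (\<theta>\<^sub>1 \<otimes> \<theta>\<^sub>2 + \<theta>\<^sub>2 \<otimes> \<theta>\<^sub>1)\<close> with \<open>D = \<lambda>\<^sub>2 - \<lambda>\<^sub>1\<close>, so
  \<open>a = - D \<theta>\<^sub>1\<close> and \<open>b = \<theta>\<^sub>2\<close> form a null coframe.  The Codazzi equations say exactly that
  \<open>da = - \<omega> \<and> a\<close> and \<open>db = \<omega> \<and> b\<close> for \<open>\<omega> = - d\<lambda>\<^sub>2 / D\<close>.  Hence the scalar curvature is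
  \<open>2 d\<omega> / (a \<and> b) = 2 (d\<lambda>\<^sub>1 \<and> d\<lambda>\<^sub>2) / (D\<^sup>3 \<theta>\<^sub>1 \<and> \<theta>\<^sub>2)\<close>, which vanishes together with
  \<open>d\<lambda>\<^sub>1 \<and> d\<lambda>\<^sub>2\<close> off the umbilic points.

  A \<open>C\<^sup>2\<close> patch need not have a \<open>C\<^sup>3\<close> congruence, but it factors locally through one that does.
  The second fundamental form \<open>- \<langle>df, dn\<rangle>\<close> contains only first derivatives, so the
  principal curvatures of the two patches agree up to a common sign.
\<close>

section \<open>Functions of class C^k\<close>

text \<open>Sliding the foot points replaces \<open>df\<close> by \<open>df + r dn + dr n\<close>.
  In the triple product the new terms either contain \<open>n\<close> twice or are antisymmetric in
  X and Y, so symmetrisation removes them. For the same reason the whole form vanishes at an umbilic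
  point, where \<open>dn\<close> is proportional to \<open>df\<close>.

  A null coframe suits the problem because the Lie algebra of SO(1,1) is one-dimensional: the
  curvature is the differential of a single connection form, without quadratic terms. Sharing the
  factor - D differently between a and b would change \<omega> by an exact form only. With all of it
  in a, the differential of \<omega> can be read off from d(d\<lambda>2) = 0 and dD \<and>
  d\<lambda>2 = - d\<lambda>1 \<and> d\<lambda>2.

  Two matters of regularity shape the proof. A patch with a C^3 congruence is itself given as C^2
  only, and has to be shown to be C^3 before its metric can be differentiated twice. The principal
  curvatures are a minimum and a maximum, smooth only where they differ; at umbilic points the wedge
  product is handled by first-order contact of the two functions.\<close>

lemma has_derivative_cong_open:
  assumes "open U" "x \<in> U" "\<And>y. y \<in> U \<Longrightarrow> f y = g y"
  shows "(f has_derivative D) (at x) \<longleftrightarrow> (g has_derivative D) (at x)"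
  by (metis assms has_derivative_transform_within_open)

lemma frechet_derivative_cong_open:
  assumes "open U" "x \<in> U" "\<And>y. y \<in> U \<Longrightarrow> f y = g y"
  shows "frechet_derivative f (at x) = frechet_derivative g (at x)"
  unfolding frechet_derivative_def by (simp add: has_derivative_cong_open[OF assms])

lemma Ck_on_cong:
  assumes "open U" "\<And>x. x \<in> U \<Longrightarrow> f x = g x"
  shows "Ck_on k f U \<longleftrightarrow> Ck_on k g U"
  using assms(2)
proof (induction k arbitrary: f g)
  case 0
  then show ?case by (auto intro: continuous_on_cong)
next
  case (Suc k)
  have "f differentiable (at x) \<longleftrightarrow> g differentiable (at x)" if "x \<in> U" for x
    unfolding differentiable_def using Suc.prems
    by (simp add: has_derivative_cong_open[OF assms(1) that, of f g])
  moreover have "Ck_on k (\<lambda>x. frechet_derivative f (at x) v) U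
      \<longleftrightarrow> Ck_on k (\<lambda>x. frechet_derivative g (at x) v) U" for v
    by (rule Suc.IH) (simp add: frechet_derivative_cong_open[OF assms(1) _ Suc.prems])
  ultimately show ?case by auto
qed

lemma Ck_on_has_derivative:
  assumes "Ck_on (Suc k) f U" "x \<in> U"
  shows "(f has_derivative frechet_derivative f (at x)) (at x)"
  using assms frechet_derivative_works by auto

lemma Ck_on_derivative: "Ck_on (Suc k) f U \<Longrightarrow> Ck_on k (\<lambda>x. frechet_derivative f (at x) v) U"
  by simp

text \<open>The inductive closure lemmas below pass through this rule: a calculus rule supplies
  \<open>D\<close>, and \<open>D x v\<close> is again built from functions covered by the induction
  hypothesis.\<close>

lemma Ck_on_SucI:
  assumes "open U" "\<And>x. x \<in> U \<Longrightarrow> (f has_derivative D x) (at x)"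
    and "\<And>v. Ck_on k (\<lambda>x. D x v) U"
  shows "Ck_on (Suc k) f U"
proof -
  have "frechet_derivative f (at x) = D x" if "x \<in> U" for x
    using assms(2)[OF that] frechet_derivative_at by metis
  then have "Ck_on k (\<lambda>x. frechet_derivative f (at x) v) U" for v
    using assms(3)[of v] Ck_on_cong[OF assms(1), of "\<lambda>x. frechet_derivative f (at x) v" "\<lambda>x. D x v"]
    by simp
  then show ?thesis using assms(2) by (auto simp: differentiable_def)
qed

lemma Ck_on_SucD: "Ck_on (Suc k) f U \<Longrightarrow> Ck_on k f U"
proof (induction k arbitrary: f)
  case 0
  then show ?case
    by (auto intro!: differentiable_imp_continuous_on differentiable_at_imp_differentiable_on)
next
  case (Suc k)
  then show ?case by (meson Ck_on.simps(2))
qed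

lemma Ck_on_mono: "Ck_on k f U \<Longrightarrow> j \<le> k \<Longrightarrow> Ck_on j f U"
  by (induction k) (auto simp: le_Suc_eq dest: Ck_on_SucD simp del: Ck_on.simps(2))

lemma Ck_on_continuous: "Ck_on k f U \<Longrightarrow> continuous_on U f"
  using Ck_on_mono[of k f U 0] by simp

lemma Ck_on_subset: "Ck_on k f U \<Longrightarrow> V \<subseteq> U \<Longrightarrow> Ck_on k f V"
  by (induction k arbitrary: f) (auto intro: continuous_on_subset)

lemma Ck_on_const: "open U \<Longrightarrow> Ck_on k (\<lambda>x. c) U"
proof (induction k arbitrary: c)
  case (Suc k)
  show ?case
    by (rule Ck_on_SucI[OF Suc.prems has_derivative_const]) (rule Suc.IH[OF Suc.prems])
qed simp

lemma Ck_on_linear: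
  assumes "open U" "bounded_linear L" "Ck_on k f U"
  shows "Ck_on k (\<lambda>x. L (f x)) U"
  using assms(3)
proof (induction k arbitrary: f)
  case 0
  then show ?case using assms(2)
    by (simp add: bounded_linear.continuous_on)
next
  case (Suc k)
  show ?case
  proof (rule Ck_on_SucI[OF assms(1)])
    show "((\<lambda>x. L (f x)) has_derivative (\<lambda>v. L (frechet_derivative f (at x) v))) (at x)" if "x \<in> U" for x
      using bounded_linear.has_derivative[OF assms(2) Ck_on_has_derivative[OF Suc.prems that]] .
    show "Ck_on k (\<lambda>x. L (frechet_derivative f (at x) v)) U" for v
      by (rule Suc.IH[OF Ck_on_derivative[OF Suc.prems]])
  qed
qed

lemma Ck_on_add:
  assumes "open U" "Ck_on k f U" "Ck_on k g U"
  shows "Ck_on k (\<lambda>x. f x + g x) U"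
  using assms(2,3)
proof (induction k arbitrary: f g)
  case 0
  then show ?case by (simp add: continuous_on_add)
next
  case (Suc k)
  show ?case
    by (rule Ck_on_SucI[OF assms(1) has_derivative_add[OF
          Ck_on_has_derivative[OF Suc.prems(1)] Ck_on_has_derivative[OF Suc.prems(2)]]])
      (auto intro!: Suc.IH[OF Ck_on_derivative[OF Suc.prems(1)] Ck_on_derivative[OF Suc.prems(2)]])
qed

lemma Ck_on_minus: "open U \<Longrightarrow> Ck_on k f U \<Longrightarrow> Ck_on k (\<lambda>x. - f x) U"
  by (rule Ck_on_linear[of U "\<lambda>x. - x"]) (auto intro: bounded_linear_minus bounded_linear_ident)

lemma Ck_on_diff:
  assumes "open U" "Ck_on k f U" "Ck_on k g U"
  shows "Ck_on k (\<lambda>x. f x - g x) U"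
  using Ck_on_add[OF assms(1,2) Ck_on_minus[OF assms(1,3)]] by simp

lemma Ck_on_bilinear:
  assumes "open U" "bounded_bilinear B" "Ck_on k f U" "Ck_on k g U"
  shows "Ck_on k (\<lambda>x. B (f x) (g x)) U"
  using assms(3,4)
proof (induction k arbitrary: f g)
  case 0
  then show ?case using assms(2)
    by (simp add: bounded_bilinear.continuous_on)
next
  case (Suc k)
  note f = Ck_on_derivative[OF Suc.prems(1)] and g = Ck_on_derivative[OF Suc.prems(2)]
  show ?case
    by (rule Ck_on_SucI[OF assms(1) bounded_bilinear.FDERIV[OF assms(2)
          Ck_on_has_derivative[OF Suc.prems(1)] Ck_on_has_derivative[OF Suc.prems(2)]]])
      (auto intro!: Ck_on_add[OF assms(1)] Suc.IH f g Ck_on_SucD[OF Suc.prems(1)] Ck_on_SucD[OF Suc.prems(2)]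
        simp del: Ck_on.simps)
qed

lemmas Ck_on_mult = Ck_on_bilinear[OF _ bounded_bilinear_mult]
lemmas Ck_on_scaleR = Ck_on_bilinear[OF _ bounded_bilinear_scaleR]

text \<open>The derivative is a product of \<open>inverse (f x)\<close> with itself and with the
  derivative of \<open>f\<close>, so the induction keeps \<open>f\<close> fixed and uses the result
  one order lower. The square root is treated in the same way.\<close>

lemma Ck_on_inverse:
  fixes f :: "'a::real_normed_vector \<Rightarrow> real"
  assumes "open U" "Ck_on k f U" "\<And>x. x \<in> U \<Longrightarrow> f x \<noteq> 0"
  shows "Ck_on k (\<lambda>x. inverse (f x)) U"
  using assms(2)
proof (induction k)
  case 0
  then show ?case using assms(3) by (simp add: continuous_on_inverse)
next
  case (Suc k)
  note I = Suc.IH[OF Ck_on_SucD[OF Suc.prems]]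
  show ?case
  proof (rule Ck_on_SucI[OF assms(1)])
    show "((\<lambda>x. inverse (f x)) has_derivative
        (\<lambda>v. - (inverse (f x) * frechet_derivative f (at x) v * inverse (f x)))) (at x)" if "x \<in> U" for x
      using Deriv.has_derivative_inverse[OF assms(3)[OF that] Ck_on_has_derivative[OF Suc.prems that]] .
    show "Ck_on k (\<lambda>x. - (inverse (f x) * frechet_derivative f (at x) v * inverse (f x))) U" for v
      by (intro Ck_on_minus Ck_on_mult assms(1) I Ck_on_derivative[OF Suc.prems])
  qed
qed

lemma Ck_on_divide:
  fixes f g :: "'a::real_normed_vector \<Rightarrow> real"
  assumes "open U" "Ck_on k f U" "Ck_on k g U" "\<And>x. x \<in> U \<Longrightarrow> g x \<noteq> 0"
  shows "Ck_on k (\<lambda>x. f x / g x) U"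
  unfolding divide_inverse by (intro Ck_on_mult Ck_on_inverse assms)

lemma Ck_on_sqrt:
  assumes "open U" "Ck_on k f U" "\<And>x. x \<in> U \<Longrightarrow> f x > 0"
  shows "Ck_on k (\<lambda>x. sqrt (f x)) U"
  using assms(2)
proof (induction k)
  case 0
  then show ?case by (simp add: continuous_on_real_sqrt)
next
  case (Suc k)
  note I = Suc.IH[OF Ck_on_SucD[OF Suc.prems]]
  show ?case
  proof (rule Ck_on_SucI[OF assms(1)])
    show "((\<lambda>x. sqrt (f x)) has_derivative
        (\<lambda>v. frechet_derivative f (at x) v * inverse (2 * sqrt (f x)))) (at x)" if "x \<in> U" for x
      using has_derivative_real_sqrt[OF assms(3)[OF that] Ck_on_has_derivative[OF Suc.prems that]]
      by (simp only: divide_inverse inverse_mult_distrib mult_ac)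
    show "Ck_on k (\<lambda>x. frechet_derivative f (at x) v * inverse (2 * sqrt (f x))) U" for v
      using assms(3)
      by (intro Ck_on_mult Ck_on_inverse Ck_on_const assms(1) I Ck_on_derivative[OF Suc.prems])
        (auto dest!: assms(3))
  qed
qed

text \<open>Writing the vector as a combination of basis vectors reduces the claim to sums and
  scalar multiples.\<close>

lemma Ck_on_vec_lambda:
  fixes f :: "'a::real_normed_vector \<Rightarrow> 'n::finite \<Rightarrow> real"
  assumes "open U" "\<And>i. Ck_on k (\<lambda>x. f x i) U"
  shows "Ck_on k (\<lambda>x. \<chi> i. f x i) U"
proof -
  have eq: "(\<chi> i. f x i) = (\<Sum>i\<in>UNIV. f x i *\<^sub>R axis i 1)" for x
    by (simp add: vec_eq_iff axis_def if_distrib cong: if_cong)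
  have "Ck_on k (\<lambda>x. \<Sum>i\<in>F. f x i *\<^sub>R axis i 1) U" if "finite F" for F
    using that
  proof (induction F)
    case (insert i F)
    then show ?case
      unfolding sum.insert[OF insert.hyps] by (intro Ck_on_add Ck_on_scaleR Ck_on_const assms)
  qed (simp only: sum.empty Ck_on_const assms)
  then show ?thesis unfolding eq by simp
qed

section \<open>Symmetry of second derivatives\<close>

lemma second_difference_mean_value:
  fixes f :: "'a::real_normed_vector \<Rightarrow> real"
  assumes "open U" "Ck_on 2 f U" "h > 0"
    and U: "\<And>s t. 0 \<le> s \<Longrightarrow> s \<le> h \<Longrightarrow> 0 \<le> t \<Longrightarrow> t \<le> h \<Longrightarrow> x + s *\<^sub>R v + t *\<^sub>R w \<in> U"
  shows "\<exists>s t. 0 < s \<and> s < h \<and> 0 < t \<and> t < h \<and>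
    f (x + h *\<^sub>R v + h *\<^sub>R w) - f (x + h *\<^sub>R v) - f (x + h *\<^sub>R w) + f x =
    h * h * frechet_derivative (\<lambda>y. frechet_derivative f (at y) v) (at (x + s *\<^sub>R v + t *\<^sub>R w)) w"
proof -
  note C2 = assms(2)[unfolded numeral_2_eq_2]
  define fv where "fv y = frechet_derivative f (at y) v" for y
  have df: "(f has_derivative frechet_derivative f (at y)) (at y)" if "y \<in> U" for y
    by (rule Ck_on_has_derivative[OF C2 that])
  have dfv: "(fv has_derivative frechet_derivative fv (at y)) (at y)" if "y \<in> U" for y
    using Ck_on_has_derivative[OF Ck_on_derivative[OF C2] that] unfolding fv_def .
  have scale: "frechet_derivative f (at y) (r *\<^sub>R u) = r * frechet_derivative f (at y) u" if "y \<in> U" for y r u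
    using linear_cmul[OF has_derivative_linear[OF df[OF that]]] by simp
  have scalev: "frechet_derivative fv (at y) (r *\<^sub>R u) = r * frechet_derivative fv (at y) u" if "y \<in> U" for y r u
    using linear_cmul[OF has_derivative_linear[OF dfv[OF that]]] by simp
  \<comment> \<open>The second difference is \<open>G h - G 0\<close>. The mean value theorem in
    direction \<open>v\<close>, then in direction \<open>w\<close>, produces the iterated derivative
    in this order.\<close>
  define G where "G s = f (x + s *\<^sub>R v + h *\<^sub>R w) - f (x + s *\<^sub>R v)" for s
  have dline: "((\<lambda>s. f (p + s *\<^sub>R v)) has_real_derivative fv (p + s *\<^sub>R v)) (at s)" if "p + s *\<^sub>R v \<in> U" for p s
  proof -
    have "((\<lambda>s. p + s *\<^sub>R v) has_derivative (\<lambda>r. r *\<^sub>R v)) (at s)"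
      by (auto intro!: derivative_eq_intros)
    from has_derivative_compose[OF this df[OF that]]
    show ?thesis unfolding has_field_derivative_def fv_def by (simp add: scale[OF that] mult_commute_abs)
  qed
  have dline2: "((\<lambda>t. fv (p + t *\<^sub>R w)) has_real_derivative frechet_derivative fv (at (p + t *\<^sub>R w)) w) (at t)"
    if "p + t *\<^sub>R w \<in> U" for p t
  proof -
    have "((\<lambda>t. p + t *\<^sub>R w) has_derivative (\<lambda>r. r *\<^sub>R w)) (at t)"
      by (auto intro!: derivative_eq_intros)
    from has_derivative_compose[OF this dfv[OF that]]
    show ?thesis unfolding has_field_derivative_def by (simp add: scalev[OF that] mult_commute_abs)
  qed
  have dG: "(G has_real_derivative fv (x + s *\<^sub>R v + h *\<^sub>R w) - fv (x + s *\<^sub>R v)) (at s)"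
    if "0 \<le> s" "s \<le> h" for s
  proof -
    have "(x + h *\<^sub>R w) + s *\<^sub>R v \<in> U" "x + s *\<^sub>R v \<in> U"
      using U[of s h] U[of s 0] that assms(3) by (simp_all add: add_ac)
    from DERIV_diff[OF dline[OF this(1)] dline[OF this(2)]] show ?thesis
      unfolding G_def by (simp add: add_ac)
  qed
  from MVT2[of 0 h G "\<lambda>s. fv (x + s *\<^sub>R v + h *\<^sub>R w) - fv (x + s *\<^sub>R v)", OF assms(3) dG]
  obtain s where s: "0 < s" "s < h" "G h - G 0 = h * (fv (x + s *\<^sub>R v + h *\<^sub>R w) - fv (x + s *\<^sub>R v))"
    by auto
  have "((\<lambda>t. fv (x + s *\<^sub>R v + t *\<^sub>R w)) has_real_derivative
      frechet_derivative fv (at (x + s *\<^sub>R v + t *\<^sub>R w)) w) (at t)" if "0 \<le> t" "t \<le> h" for t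
    by (rule dline2) (use U[of s t] s that in auto)
  from MVT2[of 0 h _ "\<lambda>t. frechet_derivative fv (at (x + s *\<^sub>R v + t *\<^sub>R w)) w", OF assms(3) this]
  obtain t where t: "0 < t" "t < h" "fv (x + s *\<^sub>R v + h *\<^sub>R w) - fv (x + s *\<^sub>R v) =
      h * frechet_derivative fv (at (x + s *\<^sub>R v + t *\<^sub>R w)) w"
    by auto
  show ?thesis
    using s t unfolding G_def fv_def[abs_def]
    by (intro exI[of _ s] exI[of _ t]) (simp add: algebra_simps)
qed

text \<open>The second difference over a parallelogram is symmetric in \<open>v\<close> and
  \<open>w\<close>. Its two mean value forms express one number through both mixed derivatives at
  points close to \<open>x\<close>, and continuity transfers the equality to
  \<open>x\<close>.\<close>

lemma second_derivative_symmetric_real: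
  fixes f :: "'a::real_normed_vector \<Rightarrow> real"
  assumes "open U" "Ck_on 2 f U" "x \<in> U"
  shows "frechet_derivative (\<lambda>y. frechet_derivative f (at y) v) (at x) w =
         frechet_derivative (\<lambda>y. frechet_derivative f (at y) w) (at x) v" (is "?F x = ?G x")
proof (rule ccontr)
  assume ne: "?F x \<noteq> ?G x"
  \<comment> \<open>Half the supposed gap: no number is closer than \<open>e\<close> to both
    \<open>?F x\<close> and \<open>?G x\<close>.\<close>
  define e where "e = \<bar>?F x - ?G x\<bar> / 2"
  have "e > 0" using ne unfolding e_def by simp
  have c: "continuous_on U ?F" "continuous_on U ?G"
    using assms(2) unfolding numeral_2_eq_2 by auto
  obtain d1 where d1: "d1 > 0" "\<And>y. y \<in> U \<Longrightarrow> dist y x < d1 \<Longrightarrow> dist (?F y) (?F x) < e"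
    using c(1) \<open>e > 0\<close> assms(3) unfolding continuous_on_iff by metis
  obtain d2 where d2: "d2 > 0" "\<And>y. y \<in> U \<Longrightarrow> dist y x < d2 \<Longrightarrow> dist (?G y) (?G x) < e"
    using c(2) \<open>e > 0\<close> assms(3) unfolding continuous_on_iff by metis
  obtain d3 where d3: "d3 > 0" "ball x d3 \<subseteq> U"
    using assms(1,3) openE by blast
  define d where "d = min d1 (min d2 d3)"
  have d: "d > 0" using d1 d2 d3 unfolding d_def by auto
  \<comment> \<open>The side is so small that the whole parallelogram stays within distance
    \<open>d\<close> of \<open>x\<close>; the summand 1 covers \<open>v = w = 0\<close>.\<close>
  define h where "h = d / (2 * (norm v + norm w + 1))"
  have h: "h > 0" unfolding h_def using d by (simp add: add_nonneg_pos)
  have near: "dist (x + s *\<^sub>R v + t *\<^sub>R w) x < d" if "0 \<le> s" "s \<le> h" "0 \<le> t" "t \<le> h" for s t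
  proof -
    have "dist (x + s *\<^sub>R v + t *\<^sub>R w) x = norm (s *\<^sub>R v + t *\<^sub>R w)"
      by (simp add: dist_norm add.assoc)
    also have "\<dots> \<le> s * norm v + t * norm w"
      using norm_triangle_ineq[of "s *\<^sub>R v" "t *\<^sub>R w"] that by simp
    also have "\<dots> \<le> h * norm v + h * norm w"
      using that by (intro add_mono mult_right_mono) auto
    also have "\<dots> < h * (2 * (norm v + norm w + 1))"
      unfolding distrib_left[symmetric] using h
      by (intro mult_strict_left_mono) (smt (verit) norm_ge_zero)
    also have "\<dots> = d"
      unfolding h_def by (simp add: divide_simps add_nonneg_eq_0_iff)
    finally show ?thesis .
  qed
  have inU: "x + s *\<^sub>R v + t *\<^sub>R w \<in> U" if "0 \<le> s" "s \<le> h" "0 \<le> t" "t \<le> h" for s t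
    using near[OF that] d3(2) unfolding d_def by (auto simp: mem_ball dist_commute)
  have inU': "x + s *\<^sub>R w + t *\<^sub>R v \<in> U" if "0 \<le> s" "s \<le> h" "0 \<le> t" "t \<le> h" for s t
    using inU[OF that(3,4,1,2)] by (simp add: add_ac)
  obtain s t where 1: "0 < s" "s < h" "0 < t" "t < h"
    "f (x + h *\<^sub>R v + h *\<^sub>R w) - f (x + h *\<^sub>R v) - f (x + h *\<^sub>R w) + f x = h * h * ?F (x + s *\<^sub>R v + t *\<^sub>R w)"
    using second_difference_mean_value[OF assms(1,2) h inU] by auto
  obtain s' t' where 2: "0 < s'" "s' < h" "0 < t'" "t' < h"
    "f (x + h *\<^sub>R w + h *\<^sub>R v) - f (x + h *\<^sub>R w) - f (x + h *\<^sub>R v) + f x = h * h * ?G (x + s' *\<^sub>R w + t' *\<^sub>R v)"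
    using second_difference_mean_value[OF assms(1,2) h inU'] by auto
  have "h * h * ?F (x + s *\<^sub>R v + t *\<^sub>R w) = h * h * ?G (x + t' *\<^sub>R v + s' *\<^sub>R w)"
  proof -
    have "x + h *\<^sub>R w + h *\<^sub>R v = x + h *\<^sub>R v + h *\<^sub>R w" "x + s' *\<^sub>R w + t' *\<^sub>R v = x + t' *\<^sub>R v + s' *\<^sub>R w"
      by (simp_all add: add_ac)
    note 2(5)[unfolded this]
    with 1(5) show ?thesis by linarith
  qed
  then have eq: "?F (x + s *\<^sub>R v + t *\<^sub>R w) = ?G (x + t' *\<^sub>R v + s' *\<^sub>R w)" using h by simp
  have "dist (?F (x + s *\<^sub>R v + t *\<^sub>R w)) (?F x) < e"
    using 1 near[of s t] inU[of s t] by (intro d1) (auto simp: d_def)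
  moreover have "dist (?G (x + t' *\<^sub>R v + s' *\<^sub>R w)) (?G x) < e"
    using 2 near[of t' s'] inU[of t' s'] by (intro d2) (auto simp: d_def)
  moreover have False if "dist c a < \<bar>a - b\<bar> / 2" "dist c b < \<bar>a - b\<bar> / 2" for a b c :: real
    using dist_triangle3[of a b c] that by (simp add: dist_real_def[of a b])
  ultimately show False unfolding eq e_def by blast
qed

lemma frechet_derivative_linear:
  assumes "bounded_linear L" "f differentiable (at x)"
  shows "frechet_derivative (\<lambda>y. L (f y)) (at x) v = L (frechet_derivative f (at x) v)"
  using bounded_linear.has_derivative[OF assms(1) assms(2)[unfolded frechet_derivative_works]]
  by (metis frechet_derivative_at)

text \<open>Pairing with a basis vector is linear and commutes with derivatives, which leaves the
  real case.\<close>

lemma second_derivative_symmetric: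
  fixes f :: "'a::real_normed_vector \<Rightarrow> 'b::euclidean_space"
  assumes "open U" "Ck_on 2 f U" "x \<in> U"
  shows "frechet_derivative (\<lambda>y. frechet_derivative f (at y) v) (at x) w =
         frechet_derivative (\<lambda>y. frechet_derivative f (at y) w) (at x) v"
proof (rule euclidean_eqI)
  fix b :: 'b
  note C2 = assms(2)[unfolded numeral_2_eq_2]
  let ?L = "\<lambda>y::'b. y \<bullet> b"
  have L: "bounded_linear ?L" by (rule bounded_linear_inner_left)
  have f: "frechet_derivative (\<lambda>y. ?L (f y)) (at y) u = ?L (frechet_derivative f (at y) u)" if "y \<in> U" for y u
    by (rule frechet_derivative_linear[OF L]) (use C2 that in auto)
  have "frechet_derivative (\<lambda>y. frechet_derivative (\<lambda>y. ?L (f y)) (at y) u) (at x) u' =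
      ?L (frechet_derivative (\<lambda>y. frechet_derivative f (at y) u) (at x) u')" for u u'
  proof -
    have "frechet_derivative (\<lambda>y. frechet_derivative (\<lambda>y. ?L (f y)) (at y) u) (at x) =
        frechet_derivative (\<lambda>y. ?L (frechet_derivative f (at y) u)) (at x)"
      by (rule frechet_derivative_cong_open[OF assms(1,3) f])
    moreover have "frechet_derivative (\<lambda>y. ?L (frechet_derivative f (at y) u)) (at x) u' = ?L (frechet_derivative (\<lambda>y. frechet_derivative f (at y) u) (at x) u')"
      by (rule frechet_derivative_linear[OF L]) (use C2 assms(3) in auto)
    ultimately show ?thesis by simp
  qed
  then show "?L (frechet_derivative (\<lambda>y. frechet_derivative f (at y) v) (at x) w) =
      ?L (frechet_derivative (\<lambda>y. frechet_derivative f (at y) w) (at x) v)"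
    using second_derivative_symmetric_real[OF assms(1) Ck_on_linear[OF assms(1) L assms(2)] assms(3), of v w]
    by simp
qed

section \<open>The scalar curvature in a null coframe\<close>

lemma pderivative_cong_open:
  assumes "open U" "x \<in> U" "\<And>y. y \<in> U \<Longrightarrow> f y = g y"
  shows "pderivative i f x = pderivative i g x"
  unfolding pderivative_def
  by (rule fun_cong[where x = "axis i 1"]) (rule frechet_derivative_cong_open[OF assms])

lemma pderivative_add:
  assumes "f differentiable (at x)" "g differentiable (at x)"
  shows "pderivative i (\<lambda>y. f y + g y) x = pderivative i f x + pderivative i g x"
  using fun_cong[OF frechet_derivative_at[OF has_derivative_add[OF assms[unfolded frechet_derivative_works]]]]
  by (simp add: pderivative_def)

lemma pderivative_diff:
  assumes "f differentiable (at x)" "g differentiable (at x)"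
  shows "pderivative i (\<lambda>y. f y - g y) x = pderivative i f x - pderivative i g x"
  using fun_cong[OF frechet_derivative_at[OF has_derivative_diff[OF assms[unfolded frechet_derivative_works]]]]
  by (simp add: pderivative_def)

lemma pderivative_mult:
  fixes f g :: "real^'n::finite \<Rightarrow> real"
  assumes "f differentiable (at x)" "g differentiable (at x)"
  shows "pderivative i (\<lambda>y. f y * g y) x = f x * pderivative i g x + pderivative i f x * g x"
  using fun_cong[OF frechet_derivative_at[OF has_derivative_mult[OF assms[unfolded frechet_derivative_works]]]]
  by (simp add: pderivative_def)

lemma Ck_on_pderivative: "Ck_on (Suc k) f U \<Longrightarrow> Ck_on k (pderivative i f) U"
  unfolding pderivative_def[abs_def] by simp

lemma Ck_on_differentiable: "Ck_on (Suc k) f U \<Longrightarrow> x \<in> U \<Longrightarrow> f differentiable (at x)"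
  by simp

lemma matrix_inv_eqI:
  fixes M N :: "real^'n::finite^'n"
  assumes "M ** N = mat 1"
  shows "matrix_inv M = N"
proof -
  have "\<exists>N. M ** N = mat 1 \<and> N ** M = mat 1"
    using assms matrix_left_right_inverse by blast
  then have "M ** matrix_inv M = mat 1 \<and> matrix_inv M ** M = mat 1"
    unfolding matrix_inv_def by (rule someI_ex)
  then show ?thesis
    by (metis assms matrix_mul_assoc matrix_mul_lid matrix_mul_rid)
qed

text \<open>\<open>da\<close> and \<open>db\<close> are the structure equations of a torsion-free
  connection that scales \<open>a\<close> by \<open>- w\<close> and \<open>b\<close> by
  \<open>w\<close>. It preserves the metric, so it is the Levi-Civita connection. Its connection
  matrix is diagonal, hence the curvature operator multiplies \<open>a\<close> by dw and
  \<open>b\<close> by - dw, and contraction with the inverse metric counts both.\<close>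

lemma scalar_curvature_null_coframe:
  fixes a b w :: "2 \<Rightarrow> real^2 \<Rightarrow> real"
  assumes U: "open U" "x \<in> U"
    and a: "\<And>i. Ck_on 2 (a i) U" and b: "\<And>i. Ck_on 2 (b i) U" and w: "\<And>i. Ck_on 1 (w i) U"
    and g: "\<And>y i j. y \<in> U \<Longrightarrow> g y $ i $ j = a i y * b j y + a j y * b i y"
    and nz: "\<And>y. y \<in> U \<Longrightarrow> a 1 y * b 2 y - a 2 y * b 1 y \<noteq> 0"
    and da: "\<And>y i j. y \<in> U \<Longrightarrow>
      pderivative i (a j) y - pderivative j (a i) y = - (w i y * a j y - w j y * a i y)"
    and db: "\<And>y i j. y \<in> U \<Longrightarrow>
      pderivative i (b j) y - pderivative j (b i) y = w i y * b j y - w j y * b i y"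
  shows "scalar_curvature g x =
    2 * (pderivative 1 (w 2) x - pderivative 2 (w 1) x) / (a 1 x * b 2 x - a 2 x * b 1 x)"
proof -
  define \<Delta> where "\<Delta> y = a 1 y * b 2 y - a 2 y * b 1 y" for y
  \<comment> \<open>\<open>A\<close> and \<open>B\<close> are the vector fields dual to the coframe
    \<open>a\<close>, \<open>b\<close>, by Cramer's rule.\<close>
  define A where "A k y = (if k = 1 then b 2 y else - b 1 y) / \<Delta> y" for k :: 2 and y
  define B where "B k y = (if k = 1 then - a 2 y else a 1 y) / \<Delta> y" for k :: 2 and y
  \<comment> \<open>The Levi-Civita connection satisfies \<open>\<nabla>a = - w \<otimes> a\<close> and \<open>\<nabla>b = w \<otimes> b\<close>, which determines \<open>\<Gamma>\<close>.\<close>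
  define P where "P i j y = pderivative i (a j) y + w i y * a j y" for i j :: 2 and y
  define Q where "Q i j y = pderivative i (b j) y - w i y * b j y" for i j :: 2 and y
  define \<Gamma> where "\<Gamma> k i j y = A k y * P i j y + B k y * Q i j y" for i j k :: 2 and y
  note [simp] = sum_2
  have \<Delta>: "\<Delta> y \<noteq> 0" if "y \<in> U" for y using nz[OF that] unfolding \<Delta>_def .
  have dual: "A 1 y * a 1 y + A 2 y * a 2 y = 1" "A 1 y * b 1 y + A 2 y * b 2 y = 0"
    "B 1 y * a 1 y + B 2 y * a 2 y = 0" "B 1 y * b 1 y + B 2 y * b 2 y = 1" if "y \<in> U" for y
    using \<Delta>[OF that] unfolding A_def B_def by (simp_all add: field_simps) (simp_all add: \<Delta>_def)
  have dual': "A k y * a l y + B k y * b l y = (if k = l then 1 else 0)" if "y \<in> U" for k l y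
    using exhaust_2[of k] exhaust_2[of l] \<Delta>[OF that] unfolding A_def B_def
    by (auto simp: field_simps) (simp_all add: \<Delta>_def)
  have inv: "matrix_inv (g y) $ k $ l = A k y * B l y + A l y * B k y" if y: "y \<in> U" for y k l
  proof -
    define M where "M = (\<chi> k l. A k y * B l y + A l y * B k y)"
    have "(g y ** M) $ i $ j = mat 1 $ i $ j" for i j
    proof -
      have "(g y ** M) $ i $ j = (A 1 y * a 1 y + A 2 y * a 2 y) * b i y * B j y
        + (A 1 y * b 1 y + A 2 y * b 2 y) * a i y * B j y
        + (B 1 y * a 1 y + B 2 y * a 2 y) * b i y * A j y
        + (B 1 y * b 1 y + B 2 y * b 2 y) * a i y * A j y"
        unfolding matrix_matrix_mult_def M_def using y by (simp add: g algebra_simps)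
      also have "\<dots> = A j y * a i y + B j y * b i y"
        by (simp add: dual[OF y])
      finally show ?thesis by (simp add: dual'[OF y] mat_def)
    qed
    then have "g y ** M = mat 1" by (simp add: vec_eq_iff)
    then have "matrix_inv (g y) = M"
      by (rule matrix_inv_eqI)
    then show ?thesis by (simp add: M_def)
  qed
  have Da: "a i differentiable (at y)" and Db: "b i differentiable (at y)" and Dw: "w i differentiable (at y)"
    if "y \<in> U" for y i
    using a[of i] b[of i] w[of i] that by (auto simp: numeral_2_eq_2)
  have Dg: "pderivative m (\<lambda>y. g y $ i $ j) y =
      a i y * pderivative m (b j) y + pderivative m (a i) y * b j y
      + (a j y * pderivative m (b i) y + pderivative m (a j) y * b i y)" if y: "y \<in> U" for m i j y
  proof -
    have "pderivative m (\<lambda>y. g y $ i $ j) y = pderivative m (\<lambda>y. a i y * b j y + a j y * b i y) y"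
      by (rule pderivative_cong_open[OF U(1) y g])
    also have "\<dots> = pderivative m (\<lambda>y. a i y * b j y) y + pderivative m (\<lambda>y. a j y * b i y) y"
      by (rule pderivative_add) (intro differentiable_mult Da Db y)+
    finally show ?thesis by (simp add: pderivative_mult Da Db y)
  qed
  have ch: "christoffel g k i j y = \<Gamma> k i j y" if y: "y \<in> U" for k i j y
  proof -
    have "pderivative i (\<lambda>y. g y $ j $ l) y + pderivative j (\<lambda>y. g y $ i $ l) y
        - pderivative l (\<lambda>y. g y $ i $ j) y = 2 * (P i j y * b l y + Q i j y * a l y)" for l
    proof -
      \<comment> \<open>The structure equations trade the index of differentiation against that of
        the component; after that the terms other than \<open>P\<close> and \<open>Q\<close>
        cancel.\<close>
      have s: "pderivative j (a i) y = pderivative i (a j) y + (w i y * a j y - w j y * a i y)"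
        "pderivative l (a i) y = pderivative i (a l) y + (w i y * a l y - w l y * a i y)"
        "pderivative l (a j) y = pderivative j (a l) y + (w j y * a l y - w l y * a j y)"
        "pderivative j (b i) y = pderivative i (b j) y - (w i y * b j y - w j y * b i y)"
        "pderivative l (b i) y = pderivative i (b l) y - (w i y * b l y - w l y * b i y)"
        "pderivative l (b j) y = pderivative j (b l) y - (w j y * b l y - w l y * b j y)"
        using da[OF y, of i j] da[OF y, of i l] da[OF y, of j l]
          db[OF y, of i j] db[OF y, of i l] db[OF y, of j l] by linarith+
      show ?thesis unfolding P_def Q_def Dg[OF y] unfolding s by algebra
    qed
    then have "christoffel g k i j y = (\<Sum>l\<in>UNIV. (A k y * B l y + A l y * B k y) *
        (2 * (P i j y * b l y + Q i j y * a l y))) / 2"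
      unfolding christoffel_def by (simp add: inv[OF y])
    also have "\<dots> = A k y * P i j y * (B 1 y * b 1 y + B 2 y * b 2 y)
      + A k y * Q i j y * (B 1 y * a 1 y + B 2 y * a 2 y)
      + B k y * P i j y * (A 1 y * b 1 y + A 2 y * b 2 y)
      + B k y * Q i j y * (A 1 y * a 1 y + A 2 y * a 2 y)"
      by (simp add: field_simps)
    also have "\<dots> = \<Gamma> k i j y" by (simp add: dual[OF y] \<Gamma>_def)
    finally show ?thesis .
  qed
  note a' = a[unfolded numeral_2_eq_2] and b' = b[unfolded numeral_2_eq_2] and w' = w[unfolded One_nat_def]
  have C\<Delta>: "Ck_on 1 \<Delta> U"
    unfolding \<Delta>_def[abs_def] One_nat_def
    by (intro Ck_on_diff Ck_on_mult U(1) Ck_on_SucD[OF a'] Ck_on_SucD[OF b'])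
  have C_if: "Ck_on 1 (\<lambda>y. (if c then p y else q y) / \<Delta> y) U" if "Ck_on 1 p U" "Ck_on 1 q U" for c p q
    by (cases c; simp only: if_True if_False; intro Ck_on_divide U(1) C\<Delta> \<Delta> that)
  have CA: "Ck_on 1 (A k) U" and CB: "Ck_on 1 (B k) U" for k
    unfolding A_def[abs_def] B_def[abs_def]
    by (intro C_if Ck_on_minus U(1) Ck_on_SucD[OF a', folded One_nat_def] Ck_on_SucD[OF b', folded One_nat_def])+
  have CP: "Ck_on 1 (P i j) U" and CQ: "Ck_on 1 (Q i j) U" for i j
    unfolding P_def[abs_def] Q_def[abs_def] One_nat_def
    by (intro Ck_on_add Ck_on_diff Ck_on_mult U(1) Ck_on_pderivative a' b' w' Ck_on_SucD[OF a'] Ck_on_SucD[OF b'])+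
  have C\<Gamma>: "Ck_on 1 (\<Gamma> k i j) U" for k i j
    unfolding \<Gamma>_def[abs_def] by (intro Ck_on_add Ck_on_mult U(1) CA CB CP CQ)
  have D\<Gamma>: "\<Gamma> k i j differentiable (at x)" for k i j
    using C\<Gamma>[of k i j] U(2) unfolding One_nat_def by simp
  have Dch: "pderivative m (christoffel g k i j) x = pderivative m (\<Gamma> k i j) x" for m k i j
    by (rule pderivative_cong_open[OF U ch])
  have aG: "a 1 y * \<Gamma> 1 i j y + a 2 y * \<Gamma> 2 i j y = P i j y"
    and bG: "b 1 y * \<Gamma> 1 i j y + b 2 y * \<Gamma> 2 i j y = Q i j y" if "y \<in> U" for i j y
    using dual[OF that] unfolding \<Gamma>_def by algebra+
  \<comment> \<open>Differentiating the relation \<open>aG\<close> rather than the quotients in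
    \<open>\<Gamma>\<close> avoids derivatives of \<open>A\<close> and \<open>B\<close>.\<close>
  have daG: "a 1 x * pderivative m (\<Gamma> 1 i j) x + a 2 x * pderivative m (\<Gamma> 2 i j) x =
      pderivative m (pderivative i (a j)) x + (w i x * pderivative m (a j) x + pderivative m (w i) x * a j x)
      - (pderivative m (a 1) x * \<Gamma> 1 i j x + pderivative m (a 2) x * \<Gamma> 2 i j x)" for m i j
  proof -
    have "pderivative m (\<lambda>y. a 1 y * \<Gamma> 1 i j y + a 2 y * \<Gamma> 2 i j y) x
      = pderivative m (\<lambda>y. pderivative i (a j) y + w i y * a j y) x"
      by (rule pderivative_cong_open[OF U]) (simp add: aG P_def)
    moreover have "pderivative i (a j) differentiable (at x)"
      by (rule Ck_on_differentiable[OF Ck_on_pderivative[OF a'] U(2)])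
    ultimately show ?thesis
      by (simp add: pderivative_add pderivative_mult Da Dw D\<Gamma> U(2) differentiable_mult)
  qed
  have dbG: "b 1 x * pderivative m (\<Gamma> 1 i j) x + b 2 x * pderivative m (\<Gamma> 2 i j) x =
      pderivative m (pderivative i (b j)) x - (w i x * pderivative m (b j) x + pderivative m (w i) x * b j x)
      - (pderivative m (b 1) x * \<Gamma> 1 i j x + pderivative m (b 2) x * \<Gamma> 2 i j x)" for m i j
  proof -
    have "pderivative m (\<lambda>y. b 1 y * \<Gamma> 1 i j y + b 2 y * \<Gamma> 2 i j y) x
      = pderivative m (\<lambda>y. pderivative i (b j) y - w i y * b j y) x"
      by (rule pderivative_cong_open[OF U]) (simp add: bG Q_def)
    moreover have "pderivative i (b j) differentiable (at x)"
      by (rule Ck_on_differentiable[OF Ck_on_pderivative[OF b'] U(2)])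
    ultimately show ?thesis
      by (simp add: pderivative_add pderivative_diff pderivative_mult Db Dw D\<Gamma> U(2)
          differentiable_mult)
  qed
  have sa: "pderivative i (pderivative j (a k)) x = pderivative j (pderivative i (a k)) x"
    and sb: "pderivative i (pderivative j (b k)) x = pderivative j (pderivative i (b k)) x" for i j k
    unfolding pderivative_def[abs_def]
    by (rule second_derivative_symmetric[OF U(1) a U(2)] second_derivative_symmetric[OF U(1) b U(2)])+
  define W where "W i j = pderivative i (w j) x - pderivative j (w i) x" for i j
  have R: "riemann g l k i j x =
      pderivative i (\<Gamma> l j k) x - pderivative j (\<Gamma> l i k) x
      + (\<Gamma> l i 1 x * \<Gamma> 1 j k x - \<Gamma> l j 1 x * \<Gamma> 1 i k x + (\<Gamma> l i 2 x * \<Gamma> 2 j k x - \<Gamma> l j 2 x * \<Gamma> 2 i k x))" for l k i j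
    unfolding riemann_def Dch by (simp add: ch[OF U(2)])
  \<comment> \<open>Antisymmetrising in \<open>i\<close> and \<open>j\<close> removes the second
    derivatives by \<open>sa\<close> and also the products of \<open>w i\<close> and
    \<open>w j\<close>; the curl \<open>W\<close> of \<open>w\<close> remains.\<close>
  have Ra: "a 1 x * riemann g 1 k i j x + a 2 x * riemann g 2 k i j x = W i j * a k x" for i j k
    unfolding R W_def
    using daG[of i j k] daG[of j i k] aG[OF U(2), of i 1] aG[OF U(2), of i 2] aG[OF U(2), of j 1]
      aG[OF U(2), of j 2] aG[OF U(2), of j k] aG[OF U(2), of i k] sa[of i j k]
    unfolding P_def by algebra
  have Rb: "b 1 x * riemann g 1 k i j x + b 2 x * riemann g 2 k i j x = - W i j * b k x" for i j k
    unfolding R W_def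
    using dbG[of i j k] dbG[of j i k] bG[OF U(2), of i 1] bG[OF U(2), of i 2] bG[OF U(2), of j 1]
      bG[OF U(2), of j 2] bG[OF U(2), of j k] bG[OF U(2), of i k] sb[of i j k]
    unfolding Q_def by algebra
  have RR: "riemann g l k i j x = W i j * (A l x * a k x - B l x * b k x)" for l k i j
  proof -
    have "riemann g l k i j x = (A l x * a 1 x + B l x * b 1 x) * riemann g 1 k i j x
        + (A l x * a 2 x + B l x * b 2 x) * riemann g 2 k i j x"
      using exhaust_2[of l] by (auto simp: dual'[OF U(2)])
    also have "\<dots> = A l x * (W i j * a k x) + B l x * (- W i j * b k x)"
      unfolding Ra[symmetric] Rb[symmetric] by algebra
    finally show ?thesis by algebra
  qed
  have "W 1 1 = 0" "W 2 2 = 0" "W 2 1 = - W 1 2" unfolding W_def by simp_all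
  then have "scalar_curvature g x = W 1 2 * ((A 1 x * a 1 x + A 2 x * a 2 x) + (B 1 x * b 1 x + B 2 x * b 2 x))
      * (A 1 x * B 2 x - A 2 x * B 1 x)"
    unfolding scalar_curvature_def ricci_def by (simp add: RR inv[OF U(2)]) (simp add: algebra_simps)
  also have "\<dots> = 2 * W 1 2 * (A 1 x * B 2 x - A 2 x * B 1 x)"
    by (simp add: dual[OF U(2)])
  also have "A 1 x * B 2 x - A 2 x * B 1 x = 1 / \<Delta> x"
    using \<Delta>[OF U(2)] unfolding A_def B_def
    by (simp add: field_simps) (simp add: \<Delta>_def algebra_simps)
  finally show ?thesis unfolding W_def \<Delta>_def by simp
qed

section \<open>Principal curvatures\<close>

lemma sig_mult_self [simp]: "sig A * sig A = 1"
  by (cases A) auto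

lemma sig_nonzero [simp]: "sig A \<noteq> 0"
  by (cases A) auto

text \<open>Multiplication by the Gram matrix of \<open>ip A\<close>. Through it \<open>ip A\<close>
  inherits bilinearity and boundedness from the Euclidean inner product.\<close>

definition reflect3 :: "ambient \<Rightarrow> real^3 \<Rightarrow> real^3" where
  "reflect3 A p = vector [p $ 1, p $ 2, sig A * p $ 3]"

lemma ip_eq_inner: "ip A p q = p \<bullet> reflect3 A q"
  unfolding ip_def reflect3_def by (simp add: inner_vec_def sum_3 algebra_simps)

lemma bounded_linear_reflect3: "bounded_linear (reflect3 A)"
proof -
  have "linear (reflect3 A)"
    by (rule linearI) (simp_all add: reflect3_def vec_eq_iff forall_3 algebra_simps)
  then show ?thesis by (simp add: linear_conv_bounded_linear)
qed

lemma bounded_bilinear_ip: "bounded_bilinear (ip A)"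
  unfolding ip_eq_inner[abs_def]
  by (rule bounded_bilinear.comp[OF bounded_bilinear_inner bounded_linear_ident bounded_linear_reflect3])

lemma ip_commute: "ip A p q = ip A q p"
  unfolding ip_def by simp

interpretation ip: bounded_bilinear "ip A"
  by (rule bounded_bilinear_ip)

text \<open>The cross product with its index raised by \<open>ip A\<close>, so that pairing with it
  gives the volume form \<open>triple\<close> in both signatures.\<close>

definition lcross :: "ambient \<Rightarrow> real^3 \<Rightarrow> real^3 \<Rightarrow> real^3" where
  "lcross A u v = reflect3 A (cross3 u v)"

lemma lcross_nth: "lcross A u v $ 1 = u $ 2 * v $ 3 - u $ 3 * v $ 2"
  "lcross A u v $ 2 = u $ 3 * v $ 1 - u $ 1 * v $ 3"
  "lcross A u v $ 3 = sig A * (u $ 1 * v $ 2 - u $ 2 * v $ 1)"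
  unfolding lcross_def reflect3_def cross3_def by simp_all

lemma bounded_bilinear_lcross: "bounded_bilinear (lcross A)"
proof -
  have "bilinear (lcross A)"
    unfolding bilinear_def by (simp add: linear_iff vec_eq_iff forall_3 lcross_nth algebra_simps)
  then show ?thesis by (simp add: bilinear_conv_bounded_bilinear)
qed

definition triple :: "real^3 \<Rightarrow> real^3 \<Rightarrow> real^3 \<Rightarrow> real" where
  "triple u v w = u \<bullet> cross3 v w"

lemma triple_expand: "triple u v w = u $ 1 * (v $ 2 * w $ 3 - v $ 3 * w $ 2)
   + u $ 2 * (v $ 3 * w $ 1 - v $ 1 * w $ 3) + u $ 3 * (v $ 1 * w $ 2 - v $ 2 * w $ 1)"
  unfolding triple_def cross3_def by (simp add: inner_vec_def sum_3)

lemma ip_lcross: "ip A (lcross A u v) w = triple u v w"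
  unfolding ip_def triple_expand lcross_nth using sig_mult_self[of A] by algebra

text \<open>Lagrange's identity with a sign. For a unit normal \<open>u\<close>, of square
  \<open>sig A\<close>, and a unit tangent vector \<open>v\<close> the two signs cancel, so rotation
  about the normal preserves unit tangent vectors in both signatures.\<close>

lemma ip_lcross_self: "ip A (lcross A u v) (lcross A u v) =
    sig A * (ip A u u * ip A v v - (ip A u v)\<^sup>2)"
  unfolding ip_def lcross_nth using sig_mult_self[of A] by algebra

text \<open>Cramer's rule: each component of \<open>d\<close> times the determinant is a combination
  of the three pairings. Later vector identities are checked against a frame in this way.\<close>

lemma ip_eq_0_imp_eq_0:
  assumes "triple u v w \<noteq> 0" "ip A d u = 0" "ip A d v = 0" "ip A d w = 0"
  shows "d = 0"
proof -
  have "d $ 1 * triple u v w = 0" "d $ 2 * triple u v w = 0" "sig A * d $ 3 * triple u v w = 0"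
    using assms(2-4) unfolding ip_def triple_expand by algebra+
  then show ?thesis using assms(1) by (simp add: vec_eq_iff forall_3)
qed

lemma pderivative_bilinear:
  assumes "bounded_bilinear B" "f differentiable (at x)" "g differentiable (at x)"
  shows "pderivative i (\<lambda>y. B (f y) (g y)) x = B (f x) (pderivative i g x) + B (pderivative i f x) (g x)"
  using fun_cong[OF frechet_derivative_at[OF bounded_bilinear.FDERIV[OF assms(1) assms(2,3)[unfolded frechet_derivative_works]]]]
  by (simp add: pderivative_def)

lemmas pderivative_ip = pderivative_bilinear[OF bounded_bilinear_ip]

lemma frechet_derivative_pderivative:
  fixes f :: "real^2 \<Rightarrow> 'b::real_normed_vector"
  assumes "f differentiable (at x)"
  shows "frechet_derivative f (at x) v = v $ 1 *\<^sub>R pderivative 1 f x + v $ 2 *\<^sub>R pderivative 2 f x"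
proof -
  interpret linear "frechet_derivative f (at x)"
    using assms linear_frechet_derivative by blast
  have "v = v $ 1 *\<^sub>R axis 1 1 + v $ 2 *\<^sub>R axis 2 1"
    by (simp add: vec_eq_iff forall_2 axis_def)
  from arg_cong[OF this, of "frechet_derivative f (at x)"] show ?thesis
    unfolding pderivative_def by (simp add: add scale)
qed

section \<open>Eigenvalues of one plane quadratic form relative to another\<close>

lemma singular_symmetric_iff:
  fixes a b c :: real
  shows "(\<exists>v::real^2. v \<noteq> 0 \<and> a * v $ 1 + b * v $ 2 = 0 \<and> b * v $ 1 + c * v $ 2 = 0) \<longleftrightarrow> a * c - b\<^sup>2 = 0"
proof
  assume "\<exists>v::real^2. v \<noteq> 0 \<and> a * v $ 1 + b * v $ 2 = 0 \<and> b * v $ 1 + c * v $ 2 = 0"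
  then obtain v :: "real^2" where v: "v \<noteq> 0" "a * v $ 1 + b * v $ 2 = 0" "b * v $ 1 + c * v $ 2 = 0"
    by blast
  have "(a * c - b\<^sup>2) * v $ 1 = 0" "(a * c - b\<^sup>2) * v $ 2 = 0"
    using v(2,3) by algebra+
  then show "a * c - b\<^sup>2 = 0" using v(1) by (auto simp: vec_eq_iff forall_2)
next
  assume d: "a * c - b\<^sup>2 = 0"
  show "\<exists>v::real^2. v \<noteq> 0 \<and> a * v $ 1 + b * v $ 2 = 0 \<and> b * v $ 1 + c * v $ 2 = 0"
  proof (cases "a = 0 \<and> b = 0")
    case True
    then show ?thesis by (intro exI[of _ "axis 1 1"]) (auto simp: axis_def vec_eq_iff)
  next
    case False
    then show ?thesis using d
      by (intro exI[of _ "vector [b, - a]"]) (auto simp: vec_eq_iff forall_2 power2_eq_square algebra_simps)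
  qed
qed

text \<open>\<open>d\<close> is the discriminant of det (II - l I) for I = (E, F, G) and II = (L, M,
  N). Multiplied by \<open>E^2\<close> it is a square plus a positive multiple of a square, so it
  can vanish only for proportional forms, the umbilic case.\<close>

lemma pencil_discriminant_nonneg:
  fixes E F G L M N :: real
  assumes "E > 0" "E * G - F\<^sup>2 > 0"
  defines "d \<equiv> (E * N - 2 * F * M + G * L)\<^sup>2 - 4 * (E * G - F\<^sup>2) * (L * N - M\<^sup>2)"
  shows "d \<ge> 0" and "d = 0 \<Longrightarrow> E * M = F * L \<and> E * N = G * L"
proof -
  have eq: "E\<^sup>2 * d = (E * (E * N - G * L) - 2 * F * (E * M - F * L))\<^sup>2
      + 4 * (E * G - F\<^sup>2) * (E * M - F * L)\<^sup>2"
    unfolding d_def by algebra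
  also have "\<dots> \<ge> 0" using assms by simp
  finally show "d \<ge> 0" using assms(1) by (simp add: zero_le_mult_iff)
  assume "d = 0"
  then have "(E * (E * N - G * L) - 2 * F * (E * M - F * L))\<^sup>2
      + 4 * (E * G - F\<^sup>2) * (E * M - F * L)\<^sup>2 = 0"
    using eq by simp
  then have "(E * M - F * L)\<^sup>2 = 0" "(E * (E * N - G * L) - 2 * F * (E * M - F * L))\<^sup>2 = 0"
    using assms(2) by (auto simp: add_nonneg_eq_0_iff)
  then show "E * M = F * L \<and> E * N = G * L" using assms(1) by auto
qed

lemma pencil_roots:
  fixes W H K l :: real
  assumes "W > 0" "H\<^sup>2 - 4 * W * K \<ge> 0"
  shows "W * l\<^sup>2 - H * l + K = 0 \<longleftrightarrow>
    l = (H - sqrt (H\<^sup>2 - 4 * W * K)) / (2 * W) \<or> l = (H + sqrt (H\<^sup>2 - 4 * W * K)) / (2 * W)"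
proof -
  define s where "s = sqrt (H\<^sup>2 - 4 * W * K)"
  have s: "s\<^sup>2 = H\<^sup>2 - 4 * W * K" unfolding s_def using assms(2) by simp
  have "4 * W * (W * l\<^sup>2 - H * l + K) = (2 * W * l - H - s) * (2 * W * l - H + s)"
    using s by algebra
  then have "W * l\<^sup>2 - H * l + K = 0 \<longleftrightarrow> (2 * W * l - H - s) * (2 * W * l - H + s) = 0"
    using assms(1) by (metis mult_eq_0_iff less_irrefl zero_neq_numeral)
  also have "\<dots> \<longleftrightarrow> 2 * W * l = H + s \<or> 2 * W * l = H - s"
    unfolding mult_eq_0_iff by (intro disj_cong) linarith+
  also have "\<dots> \<longleftrightarrow> l = (H + s) / (2 * W) \<or> l = (H - s) / (2 * W)"
    using assms(1) by (simp add: eq_divide_eq mult.commute)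
  finally show ?thesis unfolding s_def by blast
qed

text \<open>\<open>II(v, w) = - \<langle>df v, dn w\<rangle>\<close>, which needs no second derivatives and hence behaves well under a change of parameter.\<close>

lemma fundamental_form_2_eq:
  assumes "open U" "Ck_on 2 f U" "x \<in> U" "n differentiable (at x)"
    and "\<And>y v. y \<in> U \<Longrightarrow> ip A (frechet_derivative f (at y) v) (n y) = 0"
  shows "fundamental_form_2 A f n x v w =
    - ip A (frechet_derivative f (at x) v) (frechet_derivative n (at x) w)"
proof -
  let ?fv = "\<lambda>y. frechet_derivative f (at y) v"
  have d: "?fv differentiable (at x)"
    using assms(2,3) by (simp add: numeral_2_eq_2)
  have "((\<lambda>y. ip A (?fv y) (n y)) has_derivative (\<lambda>w. ip A (?fv x) (frechet_derivative n (at x) w)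
      + ip A (frechet_derivative ?fv (at x) w) (n x))) (at x)"
    by (rule ip.FDERIV) (use d assms(4) in \<open>simp_all add: frechet_derivative_works[symmetric]\<close>)
  moreover have "((\<lambda>y. ip A (?fv y) (n y)) has_derivative (\<lambda>w. 0)) (at x)"
    by (subst has_derivative_cong_open[OF assms(1,3), of _ "\<lambda>y. 0"]) (simp_all add: assms(5))
  ultimately have "(\<lambda>w. ip A (?fv x) (frechet_derivative n (at x) w)
      + ip A (frechet_derivative ?fv (at x) w) (n x)) = (\<lambda>w. 0)"
    by (rule has_derivative_unique)
  from fun_cong[OF this, of w] show ?thesis unfolding fundamental_form_2_def by simp
qed

lemma pderivative_eq_0:
  assumes "open U" "x \<in> U" "\<And>y. y \<in> U \<Longrightarrow> f y = c"
  shows "pderivative i f x = 0"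
proof -
  have "pderivative i f x = pderivative i (\<lambda>y. c) x"
    by (rule pderivative_cong_open[OF assms])
  then show ?thesis by (simp add: pderivative_def)
qed

lemma tangent_frame_expansion:
  assumes "ip A u u = 1" "ip A v v = 1" "ip A u v = 0" "ip A u n = 0" "ip A v n = 0"
    and "triple u v n \<noteq> 0" "ip A T n = 0"
  shows "T = ip A T u *\<^sub>R u + ip A T v *\<^sub>R v"
proof -
  have "T - (ip A T u *\<^sub>R u + ip A T v *\<^sub>R v) = 0"
    by (rule ip_eq_0_imp_eq_0[OF assms(6), where A = A])
      (use assms in \<open>simp_all add: ip.diff_left ip.add_left ip.scaleR_left ip_commute[of A v u]\<close>)
  then show ?thesis by simp
qed

text \<open>What the curvature computation uses of a patch, stated once for both signatures; in the
  Lorentzian case \<open>positive\<close> is the space-like condition.\<close>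

locale C3_normal_patch =
  fixes A :: ambient and U :: "(real^2) set" and f n :: "real^2 \<Rightarrow> real^3"
  assumes U: "open U" and f: "Ck_on 3 f U" and n: "Ck_on 3 n U"
    and unit: "x \<in> U \<Longrightarrow> ip A (n x) (n x) = sig A"
    and normal: "x \<in> U \<Longrightarrow> ip A (frechet_derivative f (at x) v) (n x) = 0"
    and positive: "x \<in> U \<Longrightarrow> v \<noteq> 0 \<Longrightarrow> ip A (frechet_derivative f (at x) v) (frechet_derivative f (at x) v) > 0"
begin

abbreviation f' where "f' i \<equiv> pderivative i f"
abbreviation n' where "n' i \<equiv> pderivative i n"

definition form1 where "form1 i j x = ip A (f' i x) (f' j x)"
definition form2 where "form2 i j x = - ip A (f' i x) (n' j x)"
text \<open>\<open>W\<close>, \<open>H\<close> and \<open>disc\<close> come from det (II - l I) =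
  \<open>W * l^2 - H * l\<close> + det II, a quadratic in l with roots \<open>l1\<close> and
  \<open>l2\<close>.\<close>

definition W where "W x = form1 1 1 x * form1 2 2 x - (form1 1 2 x)\<^sup>2"
definition H where "H x = form1 1 1 x * form2 2 2 x - 2 * form1 1 2 x * form2 1 2 x + form1 2 2 x * form2 1 1 x"
definition disc where "disc x = (H x)\<^sup>2 - 4 * W x * (form2 1 1 x * form2 2 2 x - (form2 1 2 x)\<^sup>2)"
definition l1 where "l1 x = (H x - sqrt (disc x)) / (2 * W x)"
definition l2 where "l2 x = (H x + sqrt (disc x)) / (2 * W x)"

lemma f_Suc: "Ck_on (Suc 2) f U" and n_Suc: "Ck_on (Suc 2) n U"
  using f n by (simp_all only: eval_nat_numeral)

lemma f'_C2: "Ck_on 2 (f' i) U" and n'_C2: "Ck_on 2 (n' i) U" and n_C2: "Ck_on 2 n U"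
  and f_C2: "Ck_on 2 f U"
  using f_Suc n_Suc Ck_on_pderivative Ck_on_SucD by blast+

lemma Df: "x \<in> U \<Longrightarrow> f differentiable (at x)" and Dn: "x \<in> U \<Longrightarrow> n differentiable (at x)"
  and Df': "x \<in> U \<Longrightarrow> f' i differentiable (at x)" and Dn': "x \<in> U \<Longrightarrow> n' i differentiable (at x)"
  using f_C2 n_C2 f'_C2 n'_C2 unfolding numeral_2_eq_2 by (blast intro: Ck_on_differentiable)+

lemma f'_normal: "x \<in> U \<Longrightarrow> ip A (f' i x) (n x) = 0"
  unfolding pderivative_def by (rule normal)

lemma n'_normal: "x \<in> U \<Longrightarrow> ip A (n' i x) (n x) = 0"
proof -
  assume x: "x \<in> U"
  have "pderivative i (\<lambda>y. ip A (n y) (n y)) x = 0"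
    by (rule pderivative_eq_0[OF U x unit])
  then show ?thesis by (simp add: pderivative_ip Dn x ip_commute)
qed

lemma f''_symmetric: "x \<in> U \<Longrightarrow> pderivative i (f' j) x = pderivative j (f' i) x"
  and n''_symmetric: "x \<in> U \<Longrightarrow> pderivative i (n' j) x = pderivative j (n' i) x"
  unfolding pderivative_def[abs_def]
  by (rule second_derivative_symmetric[OF U f_C2] second_derivative_symmetric[OF U n_C2], assumption)+

lemma form1_symmetric: "form1 i j x = form1 j i x"
  unfolding form1_def by (rule ip_commute)

text \<open>Differentiating the orthogonality of \<open>f' i\<close> and \<open>n\<close> turns both
  sides into normal components of second derivatives of \<open>f\<close>.\<close>

lemma form2_symmetric: "form2 i j x = form2 j i x" if x: "x \<in> U"
proof -
  have *: "form2 i j x = ip A (pderivative j (f' i) x) (n x)" for i j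
  proof -
    have "pderivative j (\<lambda>y. ip A (f' i y) (n y)) x = 0"
      by (rule pderivative_eq_0[OF U x f'_normal])
    then show ?thesis by (simp add: pderivative_ip Dn Df' x form2_def)
  qed
  show ?thesis unfolding * f''_symmetric[OF x, of i j] ..
qed

lemma form1_eq: "x \<in> U \<Longrightarrow> fundamental_form_1 A f x v w =
    v $ 1 * w $ 1 * form1 1 1 x + (v $ 1 * w $ 2 + v $ 2 * w $ 1) * form1 1 2 x + v $ 2 * w $ 2 * form1 2 2 x"
  unfolding fundamental_form_1_def form1_def
  by (simp add: frechet_derivative_pderivative Df ip.add_left ip.add_right ip.scaleR_left ip.scaleR_right
      ip_commute[of A "f' 2 x" "f' 1 x"] algebra_simps)

lemma form2_eq: "x \<in> U \<Longrightarrow> fundamental_form_2 A f n x v w =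
    v $ 1 * w $ 1 * form2 1 1 x + (v $ 1 * w $ 2 + v $ 2 * w $ 1) * form2 1 2 x + v $ 2 * w $ 2 * form2 2 2 x"
  using form2_symmetric[of x 2 1]
  by (simp add: fundamental_form_2_eq[OF U f_C2 _ Dn normal] form2_def
      frechet_derivative_pderivative Df Dn ip.add_left ip.add_right ip.scaleR_left ip.scaleR_right
      algebra_simps)

lemma form1_pos: "form1 1 1 x > 0" "W x > 0" if x: "x \<in> U"
proof -
  have pos: "fundamental_form_1 A f x v v > 0" if "v \<noteq> 0" for v
    unfolding fundamental_form_1_def by (rule positive[OF x that])
  from pos[of "axis 1 1"] show E: "form1 1 1 x > 0"
    by (simp add: form1_eq[OF x]) (simp add: axis_def)
  \<comment> \<open>This vector is orthogonal to \<open>axis 1 1\<close> for I, and its square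
    length is \<open>form1 1 1 x * W x\<close>.\<close>
  have "vector [- form1 1 2 x, form1 1 1 x] \<noteq> (0::real^2)"
    using E by (simp add: vec_eq_iff forall_2)
  from pos[OF this] have "form1 1 1 x * W x > 0"
    unfolding form1_eq[OF x] W_def by (simp add: power2_eq_square algebra_simps)
  then show "W x > 0" using E by (simp add: zero_less_mult_iff)
qed

lemma disc_nonneg: "x \<in> U \<Longrightarrow> disc x \<ge> 0"
  unfolding disc_def H_def W_def
  by (rule pencil_discriminant_nonneg(1)) (use form1_pos in \<open>auto simp: W_def\<close>)

lemma principal_curvatures_eq: "principal_curvatures A f n x = {l1 x, l2 x}" if x: "x \<in> U"
proof -
  have "l \<in> principal_curvatures A f n x \<longleftrightarrow> l = l1 x \<or> l = l2 x" for l
  proof -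
    let ?a = "form2 1 1 x - l * form1 1 1 x" and ?b = "form2 1 2 x - l * form1 1 2 x"
      and ?c = "form2 2 2 x - l * form1 2 2 x"
    have "(\<forall>w. fundamental_form_2 A f n x v w = l * fundamental_form_1 A f x v w) \<longleftrightarrow>
        ?a * v $ 1 + ?b * v $ 2 = 0 \<and> ?b * v $ 1 + ?c * v $ 2 = 0" for v
    proof
      assume "\<forall>w. fundamental_form_2 A f n x v w = l * fundamental_form_1 A f x v w"
      from spec[OF this, of "axis 1 1"] spec[OF this, of "axis 2 1"]
      show "?a * v $ 1 + ?b * v $ 2 = 0 \<and> ?b * v $ 1 + ?c * v $ 2 = 0"
        by (simp add: form1_eq[OF x] form2_eq[OF x] axis_def algebra_simps)
    next
      assume "?a * v $ 1 + ?b * v $ 2 = 0 \<and> ?b * v $ 1 + ?c * v $ 2 = 0"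
      then show "\<forall>w. fundamental_form_2 A f n x v w = l * fundamental_form_1 A f x v w"
        unfolding form1_eq[OF x] form2_eq[OF x] by (intro allI) algebra
    qed
    then have "l \<in> principal_curvatures A f n x \<longleftrightarrow> ?a * ?c - ?b\<^sup>2 = 0"
      unfolding principal_curvatures_def by (simp add: singular_symmetric_iff)
    also have "?a * ?c - ?b\<^sup>2 = W x * l\<^sup>2 - H x * l + (form2 1 1 x * form2 2 2 x - (form2 1 2 x)\<^sup>2)"
      unfolding W_def H_def by algebra
    also have "\<dots> = 0 \<longleftrightarrow> l = l1 x \<or> l = l2 x"
      unfolding l1_def l2_def disc_def
      by (rule pencil_roots) (use form1_pos disc_nonneg x in \<open>auto simp: disc_def\<close>)
    finally show ?thesis .
  qed
  then show ?thesis by auto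
qed

lemma l1_le_l2: "x \<in> U \<Longrightarrow> l1 x \<le> l2 x"
  unfolding l1_def l2_def using form1_pos[of x] disc_nonneg[of x] by (simp add: divide_right_mono)

lemma lambda_eq: "x \<in> U \<Longrightarrow> lambda1 A f n x = l1 x" "x \<in> U \<Longrightarrow> lambda2 A f n x = l2 x"
  unfolding lambda1_def lambda2_def by (simp_all add: principal_curvatures_eq l1_le_l2)

lemma Ck2_data: "Ck_on 2 (form1 i j) U" "Ck_on 2 (form2 i j) U" "Ck_on 2 W U" "Ck_on 2 H U" "Ck_on 2 disc U"
proof -
  show 1: "Ck_on 2 (form1 i j) U" and 2: "Ck_on 2 (form2 i j) U" for i j
    unfolding form1_def[abs_def] form2_def[abs_def]
    by (intro Ck_on_minus Ck_on_bilinear[OF U bounded_bilinear_ip] U f'_C2 n'_C2)+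
  show 3: "Ck_on 2 W U" and 4: "Ck_on 2 H U"
    unfolding W_def[abs_def] H_def[abs_def] power2_eq_square
    by (intro Ck_on_add Ck_on_diff Ck_on_mult Ck_on_const U 1 2)+
  show "Ck_on 2 disc U"
    unfolding disc_def[abs_def] power2_eq_square
    by (intro Ck_on_diff Ck_on_mult Ck_on_const U 1 2 3 4)
qed

text \<open>The non-umbilic points. There the square root in \<open>l1\<close> and \<open>l2\<close>
  has a positive argument, so both are C^2; elsewhere in \<open>U\<close> they coincide.\<close>

definition V where "V = U \<inter> disc -` {0<..}"

lemma V: "open V" "V \<subseteq> U" "x \<in> V \<longleftrightarrow> x \<in> U \<and> disc x > 0"
  using continuous_open_preimage[OF Ck_on_continuous[OF Ck2_data(5)] U open_greaterThan, of 0]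
  unfolding V_def by auto

lemma Ck2_l: "Ck_on 2 l1 V" "Ck_on 2 l2 V"
  unfolding l1_def[abs_def] l2_def[abs_def]
  by (intro Ck_on_divide Ck_on_add Ck_on_diff Ck_on_mult Ck_on_sqrt Ck_on_const V(1) Ck2_data(3-5)[THEN Ck_on_subset[OF _ V(2)]];
      use V form1_pos in force)+

lemma l1_less_l2: "x \<in> V \<Longrightarrow> l1 x < l2 x"
  unfolding l1_def l2_def V(3) using form1_pos[of x] by (simp add: divide_strict_right_mono)

lemma l_sum: "x \<in> U \<Longrightarrow> (l1 x + l2 x) * W x = H x"
  using form1_pos(2)[of x] unfolding l1_def l2_def by (simp add: field_simps)

lemma l1_root: "x \<in> U \<Longrightarrow> (form2 1 1 x - l1 x * form1 1 1 x) * (form2 2 2 x - l1 x * form1 2 2 x)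
    = (form2 1 2 x - l1 x * form1 1 2 x)\<^sup>2"
proof -
  assume x: "x \<in> U"
  have "W x * (l1 x)\<^sup>2 - H x * l1 x + (form2 1 1 x * form2 2 2 x - (form2 1 2 x)\<^sup>2) = 0"
    using pencil_roots[of "W x" "H x" "form2 1 1 x * form2 2 2 x - (form2 1 2 x)\<^sup>2" "l1 x"]
      form1_pos(2)[OF x] disc_nonneg[OF x] unfolding l1_def disc_def by blast
  then show ?thesis unfolding W_def H_def by algebra
qed

end

section \<open>The Codazzi equations and the curvature of the triple product metric\<close>

lemma differentiable_ip:
  "f differentiable (at x) \<Longrightarrow> g differentiable (at x) \<Longrightarrow> (\<lambda>y. ip A (f y) (g y)) differentiable (at x)"
  unfolding differentiable_def using ip.FDERIV by blast

context C3_normal_patch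
begin

text \<open>Only the direction for \<open>l1\<close> is found as a kernel. Rotating it about the
  normal gives the second direction with the right orientation, and a trace shows that this one
  belongs to \<open>l2\<close>. The last two clauses are Rodrigues' equations dn = - l df, component
  by component.\<close>

lemma principal_frame:
  assumes x: "x \<in> V"
  shows "\<exists>V' e1 e2. open V' \<and> x \<in> V' \<and> V' \<subseteq> V \<and> Ck_on 2 e1 V' \<and> Ck_on 2 e2 V' \<and>
    (\<forall>y\<in>V'. ip A (e1 y) (e1 y) = 1 \<and> ip A (e2 y) (e2 y) = 1 \<and> ip A (e1 y) (e2 y) = 0 \<and>
       ip A (e1 y) (n y) = 0 \<and> ip A (e2 y) (n y) = 0 \<and> triple (e1 y) (e2 y) (n y) = 1 \<and>
       (\<forall>i. ip A (n' i y) (e1 y) = - l1 y * ip A (f' i y) (e1 y) \<and>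
            ip A (n' i y) (e2 y) = - l2 y * ip A (f' i y) (e2 y)))"
proof -
  define a where "a y = form2 1 1 y - l1 y * form1 1 1 y" for y
  define b where "b y = form2 1 2 y - l1 y * form1 1 2 y" for y
  define c where "c y = form2 2 2 y - l1 y * form1 2 2 y" for y
  have ac: "a y * c y = (b y)\<^sup>2" if "y \<in> V" for y
    using l1_root[of y] that V(2) unfolding a_def b_def c_def by blast
  \<comment> \<open>This is \<open>W\<close> times the trace of II - l1 I relative to I. It is
    nonzero on \<open>V\<close>, so \<open>a\<close>, \<open>b\<close>, \<open>c\<close> do not all
    vanish at a point there.\<close>
  have tr: "form1 1 1 y * c y - 2 * form1 1 2 y * b y + form1 2 2 y * a y = W y * (l2 y - l1 y)" if "y \<in> V" for y
    using l_sum[of y] that V(2) unfolding a_def b_def c_def H_def W_def by (auto simp: algebra_simps power2_eq_square)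
  \<comment> \<open>By \<open>ac = b\<^sup>2\<close>, every \<open>(b s + c t, - a s - b t)\<close> lies in the kernel of \<open>II - l1 I\<close>;
    constant \<open>s, t\<close> give a \<open>C\<^sup>2\<close> field of eigenvectors near \<open>x\<close>.\<close>
  obtain s t where st: "(b x * s + c x * t, - a x * s - b x * t) \<noteq> (0, 0)"
  proof -
    have "\<not> (a x = 0 \<and> b x = 0 \<and> c x = 0)"
      using tr[OF x] l1_less_l2[OF x] form1_pos(2)[of x] x V(2) by auto
    then show thesis using that[of 1 0] that[of 0 1] by auto
  qed
  define v1 where "v1 y = b y * s + c y * t" for y
  define v2 where "v2 y = - a y * s - b y * t" for y
  define F where "F y = v1 y *\<^sub>R f' 1 y + v2 y *\<^sub>R f' 2 y" for y
  define q where "q y = ip A (F y) (F y)" for y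
  define V' where "V' = V \<inter> q -` {0<..}"
  have Csub: "Ck_on 2 g V" if "Ck_on 2 g U" for g :: "real^2 \<Rightarrow> 'b::real_normed_vector"
    using Ck_on_subset[OF that V(2)] .
  have abc: "Ck_on 2 a V" "Ck_on 2 b V" "Ck_on 2 c V"
    unfolding a_def[abs_def] b_def[abs_def] c_def[abs_def]
    by (intro Ck_on_diff Ck_on_mult V(1) Ck2_l Csub Ck2_data)+
  have CF: "Ck_on 2 F V"
    unfolding F_def[abs_def] v1_def v2_def
    by (intro Ck_on_add Ck_on_diff Ck_on_scaleR Ck_on_mult Ck_on_minus Ck_on_const V(1) abc Csub f'_C2)
  have Cq: "Ck_on 2 q V"
    unfolding q_def[abs_def] by (rule Ck_on_bilinear[OF V(1) bounded_bilinear_ip CF CF])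
  have V': "open V'" "V' \<subseteq> V" "\<And>y. y \<in> V' \<longleftrightarrow> y \<in> V \<and> q y > 0"
    using continuous_open_preimage[OF Ck_on_continuous[OF Cq] V(1) open_greaterThan, of 0]
    unfolding V'_def by auto
  have qpos: "q y > 0" if "y \<in> V" "(v1 y, v2 y) \<noteq> (0, 0)" for y
  proof -
    have "vector [v1 y, v2 y] \<noteq> (0::real^2)" using that(2) by (auto simp: vec_eq_iff forall_2)
    from positive[OF _ this, of y] that(1) V(2) show ?thesis
      unfolding q_def F_def by (auto simp: frechet_derivative_pderivative Df subset_iff)
  qed
  have xV': "x \<in> V'"
    using qpos[OF x] st x V'(3) unfolding v1_def v2_def by blast
  define e1 where "e1 y = inverse (sqrt (q y)) *\<^sub>R F y" for y
  define e2 where "e2 y = lcross A (n y) (e1 y)" for y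
  have Ce1: "Ck_on 2 e1 V'"
    unfolding e1_def[abs_def]
    by (intro Ck_on_scaleR Ck_on_inverse Ck_on_sqrt V'(1) Ck_on_subset[OF Cq V'(2)] Ck_on_subset[OF CF V'(2)])
      (use V'(3) in force)+
  have Ce2: "Ck_on 2 e2 V'"
    unfolding e2_def[abs_def]
    by (intro Ck_on_bilinear[OF V'(1) bounded_bilinear_lcross] Ce1 Ck_on_subset[OF n_C2] order_trans[OF V'(2) V(2)])
  have "ip A (e1 y) (e1 y) = 1 \<and> ip A (e2 y) (e2 y) = 1 \<and> ip A (e1 y) (e2 y) = 0 \<and>
       ip A (e1 y) (n y) = 0 \<and> ip A (e2 y) (n y) = 0 \<and> triple (e1 y) (e2 y) (n y) = 1 \<and>
       (\<forall>i. ip A (n' i y) (e1 y) = - l1 y * ip A (f' i y) (e1 y) \<and>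
            ip A (n' i y) (e2 y) = - l2 y * ip A (f' i y) (e2 y))" if y: "y \<in> V'" for y
  proof -
    have yV: "y \<in> V" and yU: "y \<in> U" and q: "q y > 0" using y V'(3) V(2) by auto
    have Fn: "ip A (F y) (n y) = 0"
      unfolding F_def by (simp add: ip.add_left ip.scaleR_left f'_normal yU)
    have e11: "ip A (e1 y) (e1 y) = 1"
      using q unfolding e1_def by (simp add: ip.scaleR_left ip.scaleR_right q_def[symmetric] field_simps)
    have e1n: "ip A (e1 y) (n y) = 0" unfolding e1_def by (simp add: ip.scaleR_left Fn)
    have e22: "ip A (e2 y) (e2 y) = 1"
      unfolding e2_def ip_lcross_self by (simp add: e11 unit yU ip_commute[of A "n y" "e1 y"] e1n)
    have e12: "ip A (e1 y) (e2 y) = 0"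
      unfolding e2_def ip_commute[of A "e1 y"] ip_lcross triple_expand by algebra
    have e2n: "ip A (e2 y) (n y) = 0"
      unfolding e2_def ip_lcross triple_expand by algebra
    have tr1: "triple (e1 y) (e2 y) (n y) = 1"
    proof -
      have "triple (e1 y) (e2 y) (n y) = triple (n y) (e1 y) (e2 y)"
        unfolding triple_expand by algebra
      then show ?thesis using e22 ip_lcross[of A "n y" "e1 y" "e2 y"] unfolding e2_def[of y, symmetric] by simp
    qed
    have Bv: "a y * v1 y + b y * v2 y = 0" "b y * v1 y + c y * v2 y = 0"
      unfolding v1_def v2_def using ac[OF yV] by algebra+
    have nf: "ip A (n' i y) (f' j y) = - form2 i j y" and ff: "ip A (f' i y) (f' j y) = form1 i j y" for i j
      unfolding form1_def using form2_symmetric[OF yU, of i j]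
      by (simp_all add: form2_def ip_commute)
    note sym = form2_symmetric[OF yU, of 2 1] form1_symmetric[of 2 1 y]
    have nF: "ip A (n' i y) (F y) = - l1 y * ip A (f' i y) (F y)" for i
      using exhaust_2[of i] Bv sym unfolding F_def a_def b_def c_def
      by (auto simp: ip.add_right ip.scaleR_right nf ff algebra_simps)
    have ne1: "ip A (n' i y) (e1 y) = - l1 y * ip A (f' i y) (e1 y)" for i
      unfolding e1_def by (simp add: ip.scaleR_right nF)
    \<comment> \<open>\<open>(u1, u2)\<close> is orthogonal to \<open>(v1, v2)\<close> for \<open>I\<close>, so \<open>u\<close> is a multiple of \<open>e2\<close>.\<close>
    define u1 where "u1 = form1 1 2 y * v1 y + form1 2 2 y * v2 y"
    define u2 where "u2 = - (form1 1 1 y * v1 y + form1 1 2 y * v2 y)"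
    define u where "u = u1 *\<^sub>R f' 1 y + u2 *\<^sub>R f' 2 y"
    have fu: "ip A (f' 1 y) u = W y * v2 y" "ip A (f' 2 y) u = - W y * v1 y"
      unfolding u_def ip.add_right ip.scaleR_right ff sym real_scaleR_def u1_def u2_def W_def by algebra+
    have uF: "ip A u (F y) = 0"
      unfolding ip_commute[of A u] unfolding F_def by (simp add: ip.add_left ip.scaleR_left fu)
    have uu: "ip A u u = W y * q y"
    proof -
      have "ip A u u = u1 * (W y * v2 y) - u2 * (W y * v1 y)"
        by (subst (1) u_def) (simp add: ip.add_left ip.scaleR_left fu)
      moreover have "q y = u1 * v2 y - u2 * v1 y"
        unfolding q_def F_def u1_def u2_def
        by (simp add: ip.add_left ip.scaleR_left ip.add_right ip.scaleR_right ff sym algebra_simps)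
      ultimately show ?thesis by algebra
    qed
    have un: "ip A u (n y) = 0"
      unfolding u_def by (simp add: ip.add_left ip.scaleR_left f'_normal yU)
    have u_e2: "u = ip A u (e2 y) *\<^sub>R e2 y"
    proof -
      have "ip A u (e1 y) = 0" unfolding e1_def by (simp add: ip.scaleR_right uF)
      with tangent_frame_expansion[OF e11 e22 e12 e1n e2n _ un] tr1 show ?thesis by simp
    qed
    \<comment> \<open>II - l1 I annihilates (v1, v2) and has trace l2 - l1 relative to I, so on the
      orthogonal vector \<open>u\<close> it acts as multiplication by l2 - l1. This is where
      \<open>l2\<close> enters.\<close>
    have nu: "ip A (n' i y) u = - l2 y * ip A (f' i y) u" for i
    proof -
      have W: "l2 y * W y = W y * l1 y + (form1 1 1 y * c y - 2 * form1 1 2 y * b y + form1 2 2 y * a y)"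
        using tr[OF yV] by (simp add: algebra_simps)
      have "ip A (n' 1 y) u = - (l2 y * W y) * v2 y" "ip A (n' 2 y) u = (l2 y * W y) * v1 y"
        unfolding W unfolding u_def ip.add_right ip.scaleR_right nf sym u1_def u2_def real_scaleR_def
        using Bv unfolding a_def b_def c_def W_def by algebra+
      then show ?thesis using exhaust_2[of i] by (auto simp: fu)
    qed
    have "ip A u (e2 y) \<noteq> 0"
    proof
      assume "ip A u (e2 y) = 0"
      with u_e2 have "u = 0" by simp
      then show False using uu q form1_pos(2)[OF yU] by (simp add: ip.zero_left)
    qed
    moreover have "ip A u (e2 y) * ip A (n' i y) (e2 y) = ip A u (e2 y) * (- l2 y * ip A (f' i y) (e2 y))" for i
    proof -
      have "ip A T u = ip A u (e2 y) * ip A T (e2 y)" for T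
        by (subst (1) u_e2, simp add: ip.scaleR_right)
      from nu[of i, unfolded this] show ?thesis by (simp add: algebra_simps)
    qed
    ultimately have "ip A (n' i y) (e2 y) = - l2 y * ip A (f' i y) (e2 y)" for i
      by (metis mult_left_cancel)
    then show ?thesis using e11 e22 e12 e1n e2n tr1 ne1 by blast
  qed
  then show ?thesis using V'(1,2) xV' Ce1 Ce2 by blast
qed

text \<open>The null coframe is \<open>a\<close>, \<open>\<theta>2\<close> with connection form
  \<open>w\<close>. The factor comes out as \<open>k = - 2 / (D^2 * N)\<close> with
  \<open>N = a 1 * \<theta>2 2 - a 2 * \<theta>2 1\<close>, and the determinant of \<open>g\<close>
  is \<open>- N^2\<close>.\<close>

lemma scalar_curvature_triple_metric:
  assumes x: "x \<in> V"
    and g: "\<And>y i j. y \<in> U \<Longrightarrow>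
      g y $ i $ j = triple (f' i y) (n' j y) (n y) + triple (f' j y) (n' i y) (n y)"
  shows "\<exists>k. k \<noteq> 0 \<and> scalar_curvature g x =
      k * (pderivative 1 l1 x * pderivative 2 l2 x - pderivative 2 l1 x * pderivative 1 l2 x)"
    and "det (g x) \<noteq> 0"
proof -
  obtain V' e1 e2 where V': "open V'" "x \<in> V'" "V' \<subseteq> V" and Ce: "Ck_on 2 e1 V'" "Ck_on 2 e2 V'"
    and frame: "\<forall>y\<in>V'. ip A (e1 y) (e1 y) = 1 \<and> ip A (e2 y) (e2 y) = 1 \<and> ip A (e1 y) (e2 y) = 0 \<and>
       ip A (e1 y) (n y) = 0 \<and> ip A (e2 y) (n y) = 0 \<and> triple (e1 y) (e2 y) (n y) = 1 \<and>
       (\<forall>i. ip A (n' i y) (e1 y) = - l1 y * ip A (f' i y) (e1 y) \<and>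
            ip A (n' i y) (e2 y) = - l2 y * ip A (f' i y) (e2 y))"
    using principal_frame[OF x] by (elim exE conjE) (rule that)
  have fr: "ip A (e1 y) (e1 y) = 1" "ip A (e2 y) (e2 y) = 1" "ip A (e1 y) (e2 y) = 0"
      "ip A (e1 y) (n y) = 0" "ip A (e2 y) (n y) = 0" "triple (e1 y) (e2 y) (n y) = 1"
    and ne: "ip A (n' i y) (e1 y) = - l1 y * ip A (f' i y) (e1 y)"
      "ip A (n' i y) (e2 y) = - l2 y * ip A (f' i y) (e2 y)" if "y \<in> V'" for y i
    using bspec[OF frame that] by simp_all
  have VU: "V' \<subseteq> U" using V'(3) V(2) by auto
  note inU = subsetD[OF VU]
  define D where "D y = l2 y - l1 y" for y
  have D: "D y > 0" if "y \<in> V'" for y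
    using l1_less_l2[of y] that V'(3) unfolding D_def by auto
  define \<theta>1 where "\<theta>1 i y = ip A (f' i y) (e1 y)" for i y
  define \<theta>2 where "\<theta>2 i y = ip A (f' i y) (e2 y)" for i y
  have exp: "T = ip A T (e1 y) *\<^sub>R e1 y + ip A T (e2 y) *\<^sub>R e2 y" if "y \<in> V'" "ip A T (n y) = 0" for T y
    by (rule tangent_frame_expansion[OF fr(1-5)[OF that(1)] _ that(2)]) (simp add: fr(6)[OF that(1)])
  have fexp: "f' i y = \<theta>1 i y *\<^sub>R e1 y + \<theta>2 i y *\<^sub>R e2 y" if "y \<in> V'" for i y
    unfolding \<theta>1_def \<theta>2_def by (rule exp[OF that f'_normal[OF inU[OF that]]])
  have nexp: "n' i y = (- l1 y * \<theta>1 i y) *\<^sub>R e1 y + (- l2 y * \<theta>2 i y) *\<^sub>R e2 y" if "y \<in> V'" for i y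
    using exp[OF that n'_normal[OF inU[OF that], of i]] unfolding ne[OF that] \<theta>1_def \<theta>2_def .
  have C\<theta>: "Ck_on 2 (\<theta>1 i) V'" "Ck_on 2 (\<theta>2 i) V'" for i
    unfolding \<theta>1_def[abs_def] \<theta>2_def[abs_def]
    by (intro Ck_on_bilinear[OF V'(1) bounded_bilinear_ip] Ce Ck_on_subset[OF f'_C2 VU])+
  have Cl: "Ck_on 2 l1 V'" "Ck_on 2 l2 V'"
    using Ck_on_subset[OF _ V'(3)] Ck2_l by auto
  have CD: "Ck_on 2 D V'" unfolding D_def[abs_def] by (intro Ck_on_diff Cl V'(1))
  have diff: "h differentiable (at y)" if "Ck_on 2 h V'" "y \<in> V'" for h :: "real^2 \<Rightarrow> 'b::real_normed_vector" and y
    using that by (auto simp: numeral_2_eq_2)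
  \<comment> \<open>The connection form of the orthonormal frame; it is eliminated in the derivation
    of the Codazzi equations.\<close>
  define c where "c i y = ip A (e1 y) (pderivative i e2 y)" for i y
  have de: "ip A (e1 y) (pderivative i e1 y) = 0" "ip A (e2 y) (pderivative i e2 y) = 0"
    "ip A (pderivative i e1 y) (e2 y) = - c i y" if y: "y \<in> V'" for i y
  proof -
    note d1 = diff[OF Ce(1) y] and d2 = diff[OF Ce(2) y]
    show "ip A (e1 y) (pderivative i e1 y) = 0"
    proof -
      have "pderivative i (\<lambda>y. ip A (e1 y) (e1 y)) y = 0"
        by (rule pderivative_eq_0[OF V'(1) y fr(1)])
      then show ?thesis by (simp add: pderivative_ip d1 ip_commute)
    qed
    show "ip A (e2 y) (pderivative i e2 y) = 0"
    proof -
      have "pderivative i (\<lambda>y. ip A (e2 y) (e2 y)) y = 0"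
        by (rule pderivative_eq_0[OF V'(1) y fr(2)])
      then show ?thesis by (simp add: pderivative_ip d2 ip_commute)
    qed
    show "ip A (pderivative i e1 y) (e2 y) = - c i y"
    proof -
      have "pderivative i (\<lambda>y. ip A (e1 y) (e2 y)) y = 0"
        by (rule pderivative_eq_0[OF V'(1) y fr(3)])
      then show ?thesis by (simp add: pderivative_ip d1 d2 c_def)
    qed
  qed
  have de': "ip A (e2 y) (pderivative i e1 y) = - c i y" if "y \<in> V'" for i y
    using de(3)[OF that] by (simp add: ip_commute)
  have d\<theta>: "pderivative i (\<theta>1 j) y = ip A (pderivative i (f' j) y) (e1 y) - \<theta>2 j y * c i y"
    "pderivative i (\<theta>2 j) y = ip A (pderivative i (f' j) y) (e2 y) + \<theta>1 j y * c i y" if y: "y \<in> V'" for i j y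
  proof -
    note d1 = diff[OF Ce(1) y] and d2 = diff[OF Ce(2) y]
    have "pderivative i (\<theta>1 j) y = ip A (f' j y) (pderivative i e1 y) + ip A (pderivative i (f' j) y) (e1 y)"
      unfolding \<theta>1_def[abs_def] by (rule pderivative_ip[OF Df'[OF inU[OF y]] d1])
    then show "pderivative i (\<theta>1 j) y = ip A (pderivative i (f' j) y) (e1 y) - \<theta>2 j y * c i y"
      by (simp add: fexp[OF y] ip.add_left ip.scaleR_left de(1)[OF y] de'[OF y])
    have "pderivative i (\<theta>2 j) y = ip A (f' j y) (pderivative i e2 y) + ip A (pderivative i (f' j) y) (e2 y)"
      unfolding \<theta>2_def[abs_def] by (rule pderivative_ip[OF Df'[OF inU[OF y]] d2])
    then show "pderivative i (\<theta>2 j) y = ip A (pderivative i (f' j) y) (e2 y) + \<theta>1 j y * c i y"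
      by (simp add: fexp[OF y] ip.add_left ip.scaleR_left de(2)[OF y] c_def[symmetric])
  qed
  \<comment> \<open>Rodrigues' equations differentiated in direction \<open>i\<close>. The
    derivative of the frame contributes \<open>c\<close>, multiplied by the other principal
    curvature.\<close>
  have dn: "ip A (pderivative i (n' j) y) (e1 y) + l2 y * \<theta>2 j y * c i y =
      - (l1 y * pderivative i (\<theta>1 j) y + pderivative i l1 y * \<theta>1 j y)"
    "ip A (pderivative i (n' j) y) (e2 y) - l1 y * \<theta>1 j y * c i y =
      - (l2 y * pderivative i (\<theta>2 j) y + pderivative i l2 y * \<theta>2 j y)" if y: "y \<in> V'" for i j y
  proof -
    note d1 = diff[OF Ce(1) y] and d2 = diff[OF Ce(2) y]
    have "pderivative i (\<lambda>z. ip A (n' j z) (e1 z) + l1 z * \<theta>1 j z) y = 0"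
      by (rule pderivative_eq_0[OF V'(1) y, where c = 0]) (simp add: ne \<theta>1_def)
    then have "ip A (n' j y) (pderivative i e1 y) + ip A (pderivative i (n' j) y) (e1 y)
        + (l1 y * pderivative i (\<theta>1 j) y + pderivative i l1 y * \<theta>1 j y) = 0"
      by (simp add: pderivative_add pderivative_mult pderivative_ip Dn' inU[OF y] d1
          diff[OF Cl(1) y] diff[OF C\<theta>(1) y] differentiable_mult differentiable_ip)
    then show "ip A (pderivative i (n' j) y) (e1 y) + l2 y * \<theta>2 j y * c i y =
      - (l1 y * pderivative i (\<theta>1 j) y + pderivative i l1 y * \<theta>1 j y)"
      by (simp add: nexp[OF y] ip.add_left ip.scaleR_left ip.diff_left ip.minus_left de(1)[OF y] de'[OF y])
    have "pderivative i (\<lambda>z. ip A (n' j z) (e2 z) + l2 z * \<theta>2 j z) y = 0"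
      by (rule pderivative_eq_0[OF V'(1) y, where c = 0]) (simp add: ne \<theta>2_def)
    then have "ip A (n' j y) (pderivative i e2 y) + ip A (pderivative i (n' j) y) (e2 y)
        + (l2 y * pderivative i (\<theta>2 j) y + pderivative i l2 y * \<theta>2 j y) = 0"
      by (simp add: pderivative_add pderivative_mult pderivative_ip Dn' inU[OF y] d2
          diff[OF Cl(2) y] diff[OF C\<theta>(2) y] differentiable_mult differentiable_ip)
    then show "ip A (pderivative i (n' j) y) (e2 y) - l1 y * \<theta>1 j y * c i y =
      - (l2 y * pderivative i (\<theta>2 j) y + pderivative i l2 y * \<theta>2 j y)"
      by (simp add: nexp[OF y] ip.add_left ip.scaleR_left ip.diff_left ip.minus_left de(2)[OF y] c_def[symmetric])
  qed
  \<comment> \<open>Antisymmetrising in \<open>i\<close> and \<open>j\<close> removes the second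
    derivatives of \<open>f\<close> and \<open>n\<close>. \<open>X\<close>, from
    \<open>d\<theta>\<close>, and \<open>Y\<close>, from \<open>dn\<close>, contain the same
    combination of \<open>c\<close>; substituting one into the other leaves the Codazzi
    equation.\<close>
  have codazzi1: "pderivative i l1 y * \<theta>1 j y - pderivative j l1 y * \<theta>1 i y
      = D y * (pderivative i (\<theta>1 j) y - pderivative j (\<theta>1 i) y)" if y: "y \<in> V'" for i j y
  proof -
    have "ip A (pderivative i (f' j) y) (e1 y) = ip A (pderivative j (f' i) y) (e1 y)"
      "ip A (pderivative i (n' j) y) (e1 y) = ip A (pderivative j (n' i) y) (e1 y)"
      using f''_symmetric[OF inU[OF y], of i j] n''_symmetric[OF inU[OF y], of i j] by simp_all
    then have X: "\<theta>2 j y * c i y - \<theta>2 i y * c j y = - (pderivative i (\<theta>1 j) y - pderivative j (\<theta>1 i) y)"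
      and Y: "l2 y * (\<theta>2 j y * c i y - \<theta>2 i y * c j y) = -
          (l1 y * (pderivative i (\<theta>1 j) y - pderivative j (\<theta>1 i) y)
           + pderivative i l1 y * \<theta>1 j y - pderivative j l1 y * \<theta>1 i y)"
      using dn(1)[OF y, of i j] dn(1)[OF y, of j i] d\<theta>(1)[OF y, of i j] d\<theta>(1)[OF y, of j i]
      unfolding right_diff_distrib mult.assoc[symmetric] by linarith+
    show ?thesis
      using Y[unfolded X] unfolding D_def by (simp add: algebra_simps)
  qed
  have codazzi2: "pderivative i l2 y * \<theta>2 j y - pderivative j l2 y * \<theta>2 i y
      = - D y * (pderivative i (\<theta>2 j) y - pderivative j (\<theta>2 i) y)" if y: "y \<in> V'" for i j y
  proof -
    have "ip A (pderivative i (f' j) y) (e2 y) = ip A (pderivative j (f' i) y) (e2 y)"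
      "ip A (pderivative i (n' j) y) (e2 y) = ip A (pderivative j (n' i) y) (e2 y)"
      using f''_symmetric[OF inU[OF y], of i j] n''_symmetric[OF inU[OF y], of i j] by simp_all
    then have X: "\<theta>1 j y * c i y - \<theta>1 i y * c j y =  (pderivative i (\<theta>2 j) y - pderivative j (\<theta>2 i) y)"
      and Y: "l1 y * (\<theta>1 j y * c i y - \<theta>1 i y * c j y) = 
          (l2 y * (pderivative i (\<theta>2 j) y - pderivative j (\<theta>2 i) y)
           + pderivative i l2 y * \<theta>2 j y - pderivative j l2 y * \<theta>2 i y)"
      using dn(2)[OF y, of i j] dn(2)[OF y, of j i] d\<theta>(2)[OF y, of i j] d\<theta>(2)[OF y, of j i]
      unfolding right_diff_distrib mult.assoc[symmetric] by linarith+
    show ?thesis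
      using Y[unfolded X] unfolding D_def by (simp add: algebra_simps)
  qed
  define a where "a i y = - D y * \<theta>1 i y" for i y
  define w where "w i y = - pderivative i l2 y / D y" for i y
  have Ca: "Ck_on 2 (a i) V'" for i
    unfolding a_def[abs_def] by (intro Ck_on_mult Ck_on_minus C\<theta> CD V'(1))
  have Cw: "Ck_on 1 (w i) V'" for i
  proof -
    have "Ck_on 1 (pderivative i l2) V'" "Ck_on 1 D V'"
      using Cl(2) CD unfolding numeral_2_eq_2 One_nat_def
      by (blast intro: Ck_on_pderivative Ck_on_SucD)+
    then show ?thesis
      unfolding w_def[abs_def] by (intro Ck_on_divide Ck_on_minus V'(1)) (use D in force)+
  qed
  have trip: "triple (p *\<^sub>R e1 y + r *\<^sub>R e2 y) (p' *\<^sub>R e1 y + r' *\<^sub>R e2 y) (n y) = p * r' - r * p'"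
    if "y \<in> V'" for p r p' r' y
  proof -
    have "triple (p *\<^sub>R e1 y + r *\<^sub>R e2 y) (p' *\<^sub>R e1 y + r' *\<^sub>R e2 y) (n y) =
        (p * r' - r * p') * triple (e1 y) (e2 y) (n y)"
      unfolding triple_expand by simp algebra
    then show ?thesis by (simp add: fr(6)[OF that])
  qed
  have g': "g y $ i $ j = a i y * \<theta>2 j y + a j y * \<theta>2 i y" if y: "y \<in> V'" for i j y
    unfolding g[OF inU[OF y]] nexp[OF y] unfolding fexp[OF y] trip[OF y] a_def D_def by algebra
  have \<theta>nz: "\<theta>1 1 y * \<theta>2 2 y - \<theta>1 2 y * \<theta>2 1 y \<noteq> 0" if y: "y \<in> V'" for y
  proof -
    have "form1 i j y = \<theta>1 i y * \<theta>1 j y + \<theta>2 i y * \<theta>2 j y" for i j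
      unfolding form1_def fexp[OF y] using fr(1-3)[OF y]
      by (simp add: ip.add_left ip.scaleR_left ip.add_right ip.scaleR_right ip_commute[of A "e2 y" "e1 y"])
    then have "W y = (\<theta>1 1 y * \<theta>2 2 y - \<theta>1 2 y * \<theta>2 1 y)\<^sup>2"
      unfolding W_def by (simp add: power2_eq_square algebra_simps)
    then show ?thesis using form1_pos(2)[OF inU[OF y]] by auto
  qed
  have nz: "a 1 y * \<theta>2 2 y - a 2 y * \<theta>2 1 y \<noteq> 0" if y: "y \<in> V'" for y
  proof -
    have "a 1 y * \<theta>2 2 y - a 2 y * \<theta>2 1 y = - D y * (\<theta>1 1 y * \<theta>2 2 y - \<theta>1 2 y * \<theta>2 1 y)"
      unfolding a_def by algebra
    then show ?thesis using \<theta>nz[OF y] D[OF y] by auto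
  qed
  have dD: "pderivative i D y = pderivative i l2 y - pderivative i l1 y" if "y \<in> V'" for i y
    unfolding D_def[abs_def] by (rule pderivative_diff[OF diff[OF Cl(2) that] diff[OF Cl(1) that]])
  have da: "pderivative i (a j) y - pderivative j (a i) y = - (w i y * a j y - w j y * a i y)"
    if y: "y \<in> V'" for y i j
  proof -
    have "pderivative i (a j) y = - (D y * pderivative i (\<theta>1 j) y + pderivative i D y * \<theta>1 j y)" for i j
    proof -
      have "pderivative i (\<lambda>y. a j y + D y * \<theta>1 j y) y = 0"
        by (rule pderivative_eq_0[OF V'(1) y, where c = 0]) (simp add: a_def)
      then show ?thesis
        using diff[OF CD y] diff[OF C\<theta>(1) y] diff[OF Ca y]
        by (simp add: pderivative_add pderivative_mult differentiable_mult)
    qed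
    then have "pderivative i (a j) y = - (D y * pderivative i (\<theta>1 j) y + pderivative i D y * \<theta>1 j y)"
      "pderivative j (a i) y = - (D y * pderivative j (\<theta>1 i) y + pderivative j D y * \<theta>1 i y)"
      by blast+
    then have "pderivative i (a j) y - pderivative j (a i) y =
        - (pderivative i l2 y * \<theta>1 j y - pderivative j l2 y * \<theta>1 i y)"
      using codazzi1[OF y, of i j] unfolding dD[OF y] by (simp add: algebra_simps)
    also have "\<dots> = - (w i y * a j y - w j y * a i y)"
      using D[OF y] unfolding w_def a_def by simp
    finally show ?thesis .
  qed
  have db: "pderivative i (\<theta>2 j) y - pderivative j (\<theta>2 i) y = w i y * \<theta>2 j y - w j y * \<theta>2 i y"
    if y: "y \<in> V'" for y i j
    using codazzi2[OF y, of i j] D[OF y] unfolding w_def by (simp add: field_simps)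
  have curv: "scalar_curvature g x = 2 * (pderivative 1 (w 2) x - pderivative 2 (w 1) x)
      / (a 1 x * \<theta>2 2 x - a 2 x * \<theta>2 1 x)"
    by (rule scalar_curvature_null_coframe[OF V'(1,2) Ca C\<theta>(2) Cw g' nz da db])
  \<comment> \<open>Differentiating \<open>D y * w j y + pderivative j l2 y = 0\<close> takes the
    place of a quotient rule for \<open>w\<close>.\<close>
  have dw: "D x * pderivative i (w j) x + pderivative i D x * w j x = - pderivative i (pderivative j l2) x" for i j
  proof -
    have "pderivative i (\<lambda>y. D y * w j y + pderivative j l2 y) x = 0"
      by (rule pderivative_eq_0[OF V'(1,2), where c = 0]) (use D in \<open>force simp: w_def\<close>)
    moreover have "w j differentiable (at x)" "pderivative j l2 differentiable (at x)"
      using Cw[of j] Ck_on_pderivative[OF Cl(2)[unfolded numeral_2_eq_2], of j] V'(2)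
      by (auto simp: One_nat_def)
    ultimately show ?thesis
      using diff[OF CD V'(2)] by (simp add: pderivative_add pderivative_mult differentiable_mult)
  qed
  have sl: "pderivative 1 (pderivative 2 l2) x = pderivative 2 (pderivative 1 l2) x"
    unfolding pderivative_def[abs_def] by (rule second_derivative_symmetric[OF V'(1) Cl(2) V'(2)])
  let ?w = "pderivative 1 l1 x * pderivative 2 l2 x - pderivative 2 l1 x * pderivative 1 l2 x"
  have "D x * (pderivative 1 (w 2) x - pderivative 2 (w 1) x) * D x = - ?w"
  proof -
    have w: "pderivative i l2 x = - (D x * w i x)" for i using D[OF V'(2)] unfolding w_def by simp
    have X: "D x * (pderivative 1 (w 2) x - pderivative 2 (w 1) x) =
        pderivative 2 D x * w 1 x - pderivative 1 D x * w 2 x"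
      using dw[of 1 2] dw[of 2 1] sl by (simp add: algebra_simps)
    show ?thesis unfolding X dD[OF V'(2)] w by (simp add: algebra_simps)
  qed
  then have dw': "pderivative 1 (w 2) x - pderivative 2 (w 1) x = - ?w / (D x)\<^sup>2"
    using D[OF V'(2)] by (simp add: field_simps power2_eq_square)
  have "2 * (- p / q) / r = (- 2 / (q * r)) * p" for p q r :: real by simp
  then have "scalar_curvature g x = (- 2 / ((D x)\<^sup>2 * (a 1 x * \<theta>2 2 x - a 2 x * \<theta>2 1 x))) * ?w"
    unfolding curv dw' .
  moreover have "- 2 / ((D x)\<^sup>2 * (a 1 x * \<theta>2 2 x - a 2 x * \<theta>2 1 x)) \<noteq> 0"
    using D[OF V'(2)] nz[OF V'(2)] by simp
  ultimately show "\<exists>k. k \<noteq> 0 \<and> scalar_curvature g x = k * ?w" by blast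
  have "det (g x) = - (a 1 x * \<theta>2 2 x - a 2 x * \<theta>2 1 x)\<^sup>2"
    unfolding det_2 g'[OF V'(2)] by algebra
  then show "det (g x) \<noteq> 0" using nz[OF V'(2)] by simp
qed

text \<open>The Gram determinant of \<open>f' 1\<close>, \<open>f' 2\<close>, \<open>n\<close> is
  both \<open>sig A * W\<close> and \<open>sig A\<close> times the square of the triple product, so
  that square is \<open>W\<close>.\<close>

lemma triple_nonzero:
  assumes x: "x \<in> U"
  shows "triple (f' 1 x) (f' 2 x) (n x) \<noteq> 0"
proof
  assume 0: "triple (f' 1 x) (f' 2 x) (n x) = 0"
  have "(triple (f' 1 x) (f' 2 x) (n x))\<^sup>2 = W x"
    using ip_lcross_self[of A "f' 1 x" "f' 2 x"] unit[OF x] f'_normal[OF x, of 1] f'_normal[OF x, of 2]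
    unfolding W_def form1_def triple_expand ip_def using sig_mult_self[of A] by algebra
  then show False using 0 form1_pos(2)[OF x] by simp
qed

text \<open>At an umbilic point n' = - l f', so every entry of \<open>g\<close> is a sum of two
  triple products that cancel by antisymmetry.\<close>

lemma det_triple_metric_umbilic:
  assumes x: "x \<in> U" "x \<notin> V"
    and g: "\<And>i j. g x $ i $ j = triple (f' i x) (n' j x) (n x) + triple (f' j x) (n' i x) (n x)"
  shows "det (g x) = 0"
proof -
  have "disc x = 0" using x disc_nonneg[OF x(1)] V(3) by fastforce
  then have um: "form1 1 1 x * form2 1 2 x = form1 1 2 x * form2 1 1 x" "form1 1 1 x * form2 2 2 x = form1 2 2 x * form2 1 1 x"
    using pencil_discriminant_nonneg(2)[of "form1 1 1 x" "form1 2 2 x" "form1 1 2 x"] form1_pos[OF x(1)]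
    unfolding disc_def H_def W_def by blast+
  define l where "l = form2 1 1 x / form1 1 1 x"
  have l: "form2 i j x = l * form1 i j x" for i j
    using um form1_pos(1)[OF x(1)] exhaust_2[of i] exhaust_2[of j] form1_symmetric[of 2 1 x] form2_symmetric[OF x(1), of 2 1]
    unfolding l_def by (auto simp: field_simps)
  have "n' j x = - l *\<^sub>R f' j x" for j
  proof -
    have "ip A (n' j x) (f' i x) = - l * ip A (f' j x) (f' i x)" for i
      using l[of i j] unfolding form1_def form2_def by (simp add: ip_commute)
    then have "n' j x + l *\<^sub>R f' j x = 0"
      by (intro ip_eq_0_imp_eq_0[OF triple_nonzero[OF x(1)], where A = A])
        (simp_all add: ip.add_left ip.scaleR_left f'_normal n'_normal x(1))
    then show ?thesis by (simp add: eq_neg_iff_add_eq_0)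
  qed
  then have "g x $ i $ j = 0" for i j
    unfolding g triple_expand by (simp add: algebra_simps)
  then show ?thesis by (simp add: det_2)
qed

end

section \<open>The metric of the space of lines as a triple product\<close>

lemma triple_scaleR: "triple (a *\<^sub>R u) (b *\<^sub>R v + c *\<^sub>R w) (d *\<^sub>R w) = a * b * d * triple u v w"
  unfolding triple_expand by simp algebra

text \<open>
  With \<open>\<xi> = x + i y\<close> and \<open>\<eta> = p + i q\<close>, the line \<open>(\<xi>, \<eta>)\<close> has foot point \<open>W / Q\<^sup>2\<close> and direction
  \<open>(2 x, 2 y, 1 - s (x\<^sup>2 + y\<^sup>2)) / Q\<close>.  This is the equality of \<open>\<G>\<close> with the triple product metric,
  multiplied by \<open>Q\<^sup>5\<close> to clear denominators.
\<close>

lemma line_polynomial_identity: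
  fixes x y p q s dx dy dp dq dx' dy' dp' dq' :: real
  assumes s: "s * s = 1"
  defines "Q \<equiv> 1 + s * (x * x + y * y)"
    and "W1 \<equiv> 2 * (p - s * (p * (x * x - y * y) + 2 * (q * (x * y))))"
    and "W2 \<equiv> 2 * (q - s * (2 * (p * (x * y)) - q * (x * x - y * y)))"
    and "W3 \<equiv> - 4 * s * (p * x + q * y)"
    and "dQ \<equiv> 2 * s * (x * dx + y * dy)" and "dQ' \<equiv> 2 * s * (x * dx' + y * dy')"
    and "dW1 \<equiv> 2 * (dp - s * (dp * (x * x - y * y) + p * (2 * x * dx - 2 * y * dy) + 2 * (dq * x * y + q * dx * y + q * x * dy)))"
    and "dW2 \<equiv> 2 * (dq - s * (2 * (dp * x * y + p * dx * y + p * x * dy) - (dq * (x * x - y * y) + q * (2 * x * dx - 2 * y * dy))))"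
    and "dW3 \<equiv> - 4 * s * (dp * x + p * dx + dq * y + q * dy)"
    and "dW1' \<equiv> 2 * (dp' - s * (dp' * (x * x - y * y) + p * (2 * x * dx' - 2 * y * dy') + 2 * (dq' * x * y + q * dx' * y + q * x * dy')))"
    and "dW2' \<equiv> 2 * (dq' - s * (2 * (dp' * x * y + p * dx' * y + p * x * dy') - (dq' * (x * x - y * y) + q * (2 * x * dx' - 2 * y * dy'))))"
    and "dW3' \<equiv> - 4 * s * (dp' * x + p * dx' + dq' * y + q * dy')"
  shows "triple (vector [Q * dW1 - 2 * dQ * W1, Q * dW2 - 2 * dQ * W2, Q * dW3 - 2 * dQ * W3])
      (vector [2 * dx', 2 * dy', - dQ']) (vector [2 * x, 2 * y, 1 - s * (x * x + y * y)])
    + triple (vector [Q * dW1' - 2 * dQ' * W1, Q * dW2' - 2 * dQ' * W2, Q * dW3' - 2 * dQ' * W3])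
      (vector [2 * dx, 2 * dy, - dQ]) (vector [2 * x, 2 * y, 1 - s * (x * x + y * y)])
    = 4 * Q ^ 3 * (dp * dy' - dq * dx' + dp' * dy - dq' * dx)
      + 16 * s * Q ^ 2 * (q * x - p * y) * (dx * dx' + dy * dy')"
proof -
  \<comment> \<open>For each sign the claim is a polynomial identity in free variables, with no side
    relation on \<open>s\<close>.\<close>
  have "(s - 1) * (s + 1) = 0" using s by algebra
  then consider "s = 1" | "s = - 1" by auto
  then show ?thesis
  proof cases
    case 1
    show ?thesis unfolding assms(2-) triple_expand vector_3 1 by algebra
  next
    case 2
    show ?thesis unfolding assms(2-) triple_expand vector_3 2 by algebra
  qed
qed

section \<open>Direction and foot point of a line in real coordinates\<close>

definition conf_Q :: "ambient \<Rightarrow> complex \<Rightarrow> real" where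
  "conf_Q A \<xi> = 1 + sig A * (Re \<xi> * Re \<xi> + Im \<xi> * Im \<xi>)"

lemma conf_Q_pos: "\<xi> \<in> chart_domain A \<Longrightarrow> conf_Q A \<xi> > 0"
proof (cases A)
  case Euclidean
  then show ?thesis unfolding conf_Q_def by (simp add: add_pos_nonneg)
next
  case Lorentzian
  assume "\<xi> \<in> chart_domain A"
  then have "(cmod \<xi>)\<^sup>2 < 1" using Lorentzian by (simp add: power_less_one_iff abs_square_less_1)
  then show ?thesis unfolding conf_Q_def using Lorentzian unfolding cmod_power2 by (simp add: power2_eq_square)
qed

lemma has_derivative_e2u:
  assumes "conf_Q A \<xi> \<noteq> 0"
  shows "(e2u A has_derivative (\<lambda>d. - 16 * sig A * (Re \<xi> * Re d + Im \<xi> * Im d) / conf_Q A \<xi> ^ 3)) (at \<xi>)"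
proof -
  have e: "e2u A = (\<lambda>z. 4 / (conf_Q A z)\<^sup>2)"
    unfolding e2u_def[abs_def] cmod_power2 conf_Q_def by (simp add: power2_eq_square)
  define D where "D d = 2 * sig A * (Re \<xi> * Re d + Im \<xi> * Im d)" for d
  have Q: "(conf_Q A has_derivative D) (at \<xi>)"
    unfolding conf_Q_def[abs_def] D_def[abs_def]
    by (rule derivative_eq_intros refl | simp)+ (simp add: fun_eq_iff algebra_simps)
  have "(e2u A has_derivative (\<lambda>d. - 8 * D d / conf_Q A \<xi> ^ 3)) (at \<xi>)"
    unfolding e using assms
    by (auto intro!: derivative_eq_intros Q simp: fun_eq_iff field_simps power2_eq_square power3_eq_cube)
  then show ?thesis unfolding D_def by (simp add: algebra_simps)
qed

lemma wirtinger_e2u: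
  assumes "conf_Q A \<xi> \<noteq> 0"
  shows "wirtinger (e2u A) \<xi> = - (8 * sig A / conf_Q A \<xi> ^ 3) *\<^sub>R cnj \<xi>"
  unfolding wirtinger_def frechet_derivative_at[OF has_derivative_e2u[OF assms], symmetric]
  by (simp add: complex_eq_iff)

text \<open>The third power would clear these denominators. The fifth matches
  \<open>line_polynomial_identity\<close>, where the derivative of the foot point takes
  \<open>Q^3\<close>, the direction and its derivative one \<open>Q\<close> each.\<close>

lemma neutral_metric_eq:
  assumes "conf_Q A \<xi> > 0"
  shows "conf_Q A \<xi> ^ 5 * neutral_metric A (\<xi>, \<eta>) (a, b) (a', b') =
    4 * conf_Q A \<xi> ^ 3 * (Re b * Im a' - Im b * Re a' + Re b' * Im a - Im b' * Re a)
      + 16 * sig A * conf_Q A \<xi> ^ 2 * (Im \<eta> * Re \<xi> - Re \<eta> * Im \<xi>) * (Re a * Re a' + Im a * Im a')"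
proof -
  have "e2u A \<xi> = 4 / conf_Q A \<xi> ^ 2"
    unfolding e2u_def conf_Q_def cmod_power2 by (simp add: power2_eq_square)
  moreover have "conf_Q A \<xi> \<noteq> 0" using assms by simp
  ultimately show ?thesis
    unfolding neutral_metric_def using assms
    by (simp add: wirtinger_e2u) (simp add: field_simps power2_eq_square power3_eq_cube eval_nat_numeral)
qed

text \<open>Inverse stereographic projection: from the plane to the unit sphere, or from the unit
  disc to the upper sheet of the hyperboloid.\<close>

definition line_dir :: "ambient \<Rightarrow> complex \<Rightarrow> real^3" where
  "line_dir A \<xi> = inverse (conf_Q A \<xi>) *\<^sub>R
     vector [2 * Re \<xi>, 2 * Im \<xi>, 1 - sig A * (Re \<xi> * Re \<xi> + Im \<xi> * Im \<xi>)]"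

text \<open>The numerator of the point with parameter 0, split into real and imaginary parts so that
  later identities are polynomial.\<close>

definition foot_poly :: "ambient \<Rightarrow> complex \<Rightarrow> complex \<Rightarrow> real^3" where
  "foot_poly A \<xi> \<eta> = vector
     [2 * (Re \<eta> - sig A * (Re \<eta> * (Re \<xi> * Re \<xi> - Im \<xi> * Im \<xi>) + 2 * (Im \<eta> * (Re \<xi> * Im \<xi>)))),
      2 * (Im \<eta> - sig A * (2 * (Re \<eta> * (Re \<xi> * Im \<xi>)) - Im \<eta> * (Re \<xi> * Re \<xi> - Im \<xi> * Im \<xi>))),
      - 4 * sig A * (Re \<eta> * Re \<xi> + Im \<eta> * Im \<xi>)]"

definition line_foot :: "ambient \<Rightarrow> complex \<Rightarrow> complex \<Rightarrow> real^3" where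
  "line_foot A \<xi> \<eta> = inverse (conf_Q A \<xi> * conf_Q A \<xi>) *\<^sub>R foot_poly A \<xi> \<eta>"

lemma line_point_eq:
  assumes "conf_Q A \<xi> \<noteq> 0"
  shows "line_point A \<xi> \<eta> r = line_foot A \<xi> \<eta> + r *\<^sub>R line_dir A \<xi>"
proof -
  have Q: "1 + complex_of_real (sig A) * (\<xi> * cnj \<xi>) = of_real (conf_Q A \<xi>)"
    by (simp add: complex_eq_iff conf_Q_def)
  have ss: "sig A * (sig A * c) = c" for c
    using sig_mult_self[of A] by (simp add: mult.assoc[symmetric])
  have factor: "1 - \<xi>\<^sup>2 * (cnj \<xi>)\<^sup>2 = of_real (conf_Q A \<xi> * (1 - sig A * (Re \<xi> * Re \<xi> + Im \<xi> * Im \<xi>)))"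
    by (simp add: complex_eq_iff conf_Q_def power2_eq_square algebra_simps ss)
  have "Re (line_z A \<xi> \<eta> r) = line_foot A \<xi> \<eta> $ 1 + r * line_dir A \<xi> $ 1"
    "Im (line_z A \<xi> \<eta> r) = line_foot A \<xi> \<eta> $ 2 + r * line_dir A \<xi> $ 2"
    "line_t A \<xi> \<eta> r = line_foot A \<xi> \<eta> $ 3 + r * line_dir A \<xi> $ 3"
    unfolding line_z_def line_t_def Q factor line_foot_def line_dir_def foot_poly_def using assms
    by (simp_all add: of_real_power[symmetric] of_real_mult[symmetric] divide_inverse power2_eq_square del: of_real_power of_real_mult)
      (simp_all add: field_simps)
  then show ?thesis unfolding line_point_def by (simp add: vec_eq_iff forall_3)
qed

text \<open>The parameter on a line is thus measured from the foot of the perpendicular from the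
  origin. This later recovers the parameter of \<open>f z\<close> as
  \<open>sig A * ip A (f z) (n z)\<close>.\<close>

lemma ip_line_foot_dir: "ip A (line_foot A \<xi> \<eta>) (line_dir A \<xi>) = 0"
proof -
  have "ip A (foot_poly A \<xi> \<eta>) (vector [2 * Re \<xi>, 2 * Im \<xi>, 1 - sig A * (Re \<xi> * Re \<xi> + Im \<xi> * Im \<xi>)]) = 0"
    unfolding ip_def foot_poly_def vector_3 using sig_mult_self[of A] by algebra
  then show ?thesis unfolding line_foot_def line_dir_def by (simp add: ip.scaleR_left ip.scaleR_right)
qed

lemma pderivative_linear:
  assumes "bounded_linear L" "f differentiable (at x)"
  shows "pderivative i (\<lambda>y. L (f y)) x = L (pderivative i f x)"
  unfolding pderivative_def by (rule frechet_derivative_linear[OF assms])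

lemma pderivative_minus:
  "f differentiable (at x) \<Longrightarrow> pderivative i (\<lambda>y. - f y) x = - pderivative i f x"
  by (rule pderivative_linear) (auto intro: bounded_linear_minus bounded_linear_ident)

lemma Ck_on_vector_3:
  assumes "open U" "Ck_on k a U" "Ck_on k b U" "Ck_on k c U"
  shows "Ck_on k (\<lambda>x. vector [a x, b x, c x] :: real^3) U"
proof -
  have "Ck_on k (\<lambda>x. (vector [a x, b x, c x] :: real^3) $ i) U" for i
    using exhaust_3[of i] assms(2-4) by auto
  then have "Ck_on k (\<lambda>x. \<chi> i. (vector [a x, b x, c x] :: real^3) $ i) U"
    by (rule Ck_on_vec_lambda[OF assms(1)])
  then show ?thesis by simp
qed

lemma pderivative_const: "pderivative i (\<lambda>y. c) x = 0"
  unfolding pderivative_def by simp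

locale C3_congruence =
  fixes A :: ambient and U :: "(real^2) set" and h :: "real^2 \<Rightarrow> complex \<times> complex"
  assumes U: "open U" and h: "Ck_on 3 h U" and dom: "x \<in> U \<Longrightarrow> fst (h x) \<in> chart_domain A"
begin

definition X where "X z = Re (fst (h z))"
definition Y where "Y z = Im (fst (h z))"
definition P where "P z = Re (snd (h z))"
definition R where "R z = Im (snd (h z))"
definition Q where "Q z = 1 + sig A * (X z * X z + Y z * Y z)"
definition N where "N z = line_dir A (fst (h z))"
definition F where "F z = line_foot A (fst (h z)) (snd (h z))"

lemma lin: "bounded_linear (\<lambda>z. Re (fst z))" "bounded_linear (\<lambda>z. Im (fst z))"
  "bounded_linear (\<lambda>z. Re (snd z))" "bounded_linear (\<lambda>z. Im (snd z))"
  by (intro bounded_linear_compose[OF bounded_linear_Re] bounded_linear_compose[OF bounded_linear_Im]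
      bounded_linear_fst bounded_linear_snd)+

lemma Ck_coords: "Ck_on 3 X U" "Ck_on 3 Y U" "Ck_on 3 P U" "Ck_on 3 R U"
  unfolding X_def[abs_def] Y_def[abs_def] P_def[abs_def] R_def[abs_def]
  by (intro Ck_on_linear[OF U _ h] lin)+

lemma Q_pos: "z \<in> U \<Longrightarrow> Q z > 0"
  using conf_Q_pos[OF dom, of z] unfolding conf_Q_def Q_def X_def Y_def .

lemma Q_conf: "conf_Q A (fst (h z)) = Q z"
  unfolding conf_Q_def Q_def X_def Y_def ..

lemma N_eq: "N z = inverse (Q z) *\<^sub>R vector [2 * X z, 2 * Y z, 1 - sig A * (X z * X z + Y z * Y z)]"
  unfolding N_def line_dir_def Q_conf unfolding X_def Y_def ..

lemma F_eq: "F z = inverse (Q z * Q z) *\<^sub>R vector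
     [2 * (P z - sig A * (P z * (X z * X z - Y z * Y z) + 2 * (R z * (X z * Y z)))),
      2 * (R z - sig A * (2 * (P z * (X z * Y z)) - R z * (X z * X z - Y z * Y z))),
      - 4 * sig A * (P z * X z + R z * Y z)]"
  unfolding F_def line_foot_def foot_poly_def Q_conf unfolding X_def Y_def P_def R_def ..

lemma Ck_Q: "Ck_on 3 Q U"
  unfolding Q_def[abs_def] by (intro Ck_on_add Ck_on_mult Ck_on_const U Ck_coords)

lemma Ck_N: "Ck_on 3 N U"
  unfolding N_eq[abs_def]
  by (intro Ck_on_scaleR Ck_on_inverse Ck_on_vector_3 Ck_on_diff Ck_on_add Ck_on_mult Ck_on_const U Ck_coords Ck_Q)
    (use Q_pos in force)

lemma Ck_F: "Ck_on 3 F U"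
  unfolding F_eq[abs_def]
  by (intro Ck_on_scaleR Ck_on_inverse Ck_on_vector_3 Ck_on_diff Ck_on_add Ck_on_mult Ck_on_const U Ck_coords Ck_Q)
    (use Q_pos in force)

lemma Ck3_differentiable: "Ck_on 3 g U \<Longrightarrow> z \<in> U \<Longrightarrow> g differentiable (at z)"
  by (simp add: numeral_3_eq_3)

lemma diff_coords: "X differentiable (at z)" "Y differentiable (at z)" "P differentiable (at z)"
  "R differentiable (at z)" "Q differentiable (at z)" "N differentiable (at z)" "F differentiable (at z)"
  "h differentiable (at z)" if "z \<in> U"
  using Ck3_differentiable[OF _ that] Ck_coords Ck_Q Ck_N Ck_F h by blast+

text \<open>Both sides times \<open>Q^5\<close> are polynomials in the real coordinates and their
  derivatives, and \<open>neutral_metric_eq\<close> and \<open>line_polynomial_identity\<close>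
  identify these.\<close>

lemma neutral_metric_triple:
  assumes z: "z \<in> U"
  shows "neutral_metric A (h z) (pderivative i h z) (pderivative j h z) =
    triple (pderivative i F z) (pderivative j N z) (N z) + triple (pderivative j F z) (pderivative i N z) (N z)"
proof -
  note Q = Q_pos[OF z]
  note d = diff_coords[OF z]
  note rules = pderivative_add pderivative_diff pderivative_minus pderivative_mult pderivative_const d
      differentiable_add differentiable_diff differentiable_mult differentiable_const
  have vnth: "pderivative i (\<lambda>y. g y $ k) z = pderivative i g z $ k" "(\<lambda>y. g y $ k) differentiable (at z)"
    if "g differentiable (at z)" for g :: "real^2 \<Rightarrow> real^3" and i k
    using pderivative_linear[OF bounded_linear_vec_nth that] that
      bounded_linear.has_derivative[OF bounded_linear_vec_nth]
    unfolding differentiable_def by blast+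
  let ?s = "sig A" and ?x = "X z" and ?y = "Y z" and ?p = "P z" and ?q = "R z"
  define dQ where "dQ i = 2 * ?s * (?x * pderivative i X z + ?y * pderivative i Y z)" for i
  define N0 :: "real^3" where "N0 = vector [2 * ?x, 2 * ?y, 1 - ?s * (?x * ?x + ?y * ?y)]"
  define N1 :: "2 \<Rightarrow> real^3" where "N1 i = vector [2 * pderivative i X z, 2 * pderivative i Y z, - dQ i]" for i
  define F0 :: "real^3" where "F0 = vector
     [2 * (?p - ?s * (?p * (?x * ?x - ?y * ?y) + 2 * (?q * (?x * ?y)))),
      2 * (?q - ?s * (2 * (?p * (?x * ?y)) - ?q * (?x * ?x - ?y * ?y))),
      - 4 * ?s * (?p * ?x + ?q * ?y)]"
  define F1 :: "2 \<Rightarrow> real^3" where "F1 i =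
    (let dx = pderivative i X z; dy = pderivative i Y z; dp = pderivative i P z; dq = pderivative i R z in vector
     [2 * (dp - ?s * (dp * (?x * ?x - ?y * ?y) + ?p * (2 * ?x * dx - 2 * ?y * dy) + 2 * (dq * ?x * ?y + ?q * dx * ?y + ?q * ?x * dy))),
      2 * (dq - ?s * (2 * (dp * ?x * ?y + ?p * dx * ?y + ?p * ?x * dy) - (dq * (?x * ?x - ?y * ?y) + ?q * (2 * ?x * dx - 2 * ?y * dy)))),
      - 4 * ?s * (dp * ?x + ?p * dx + dq * ?y + ?q * dy)])" for i
  have dQ: "pderivative i Q z = dQ i" for i
    unfolding Q_def[abs_def] dQ_def by (simp add: rules algebra_simps)
  \<comment> \<open>\<open>N\<close> and \<open>F\<close> are differentiated through
    denominator-free products, which gives \<open>dN\<close> and \<open>dF\<close> without a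
    quotient rule.\<close>
  have QN: "Q y * N y $ k = vector [2 * X y, 2 * Y y, 1 - ?s * (X y * X y + Y y * Y y)] $ k" if "y \<in> U" for y k
    using Q_pos[OF that] unfolding N_eq by simp
  have QF: "Q y * Q y * F y $ k = vector
     [2 * (P y - ?s * (P y * (X y * X y - Y y * Y y) + 2 * (R y * (X y * Y y)))),
      2 * (R y - ?s * (2 * (P y * (X y * Y y)) - R y * (X y * X y - Y y * Y y))),
      - 4 * ?s * (P y * X y + R y * Y y)] $ k" if "y \<in> U" for y k
  proof -
    have "c * c * (inverse (c * c) * v) = v" if "c > 0" for c v :: real
      using that by (simp add: field_simps)
    from this[OF Q_pos[OF that]] show ?thesis
      unfolding F_eq vector_scaleR_component real_scaleR_def .
  qed
  have dN: "Q z * pderivative i N z $ k + dQ i * N z $ k = N1 i $ k" for i k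
  proof -
    have "pderivative i (\<lambda>y. Q y * N y $ k) z = N1 i $ k"
      by (subst pderivative_cong_open[OF U z QN], assumption)
        (use exhaust_3[of k] in \<open>elim disjE; simp add: N1_def dQ_def rules algebra_simps\<close>)
    then show ?thesis by (simp add: pderivative_mult d vnth dQ)
  qed
  have dF: "Q z * Q z * pderivative i F z $ k + 2 * Q z * dQ i * F z $ k = F1 i $ k" for i k
  proof -
    have "pderivative i (\<lambda>y. Q y * Q y * F y $ k) z = F1 i $ k"
      by (subst pderivative_cong_open[OF U z QF], assumption)
        (use exhaust_3[of k] in \<open>elim disjE; simp add: F1_def Let_def rules; simp add: algebra_simps\<close>)
    then show ?thesis by (simp add: pderivative_mult d vnth dQ differentiable_mult algebra_simps)
  qed
  have N0: "Q z *\<^sub>R N z = N0"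
    unfolding vec_eq_iff N0_def using QN[OF z] by simp
  have N1: "Q z *\<^sub>R pderivative i N z + dQ i *\<^sub>R N z = N1 i" for i
    unfolding vec_eq_iff using dN by simp
  have F1: "(Q z ^ 3) *\<^sub>R pderivative i F z = Q z *\<^sub>R F1 i - (2 * dQ i) *\<^sub>R F0" for i
  proof -
    have "Q z ^ 3 * pderivative i F z $ k = Q z * F1 i $ k - 2 * dQ i * F0 $ k" for k
      unfolding dF[symmetric] F0_def QF[OF z, symmetric] by algebra
    then show ?thesis unfolding vec_eq_iff by simp
  qed
  \<comment> \<open>The extra multiple of \<open>N z\<close> in the second slot does not change the
    triple product, since \<open>N z\<close> also stands in the third.\<close>
  have T: "Q z ^ 5 * triple (pderivative i F z) (pderivative j N z) (N z) =
      triple (Q z *\<^sub>R F1 i - (2 * dQ i) *\<^sub>R F0) (N1 j) N0" for i j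
    unfolding F1[symmetric] N1[symmetric] N0[symmetric] triple_scaleR by algebra
  have coords: "Re (fst (pderivative i h z)) = pderivative i X z" "Im (fst (pderivative i h z)) = pderivative i Y z"
    "Re (snd (pderivative i h z)) = pderivative i P z" "Im (snd (pderivative i h z)) = pderivative i R z" for i
    unfolding X_def[abs_def] Y_def[abs_def] P_def[abs_def] R_def[abs_def]
    using pderivative_linear[OF lin(1) d(8)] pderivative_linear[OF lin(2) d(8)]
      pderivative_linear[OF lin(3) d(8)] pderivative_linear[OF lin(4) d(8)] by simp_all
  have "Q z ^ 5 * neutral_metric A (h z) (pderivative i h z) (pderivative j h z) =
    4 * Q z ^ 3 * (pderivative i P z * pderivative j Y z - pderivative i R z * pderivative j X z
        + pderivative j P z * pderivative i Y z - pderivative j R z * pderivative i X z)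
      + 16 * ?s * Q z ^ 2 * (?q * ?x - ?p * ?y) * (pderivative i X z * pderivative j X z + pderivative i Y z * pderivative j Y z)"
    using neutral_metric_eq[of A "fst (h z)" "snd (h z)" "fst (pderivative i h z)" "snd (pderivative i h z)"
        "fst (pderivative j h z)" "snd (pderivative j h z)"] Q
    unfolding Q_conf coords prod.collapse unfolding X_def[of z, symmetric] Y_def[of z, symmetric] P_def[of z, symmetric] R_def[of z, symmetric]
    by simp
  also have "\<dots> = triple (Q z *\<^sub>R F1 i - (2 * dQ i) *\<^sub>R F0) (N1 j) N0 + triple (Q z *\<^sub>R F1 j - (2 * dQ j) *\<^sub>R F0) (N1 i) N0"
  proof -
    have "(\<forall>k. u $ k = v $ k) \<Longrightarrow> u = v" for u v :: "real^3" by (simp add: vec_eq_iff)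
    note id = line_polynomial_identity[OF sig_mult_self[of A], where x = ?x and y = ?y and p = ?p and q = ?q
        and dx = "pderivative i X z" and dy = "pderivative i Y z" and dp = "pderivative i P z" and dq = "pderivative i R z"
        and dx' = "pderivative j X z" and dy' = "pderivative j Y z" and dp' = "pderivative j P z" and dq' = "pderivative j R z",
        folded Q_def dQ_def]
    show ?thesis
      unfolding id[symmetric] by (simp add: triple_expand F1_def Let_def F0_def N1_def N0_def)
  qed
  also have "\<dots> = Q z ^ 5 * (triple (pderivative i F z) (pderivative j N z) (N z) + triple (pderivative j F z) (pderivative i N z) (N z))"
    unfolding distrib_left T ..
  finally show ?thesis using Q by simp
qed

end

section \<open>Normal congruences of class C^3\<close>

lemma linear_half_turn: "bounded_linear half_turn"
proof -
  have "linear half_turn"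
    by (rule linearI) (simp_all add: half_turn_def vec_eq_iff forall_3)
  then show ?thesis by (simp add: linear_conv_bounded_linear)
qed

text \<open>\<open>T\<close> is the identity or the half turn, both orientation-preserving
  isometries, so quantities built from \<open>ip\<close> and \<open>triple\<close> may be computed
  in the standard chart.\<close>

lemma line_chart_isometry:
  assumes "L \<in> line_charts A"
  obtains T where "bounded_linear T" "\<And>u v. ip A (T u) (T v) = ip A u v"
    "\<And>u v w. triple (T u) (T v) (T w) = triple u v w" "\<And>\<xi> \<eta> r. L \<xi> \<eta> r = T (line_point A \<xi> \<eta> r)"
proof -
  consider "L = line_point A" | "A = Euclidean" "L = (\<lambda>\<xi> \<eta> r. half_turn (line_point A \<xi> \<eta> r))"
    using assms by (cases A) auto
  then show thesis
  proof cases
    case 1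
    show thesis by (rule that[of "\<lambda>u. u"]) (simp_all add: 1 bounded_linear_ident)
  next
    case 2
    show thesis
    proof (rule that[of half_turn])
      show "ip A (half_turn u) (half_turn v) = ip A u v" for u v
        unfolding ip_def half_turn_def by simp
      show "triple (half_turn u) (half_turn v) (half_turn w) = triple u v w" for u v w
        unfolding triple_expand half_turn_def vector_3 by algebra
    qed (simp_all add: 2 linear_half_turn)
  qed
qed

lemma congruence_patch_normal_patch: "congruence_patch A S U f n L h \<Longrightarrow> normal_patch A S U f n"
  unfolding congruence_patch_def by blast

lemma congruence_patch_C2_patch: "congruence_patch A S U f n L h \<Longrightarrow> C2_patch S U f"
  unfolding congruence_patch_def normal_patch_def by blast

text \<open>\<open>f\<close> is given as C^2 only, whereas \<open>n\<close> is visibly C^3. In the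
  decomposition of \<open>f\<close> as foot point plus \<open>r\<close> times \<open>n\<close>, the
  derivative of \<open>r\<close> is \<open>sig A\<close> times the pairing of the foot point with
  dn, because df and dn are orthogonal to \<open>n\<close>. It involves no derivative of
  \<open>f\<close>, so \<open>r\<close> and then \<open>f\<close> are C^3.\<close>

lemma congruence_patch_triple_metric:
  assumes c: "congruence_patch A S U f n L h" and h: "Ck_on 3 h U"
    and sp: "A = Lorentzian \<Longrightarrow> space_like S"
  shows "C3_normal_patch A U f n"
    and "\<And>z i j. z \<in> U \<Longrightarrow> induced_metric A h z $ i $ j =
      triple (pderivative i f z) (pderivative j n z) (n z) + triple (pderivative j f z) (pderivative i n z) (n z)"
proof -
  note normal_patch_c = congruence_patch_normal_patch[OF c] and C2_patch_c = congruence_patch_C2_patch[OF c]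
  interpret C3_congruence A U h
    using c h C2_patch_c unfolding congruence_patch_def C2_patch_def by unfold_locales auto
  have "L \<in> line_charts A" using c unfolding congruence_patch_def by blast
  then obtain T where T: "bounded_linear T" "\<And>u v. ip A (T u) (T v) = ip A u v"
    "\<And>u v w. triple (T u) (T v) (T w) = triple u v w" "\<And>\<xi> \<eta> r. L \<xi> \<eta> r = T (line_point A \<xi> \<eta> r)"
    using line_chart_isometry by blast
  interpret T: bounded_linear T by (rule T(1))
  have unit: "ip A (n z) (n z) = sig A" and normal: "ip A (frechet_derivative f (at z) v) (n z) = 0"
    if "z \<in> U" for z v
    using normal_patch_c that unfolding normal_patch_def by auto
  have f2: "Ck_on 2 f U" using C2_patch_c unfolding C2_patch_def by blast
  have Df: "f differentiable (at z)" if "z \<in> U" for z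
    using f2 that by (auto simp: numeral_2_eq_2)
  define r where "r z = sig A * ip A (f z) (n z)" for z
  have pt: "n z = T (N z) \<and> f z = T (F z) + r z *\<^sub>R n z" if z: "z \<in> U" for z
  proof -
    obtain r0 where r0: "\<And>s. f z + s *\<^sub>R n z = L (fst (h z)) (snd (h z)) (r0 + s)"
      using c z unfolding congruence_patch_def by blast
    have r1: "f z + s *\<^sub>R n z = T (F z) + (r0 + s) *\<^sub>R T (N z)" for s
      unfolding r0 T(4) using Q_pos[OF z] line_point_eq[of A "fst (h z)" "snd (h z)" "r0 + s"]
      by (simp add: Q_conf F_def N_def T.add T.scaleR)
    \<comment> \<open>Two points of the line give its direction; the first one then gives its
      position.\<close>
    from r1[of 0] r1[of 1] have n: "n z = T (N z)"
      by (simp add: scaleR_left_distrib)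
    with r1[of 0] have f: "f z = T (F z) + r0 *\<^sub>R n z" by simp
    have "ip A (T (F z)) (n z) = 0"
      unfolding n T(2) F_def N_def by (rule ip_line_foot_dir)
    then have "ip A (f z) (n z) = r0 * sig A"
      unfolding f by (simp add: ip.add_left ip.scaleR_left unit[OF z])
    then have "r0 = r z" unfolding r_def using sig_mult_self[of A] by (simp add: algebra_simps)
    with n f show ?thesis by simp
  qed
  have n3: "Ck_on 3 n U"
    using Ck_on_cong[OF U, of n "\<lambda>z. T (N z)" 3] pt Ck_on_linear[OF U T(1) Ck_N] by blast
  have n3': "Ck_on (Suc 2) n U" using n3 by (simp only: eval_nat_numeral)
  have Dn: "n differentiable (at z)" if "z \<in> U" for z using Ck3_differentiable[OF n3 that] .
  have nn: "ip A (n z) (frechet_derivative n (at z) v) = 0" if z: "z \<in> U" for z v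
  proof -
    have "((\<lambda>y. ip A (n y) (n y)) has_derivative (\<lambda>v. ip A (n z) (frechet_derivative n (at z) v)
        + ip A (frechet_derivative n (at z) v) (n z))) (at z)"
      using Dn[OF z] by (intro ip.FDERIV) (simp_all add: frechet_derivative_works[symmetric])
    moreover have "((\<lambda>y. ip A (n y) (n y)) has_derivative (\<lambda>v. 0)) (at z)"
      by (subst has_derivative_cong_open[OF U z, of _ "\<lambda>y. sig A"]) (simp_all add: unit)
    ultimately have "(\<lambda>v. ip A (n z) (frechet_derivative n (at z) v)
        + ip A (frechet_derivative n (at z) v) (n z)) = (\<lambda>v. 0)"
      by (rule has_derivative_unique)
    from fun_cong[OF this, of v] show ?thesis by (simp add: ip_commute)
  qed
  have TF: "Ck_on 3 (\<lambda>z. T (F z)) U" by (rule Ck_on_linear[OF U T(1) Ck_F])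
  have r3: "Ck_on (Suc 2) r U"
  proof (rule Ck_on_SucI[OF U])
    show "(r has_derivative (\<lambda>v. sig A * ip A (T (F z)) (frechet_derivative n (at z) v))) (at z)" if z: "z \<in> U" for z
    proof -
      have "((\<lambda>y. ip A (f y) (n y)) has_derivative (\<lambda>v. ip A (f z) (frechet_derivative n (at z) v)
        + ip A (frechet_derivative f (at z) v) (n z))) (at z)"
        using Dn[OF z] Df[OF z] by (intro ip.FDERIV) (simp_all add: frechet_derivative_works[symmetric])
      then have "(r has_derivative (\<lambda>v. sig A * (ip A (f z) (frechet_derivative n (at z) v)
        + ip A (frechet_derivative f (at z) v) (n z)))) (at z)"
        unfolding r_def[abs_def] by (rule has_derivative_mult_right)
      moreover have "ip A (f z) (frechet_derivative n (at z) v) = ip A (T (F z)) (frechet_derivative n (at z) v)" for v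
        using pt[OF z] nn[OF z, of v] by (metis ip.add_left ip.scaleR_left add_0_right scaleR_zero_right)
      ultimately show ?thesis by (simp add: normal[OF z])
    qed
    show "Ck_on 2 (\<lambda>z. sig A * ip A (T (F z)) (frechet_derivative n (at z) v)) U" for v
      by (intro Ck_on_mult Ck_on_const Ck_on_bilinear[OF U bounded_bilinear_ip] U Ck_on_derivative[OF n3'] Ck_on_mono[OF TF]) simp
  qed
  then have r3: "Ck_on 3 r U" by (simp only: eval_nat_numeral)
  have f3: "Ck_on 3 f U"
    using Ck_on_cong[OF U, of f "\<lambda>z. T (F z) + r z *\<^sub>R n z" 3] pt
      Ck_on_add[OF U TF Ck_on_scaleR[OF U r3 n3]] by blast
  show "C3_normal_patch A U f n"
  proof
    show "ip A (frechet_derivative f (at z) v) (frechet_derivative f (at z) v) > 0" if z: "z \<in> U" and v: "v \<noteq> 0" for z v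
    proof (cases A)
      case Lorentzian
      then show ?thesis
        using sp C2_patch_c z v unfolding space_like_def fundamental_form_1_def by auto
    next
      case Euclidean
      have "inj (frechet_derivative f (at z))" using C2_patch_c z unfolding C2_patch_def by blast
      moreover have "linear (frechet_derivative f (at z))" using linear_frechet_derivative[OF Df[OF z]] .
      ultimately have "frechet_derivative f (at z) v \<noteq> 0"
        using v by (metis injD linear_0)
      moreover have "ip Euclidean u u = u \<bullet> u" for u
        unfolding ip_def by (simp add: inner_vec_def sum_3)
      ultimately show ?thesis using Euclidean by simp
    qed
  qed (use U f3 n3 unit normal in auto)
  show "induced_metric A h z $ i $ j =
     triple (pderivative i f z) (pderivative j n z) (n z) + triple (pderivative j f z) (pderivative i n z) (n z)"
    if z: "z \<in> U" for z i j
  proof -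
    note d = diff_coords[OF z]
    have dr: "r differentiable (at z)" using Ck3_differentiable[OF r3 z] .
    have dTF: "(\<lambda>y. T (F y)) differentiable (at z)" using Ck3_differentiable[OF TF z] .
    have pn: "pderivative i n z = T (pderivative i N z)" for i
      using pderivative_cong_open[OF U z, of n "\<lambda>y. T (N y)"] pt pderivative_linear[OF T(1) d(6)] by metis
    have pf: "pderivative i f z = T (pderivative i F z) + (r z *\<^sub>R pderivative i n z + pderivative i r z *\<^sub>R n z)" for i
    proof -
      have "pderivative i f z = pderivative i (\<lambda>y. T (F y) + r y *\<^sub>R n y) z"
        by (rule pderivative_cong_open[OF U z]) (use pt in blast)
      moreover have "(\<lambda>y. r y *\<^sub>R n y) differentiable (at z)"
        by (rule differentiable_scaleR[OF dr Dn[OF z]])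
      ultimately show ?thesis
        by (simp add: pderivative_add dTF pderivative_linear[OF T(1) d(7)]
            pderivative_bilinear[OF bounded_bilinear_scaleR dr Dn[OF z]])
    qed
    \<comment> \<open>Terms with \<open>n z\<close> twice vanish, and those with \<open>a\<close>
      cancel because both derivatives of \<open>f\<close> carry the same coefficient
      \<open>r z\<close>.\<close>
    have "triple (u + (a *\<^sub>R v + b *\<^sub>R n z)) v' (n z) + triple (u' + (a *\<^sub>R v' + b' *\<^sub>R n z)) v (n z)
        = triple u v' (n z) + triple u' v (n z)" for u u' v v' a b b'
      unfolding triple_expand vector_add_component vector_scaleR_component real_scaleR_def by algebra
    then have "triple (pderivative i f z) (pderivative j n z) (n z) + triple (pderivative j f z) (pderivative i n z) (n z)
      = triple (T (pderivative i F z)) (pderivative j n z) (n z) + triple (T (pderivative j F z)) (pderivative i n z) (n z)"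
      unfolding pf by blast
    also have "\<dots> = neutral_metric A (h z) (pderivative i h z) (pderivative j h z)"
      unfolding pn pt[OF z, THEN conjunct1] T(3) by (rule neutral_metric_triple[OF z, symmetric])
    finally show ?thesis unfolding induced_metric_def by simp
  qed
qed

section \<open>Changes of parameter\<close>

text \<open>With a left inverse \<open>P\<close> of \<open>D\<close>, the map \<open>P\<close> after
  \<open>g\<close> has the identity as derivative at \<open>\<phi> y\<close>. Hence the increment of
  \<open>\<phi>\<close> is that of \<open>m\<close> up to a small multiple of itself. Absorbing this
  multiple bounds the increment linearly, and the bound then makes the error small.\<close>

lemma differentiable_lift:
  fixes f :: "'a::real_normed_vector \<Rightarrow> 'c::euclidean_space" and g :: "'b::euclidean_space \<Rightarrow> 'c"
  assumes g: "(g has_derivative D) (at (\<phi> y))" "inj D"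
    and W: "open W" "y \<in> W" "\<And>z. z \<in> W \<Longrightarrow> g (\<phi> z) = f z"
    and f: "f differentiable (at y)" and c: "continuous (at y) \<phi>"
  shows "\<phi> differentiable (at y)"
proof -
  have "linear D" using g(1) has_derivative_linear by blast
  then obtain P where P: "linear P" "P \<circ> D = id"
    using linear_injective_left_inverse g(2) by blast
  have bP: "bounded_linear P" using P(1) by (simp add: linear_conv_bounded_linear)
  have PD: "P (D v) = v" for v using P(2) by (metis comp_apply id_apply)
  define G where "G = (\<lambda>u. P (g u))"
  have G: "(G has_derivative (\<lambda>v. v)) (at (\<phi> y))"
    using bounded_linear.has_derivative[OF bP g(1)] unfolding G_def PD .
  define m where "m = (\<lambda>z. P (f z))"
  define M where "M = (\<lambda>v. P (frechet_derivative f (at y) v))"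
  have m: "(m has_derivative M) (at y)"
    using bounded_linear.has_derivative[OF bP] f unfolding m_def M_def frechet_derivative_works by blast
  have bM: "bounded_linear M" using m has_derivative_bounded_linear by blast
  then obtain K where K: "K > 0" "\<And>v. norm (M v) \<le> norm v * K"
    using bounded_linear.pos_bounded by blast
  have Gm: "G (\<phi> z) = m z" if "z \<in> W" for z
    using W(3)[OF that] unfolding G_def m_def by simp
  have "(\<phi> has_derivative M) (at y)"
    unfolding has_derivative_at_alt
  proof (intro conjI allI impI bM)
    fix e :: real assume e: "e > 0"
    \<comment> \<open>The bound 1/2 lets \<open>e1 * norm ?k\<close> be absorbed on the left, giving
      \<open>norm ?k \<le> 2 * (K + 1) * ?t\<close>; the other bound then makes
      \<open>e1 * norm ?k\<close> at most half of \<open>e * ?t\<close>.\<close>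
    define e1 where "e1 = min (1/2) (e / (4 * (K + 1)))"
    have "e1 \<le> 1/2" unfolding e1_def by (rule min.cobounded1)
    moreover have "e1 \<le> e / (4 * (K + 1))" unfolding e1_def by (rule min.cobounded2)
    moreover have "e1 > 0" unfolding e1_def using e K(1) by simp
    ultimately have e1: "e1 > 0" "e1 \<le> 1/2" "e1 * (4 * (K + 1)) \<le> e"
      using K(1) by (simp_all add: pos_le_divide_eq)
    define e2 where "e2 = min 1 (e / 2)"
    have e2: "e2 > 0" "e2 \<le> 1" "2 * e2 \<le> e" using e unfolding e2_def by auto
    obtain d1 where d1: "d1 > 0" "\<And>u. norm (u - \<phi> y) < d1 \<Longrightarrow> norm (G u - G (\<phi> y) - (u - \<phi> y)) \<le> e1 * norm (u - \<phi> y)"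
      using G e1(1) unfolding has_derivative_at_alt by blast
    obtain d2 where d2: "d2 > 0" "\<And>z. norm (z - y) < d2 \<Longrightarrow> norm (\<phi> z - \<phi> y) < d1"
      using c d1(1) unfolding continuous_at_eps_delta dist_norm by blast
    obtain d3 where d3: "d3 > 0" "\<And>z. norm (z - y) < d3 \<Longrightarrow> norm (m z - m y - M (z - y)) \<le> e2 * norm (z - y)"
      using m e2(1) unfolding has_derivative_at_alt by blast
    obtain d4 where d4: "d4 > 0" "\<And>z. norm (z - y) < d4 \<Longrightarrow> z \<in> W"
      using W(1,2) unfolding open_dist dist_norm by blast
    have "norm (\<phi> z - \<phi> y - M (z - y)) \<le> e * norm (z - y)"
      if z: "norm (z - y) < min d2 (min d3 d4)" for z
    proof -
      let ?k = "\<phi> z - \<phi> y" and ?t = "norm (z - y)"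
      have zW: "z \<in> W" using d4 z by simp
      define A where "A = m z - m y - M (z - y)"
      define B where "B = m z - m y - ?k"
      have A: "norm A \<le> e2 * ?t" unfolding A_def using d3 z by simp
      have B: "norm B \<le> e1 * norm ?k"
        unfolding B_def Gm[OF zW, symmetric] Gm[OF W(2), symmetric] using d1(2) d2(2) z by simp
      have "norm ?k = norm (A + M (z - y) - B)" unfolding A_def B_def by simp
      also have "\<dots> \<le> norm A + norm (M (z - y)) + norm B"
        using norm_triangle_ineq4[of "A + M (z - y)" B] norm_triangle_ineq[of A "M (z - y)"] by linarith
      also have "\<dots> \<le> e2 * ?t + ?t * K + e1 * norm ?k"
        using A B K(2)[of "z - y"] by linarith
      also have "\<dots> \<le> 1 * ?t + ?t * K + (1/2) * norm ?k"
        using e1(2) e2(2) by (intro add_mono mult_right_mono order_refl) simp_all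
      finally have k: "norm ?k \<le> 2 * (K + 1) * ?t" by (simp add: algebra_simps)
      have "norm (?k - M (z - y)) = norm (A - B)" unfolding A_def B_def by (simp add: algebra_simps)
      also have "\<dots> \<le> e2 * ?t + e1 * norm ?k"
        using norm_triangle_ineq4[of A B] A B by linarith
      also have "\<dots> \<le> e2 * ?t + e1 * (2 * (K + 1) * ?t)"
        using k e1(1) by simp
      also have "\<dots> = (2 * e2 + e1 * (4 * (K + 1))) * ?t / 2" by (simp add: algebra_simps)
      also have "\<dots> \<le> (e + e) * ?t / 2"
        using e1(3) e2(3) by (intro divide_right_mono mult_right_mono add_mono) simp_all
      finally show ?thesis by simp
    qed
    then show "\<exists>d>0. \<forall>z. norm (z - y) < d \<longrightarrow> norm (\<phi> z - \<phi> y - M (z - y)) \<le> e * norm (z - y)"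
      using d2(1) d3(1) d4(1) by (intro exI[of _ "min d2 (min d3 d4)"]) auto
  qed
  then show ?thesis unfolding differentiable_def by blast
qed

text \<open>The transition map is the inverse homeomorphism of \<open>g\<close> after
  \<open>f\<close>, defined near \<open>x\<close> because the image of \<open>g\<close> is open in
  \<open>S\<close>. At first it is only continuous; \<open>differentiable_lift\<close> applies since
  \<open>g\<close> is an immersion.\<close>

lemma C2_patch_transition:
  assumes f: "C2_patch S U f" and g: "C2_patch S U' g" and x: "x \<in> U" and x': "x' \<in> U'" "g x' = f x"
  obtains W \<phi> where "open W" "x \<in> W" "W \<subseteq> U" "\<phi> x = x'" "\<And>y. y \<in> W \<Longrightarrow> \<phi> y \<in> U' \<and> g (\<phi> y) = f y"
    "\<And>y. y \<in> W \<Longrightarrow> \<phi> differentiable (at y)"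
proof -
  have U: "open U" and f2: "Ck_on 2 f U" and fS: "f ` U \<subseteq> S"
    using f openin_imp_subset[of _ S "f ` U"] unfolding C2_patch_def by blast+
  have g2: "Ck_on 2 g U'" and ginj: "\<And>y. y \<in> U' \<Longrightarrow> inj (frechet_derivative g (at y))"
    and go: "openin (top_of_set S) (g ` U')"
    using g unfolding C2_patch_def by auto
  obtain g' where g': "homeomorphism U' (g ` U') g g'" using g unfolding C2_patch_def by auto
  obtain T where T: "open T" "g ` U' = S \<inter> T" using go unfolding openin_open by blast
  define W where "W = U \<inter> f -` T"
  have cf: "continuous_on U f" using Ck_on_continuous[OF f2] .
  have W: "open W" unfolding W_def by (rule continuous_open_preimage[OF cf U T(1)])
  have fW: "f y \<in> g ` U'" if "y \<in> W" for y
    using that fS unfolding W_def T(2) by auto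
  have "f x \<in> g ` U'" using x' by (metis image_eqI)
  then have xW: "x \<in> W" using x unfolding W_def T(2) by auto
  define \<phi> where "\<phi> = g' \<circ> f"
  have \<phi>: "\<phi> y \<in> U' \<and> g (\<phi> y) = f y" if "y \<in> W" for y
    using fW[OF that] g' unfolding \<phi>_def homeomorphism_def by auto
  have c\<phi>: "continuous_on W \<phi>"
    unfolding \<phi>_def
  proof (rule continuous_on_compose)
    show "continuous_on W f" by (rule continuous_on_subset[OF cf]) (auto simp: W_def)
    show "continuous_on (f ` W) g'"
      by (rule continuous_on_subset[of "g ` U'"]) (use g' fW in \<open>auto simp: homeomorphism_def\<close>)
  qed
  show thesis
  proof (rule that[OF W xW])
    show "\<phi> x = x'" using g' x' unfolding \<phi>_def homeomorphism_def by (metis comp_apply)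
    show "\<phi> differentiable (at y)" if y: "y \<in> W" for y
    proof (rule differentiable_lift)
      show "(g has_derivative frechet_derivative g (at (\<phi> y))) (at (\<phi> y))"
        using g2 \<phi>[OF y] by (auto simp: numeral_2_eq_2 frechet_derivative_works[symmetric])
      show "f differentiable (at y)" using f2 y by (auto simp: W_def numeral_2_eq_2)
      show "continuous (at y) \<phi>" using c\<phi> W y continuous_on_eq_continuous_at by blast
    qed (use W y \<phi> ginj in auto)
  qed (use \<phi> W_def in auto)
qed

lemma (in C3_normal_patch) normal_unique:
  assumes x: "x \<in> U" and m: "ip A m m = sig A" "\<And>v. ip A (frechet_derivative f (at x) v) m = 0"
  defines "c \<equiv> sig A * ip A m (n x)"
  shows "m = c *\<^sub>R n x" "c = 1 \<or> c = - 1"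
proof -
  have "ip A m (f' i x) = 0" for i
    using m(2) unfolding pderivative_def by (simp add: ip_commute)
  moreover have "ip A (n x) (f' i x) = 0" for i
    using f'_normal[OF x] by (simp add: ip_commute)
  ultimately have "m - c *\<^sub>R n x = 0"
    by (intro ip_eq_0_imp_eq_0[OF triple_nonzero[OF x], where A = A])
      (use sig_mult_self[of A] in \<open>simp_all add: ip.diff_left ip.scaleR_left unit[OF x] c_def mult_ac\<close>)
  then show mc: "m = c *\<^sub>R n x" by simp
  have "ip A m m = c * c * sig A"
    by (simp add: mc ip.scaleR_left ip.scaleR_right unit[OF x])
  then have "(c - 1) * (c + 1) = 0" using m(1) by (simp add: algebra_simps)
  then show "c = 1 \<or> c = - 1" by auto
qed

text \<open>\<open>D\<close> is bijective, so one eigenvalue problem is the pullback of the other,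
  and a sign \<open>\<sigma>\<close> in the normal multiplies the eigenvalues.\<close>

lemma principal_curvatures_transition:
  assumes \<sigma>: "\<sigma> * \<sigma> = (1::real)" and D: "linear D" "inj D"
    and 1: "\<And>v w. fundamental_form_1 A f x v w = fundamental_form_1 A g y (D v) (D w)"
    and 2: "\<And>v w. fundamental_form_2 A f n x v w = \<sigma> * fundamental_form_2 A g m y (D v) (D w)"
  shows "principal_curvatures A f n x = (\<lambda>l. \<sigma> * l) ` principal_curvatures A g m y"
proof -
  have "surj D" using linear_injective_imp_surjective[OF D refl] .
  have D0: "D v = 0 \<longleftrightarrow> v = 0" for v
    using linear_0[OF D(1)] injD[OF D(2), of v 0] by auto
  have iff: "l \<in> principal_curvatures A f n x \<longleftrightarrow> \<sigma> * l \<in> principal_curvatures A g m y" for l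
  proof -
    have "(\<forall>w. \<sigma> * fundamental_form_2 A g m y v (D w) = l * fundamental_form_1 A g y v (D w)) \<longleftrightarrow>
      (\<forall>w. fundamental_form_2 A g m y v w = \<sigma> * l * fundamental_form_1 A g y v w)" for v
    proof -
      have "\<sigma> * a = l * b \<longleftrightarrow> a = \<sigma> * l * b" for a b
        using \<sigma> by algebra
      then show ?thesis using \<open>surj D\<close> by (metis surjD)
    qed
    then have "l \<in> principal_curvatures A f n x \<longleftrightarrow> (\<exists>v. v \<noteq> 0 \<and>
        (\<forall>w. fundamental_form_2 A g m y (D v) w = \<sigma> * l * fundamental_form_1 A g y (D v) w))"
      unfolding principal_curvatures_def mem_Collect_eq 1 2 by simp
    also have "\<dots> \<longleftrightarrow> \<sigma> * l \<in> principal_curvatures A g m y"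
      unfolding principal_curvatures_def mem_Collect_eq
    proof
      assume "\<exists>v. v \<noteq> 0 \<and> (\<forall>w. fundamental_form_2 A g m y v w = \<sigma> * l * fundamental_form_1 A g y v w)"
      then obtain u where u: "u \<noteq> 0" "\<forall>w. fundamental_form_2 A g m y u w = \<sigma> * l * fundamental_form_1 A g y u w"
        by blast
      obtain v where "u = D v" using \<open>surj D\<close> by blast
      then show "\<exists>v. v \<noteq> 0 \<and> (\<forall>w. fundamental_form_2 A g m y (D v) w = \<sigma> * l * fundamental_form_1 A g y (D v) w)"
        using u D0 by blast
    qed (use D0 in blast)
    finally show ?thesis .
  qed
  show ?thesis
  proof (rule set_eqI)
    fix l
    have "l = \<sigma> * (\<sigma> * l)" using \<sigma> by algebra
    moreover have "\<sigma> * (\<sigma> * l') = l'" for l' using \<sigma> by algebra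
    ultimately show "l \<in> principal_curvatures A f n x \<longleftrightarrow> l \<in> (\<lambda>l. \<sigma> * l) ` principal_curvatures A g m y"
      unfolding iff by (metis (no_types, lifting) image_iff)
  qed
qed

lemma wedge_d_same_derivative:
  assumes "frechet_derivative a (at x) = frechet_derivative b (at x)"
  shows "wedge_d a b x v w = 0"
  unfolding wedge_d_def assms by simp

lemma wedge_d_pderivative:
  assumes "a differentiable (at x)" "b differentiable (at x)"
  shows "wedge_d a b x v w = (v $ 1 * w $ 2 - v $ 2 * w $ 1) *
    (pderivative 1 a x * pderivative 2 b x - pderivative 2 a x * pderivative 1 b x)"
  unfolding wedge_d_def frechet_derivative_pderivative[OF assms(1)] frechet_derivative_pderivative[OF assms(2)]
  by (simp add: algebra_simps)

text \<open>\<open>b - a\<close> has a minimum at \<open>x\<close>, so the two differentials agree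
  there. This settles the umbilic points.\<close>

lemma wedge_d_eq_0_of_touching:
  assumes "open W" "x \<in> W" "\<And>y. y \<in> W \<Longrightarrow> a y \<le> b y" "a x = b x"
    and "a differentiable (at x)" "b differentiable (at x)"
  shows "wedge_d a b x v w = 0"
proof -
  have "((\<lambda>y. b y - a y) has_derivative (\<lambda>v. frechet_derivative b (at x) v - frechet_derivative a (at x) v)) (at x)"
    using assms(5,6) unfolding frechet_derivative_works by (intro has_derivative_diff)
  then have "(\<lambda>v. frechet_derivative b (at x) v - frechet_derivative a (at x) v) = (\<lambda>v. 0)"
    by (rule differential_zero_maxmin[OF assms(2,1)]) (use assms(3,4) in auto)
  then have "frechet_derivative a (at x) = frechet_derivative b (at x)"
    by (simp add: fun_eq_iff)
  then show ?thesis by (rule wedge_d_same_derivative)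
qed

section \<open>Comparison of an arbitrary C^2 patch with a C^3 patch\<close>

context C3_normal_patch
begin

lemma l_differentiable: "x \<in> V \<Longrightarrow> l1 differentiable (at x)" "x \<in> V \<Longrightarrow> l2 differentiable (at x)"
  using Ck2_l by (auto simp: numeral_2_eq_2)

lemma l_eq_outside_V: "x \<in> U \<Longrightarrow> x \<notin> V \<Longrightarrow> l1 x = l2 x"
  using disc_nonneg[of x] V(3)[of x] unfolding l1_def l2_def by simp

lemma wedge_d_eq_0_iff_scalar_curvature_eq_0:
  assumes x: "x \<in> V"
    and g: "\<And>y i j. y \<in> U \<Longrightarrow>
      g y $ i $ j = triple (f' i y) (n' j y) (n y) + triple (f' j y) (n' i y) (n y)"
  shows "(\<forall>v w. wedge_d l1 l2 x v w = 0) \<longleftrightarrow> scalar_curvature g x = 0"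
proof -
  obtain k where k: "k \<noteq> 0" "scalar_curvature g x =
      k * (pderivative 1 l1 x * pderivative 2 l2 x - pderivative 2 l1 x * pderivative 1 l2 x)"
    using scalar_curvature_triple_metric(1)[OF x g] by blast
  note w = wedge_d_pderivative[OF l_differentiable[OF x]]
  show ?thesis
  proof
    assume "\<forall>v w. wedge_d l1 l2 x v w = 0"
    then have "wedge_d l1 l2 x (axis 1 1) (axis 2 1) = 0" by blast
    then show "scalar_curvature g x = 0" unfolding w k(2) by (simp add: axis_def)
  next
    assume "scalar_curvature g x = 0"
    then show "\<forall>v w. wedge_d l1 l2 x v w = 0" using k unfolding w by simp
  qed
qed

text \<open>The two unit normals differ by a sign that is constant near \<open>x\<close> by
  continuity; a negative sign exchanges minimum and maximum, whence the second alternative.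
  \<open>\<phi>\<close> is known to be differentiable once only, so the second fundamental form is
  transported in the shape of \<open>fundamental_form_2_eq\<close>.\<close>

lemma principal_curvature_functions_transition:
  assumes np: "normal_patch A S U\<^sub>0 f\<^sub>0 n\<^sub>0" and f: "C2_patch S U f"
    and x: "x \<in> U\<^sub>0" and x': "x' \<in> U" "f x' = f\<^sub>0 x"
  obtains W \<phi> where "open W" "x \<in> W" "\<phi> x = x'" "\<And>y. y \<in> W \<Longrightarrow> \<phi> y \<in> U" "\<phi> differentiable (at x)"
    "(\<forall>y\<in>W. lambda1 A f\<^sub>0 n\<^sub>0 y = l1 (\<phi> y) \<and> lambda2 A f\<^sub>0 n\<^sub>0 y = l2 (\<phi> y)) \<or>
     (\<forall>y\<in>W. lambda1 A f\<^sub>0 n\<^sub>0 y = - l2 (\<phi> y) \<and> lambda2 A f\<^sub>0 n\<^sub>0 y = - l1 (\<phi> y))"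
proof -
  have f0: "C2_patch S U\<^sub>0 f\<^sub>0" and n0: "continuous_on U\<^sub>0 n\<^sub>0"
    and unit0: "\<And>y. y \<in> U\<^sub>0 \<Longrightarrow> ip A (n\<^sub>0 y) (n\<^sub>0 y) = sig A"
    and normal0: "\<And>y v. y \<in> U\<^sub>0 \<Longrightarrow> ip A (frechet_derivative f\<^sub>0 (at y) v) (n\<^sub>0 y) = 0"
    using np unfolding normal_patch_def by auto
  have U0: "open U\<^sub>0" and C2f0: "Ck_on 2 f\<^sub>0 U\<^sub>0" and inj0: "\<And>y. y \<in> U\<^sub>0 \<Longrightarrow> inj (frechet_derivative f\<^sub>0 (at y))"
    using f0 unfolding C2_patch_def by auto
  obtain W0 \<phi> where W0: "open W0" "x \<in> W0" "W0 \<subseteq> U\<^sub>0" and \<phi>x: "\<phi> x = x'"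
    and \<phi>: "\<And>y. y \<in> W0 \<Longrightarrow> \<phi> y \<in> U \<and> f (\<phi> y) = f\<^sub>0 y" and d\<phi>: "\<And>y. y \<in> W0 \<Longrightarrow> \<phi> differentiable (at y)"
    using C2_patch_transition[OF f0 f x x'] by metis
  define D where "D y = frechet_derivative \<phi> (at y)" for y
  have hD: "(\<phi> has_derivative D y) (at y)" if "y \<in> W0" for y
    using d\<phi>[OF that] unfolding D_def frechet_derivative_works .
  have chain: "frechet_derivative f\<^sub>0 (at y) v = frechet_derivative f (at (\<phi> y)) (D y v)" if y: "y \<in> W0" for y v
  proof -
    have "(f has_derivative frechet_derivative f (at (\<phi> y))) (at (\<phi> y))"
      using Df \<phi>[OF y] by (simp add: frechet_derivative_works[symmetric])
    from has_derivative_compose[OF hD[OF y] this]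
    have "((\<lambda>y. f (\<phi> y)) has_derivative (\<lambda>v. frechet_derivative f (at (\<phi> y)) (D y v))) (at y)" .
    then have "(f\<^sub>0 has_derivative (\<lambda>v. frechet_derivative f (at (\<phi> y)) (D y v))) (at y)"
      by (subst has_derivative_cong_open[OF W0(1) y, of _ "\<lambda>y. f (\<phi> y)"]) (use \<phi> in auto)
    then show ?thesis using frechet_derivative_at by metis
  qed
  have linD: "linear (D y)" if "y \<in> W0" for y using hD[OF that] has_derivative_linear by blast
  have injD: "inj (D y)" if y: "y \<in> W0" for y
  proof (rule injI)
    fix u v assume "D y u = D y v"
    then have "frechet_derivative f\<^sub>0 (at y) u = frechet_derivative f\<^sub>0 (at y) v" using chain[OF y] by simp
    then show "u = v" using inj0 y W0(3) by (meson injD subset_iff)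
  qed
  have surjD: "surj (D y)" if y: "y \<in> W0" for y
    using linear_injective_imp_surjective[OF linD[OF y] injD[OF y] refl] .
  define c where "c y = sig A * ip A (n\<^sub>0 y) (n (\<phi> y))" for y
  have c: "n\<^sub>0 y = c y *\<^sub>R n (\<phi> y)" "c y = 1 \<or> c y = - 1" if y: "y \<in> W0" for y
  proof -
    have "ip A (frechet_derivative f (at (\<phi> y)) v) (n\<^sub>0 y) = 0" for v
    proof -
      obtain u where "v = D y u" using surjD[OF y] by blast
      then show ?thesis using normal0[of y u] chain[OF y, of u] y W0(3) by auto
    qed
    moreover have "\<phi> y \<in> U" "ip A (n\<^sub>0 y) (n\<^sub>0 y) = sig A" using \<phi>[OF y] unit0 y W0(3) by auto
    ultimately show "n\<^sub>0 y = c y *\<^sub>R n (\<phi> y)" "c y = 1 \<or> c y = - 1"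
      using normal_unique[of "\<phi> y" "n\<^sub>0 y"] unfolding c_def by auto
  qed
  have cc: "continuous_on W0 c"
  proof -
    have "continuous_on W0 \<phi>"
      using d\<phi> continuous_on_eq_continuous_at[OF W0(1)] differentiable_imp_continuous_within by blast
    then have "continuous_on W0 (\<lambda>y. n (\<phi> y))"
      by (rule continuous_on_compose2[OF Ck_on_continuous[OF n]]) (use \<phi> in auto)
    then show ?thesis
      unfolding c_def[abs_def] by (intro continuous_on_mult continuous_on_const ip.continuous_on continuous_on_subset[OF n0 W0(3)])
  qed
  \<comment> \<open>The points at which \<open>c\<close> has the same sign as at
    \<open>x\<close>.\<close>
  define W where "W = W0 \<inter> (\<lambda>y. c y * c x) -` {0<..}"
  have W: "open W"
    unfolding W_def by (rule continuous_open_preimage[OF _ W0(1)]) (intro continuous_on_mult cc continuous_on_const open_greaterThan)+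
  have xW: "x \<in> W" using W0(2) c(2)[OF W0(2)] unfolding W_def by auto
  have WW0: "y \<in> W0" if "y \<in> W" for y using that unfolding W_def by simp
  define \<sigma> where "\<sigma> = c x"
  have \<sigma>: "\<sigma> = 1 \<or> \<sigma> = - 1" unfolding \<sigma>_def using c(2)[OF W0(2)] .
  have c\<sigma>: "c y = \<sigma>" if "y \<in> W" for y
    using that c(2)[OF WW0[OF that]] \<sigma> unfolding W_def \<sigma>_def by auto
  have n\<sigma>: "n\<^sub>0 y = \<sigma> *\<^sub>R n (\<phi> y)" if "y \<in> W" for y
    using c(1)[OF WW0[OF that]] c\<sigma>[OF that] by simp
  have pc: "principal_curvatures A f\<^sub>0 n\<^sub>0 y = {\<sigma> * l1 (\<phi> y), \<sigma> * l2 (\<phi> y)}" if y: "y \<in> W" for y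
  proof -
    note y0 = WW0[OF y]
    have yU: "y \<in> U\<^sub>0" and \<phi>U: "\<phi> y \<in> U" using W0(3) y0 \<phi> by auto
    have "(n has_derivative frechet_derivative n (at (\<phi> y))) (at (\<phi> y))"
      using Dn[OF \<phi>U] by (simp add: frechet_derivative_works[symmetric])
    from has_derivative_scaleR_right[OF has_derivative_compose[OF hD[OF y0] this], of \<sigma>]
    have "((\<lambda>y. \<sigma> *\<^sub>R n (\<phi> y)) has_derivative (\<lambda>v. \<sigma> *\<^sub>R frechet_derivative n (at (\<phi> y)) (D y v))) (at y)" .
    then have dn0: "(n\<^sub>0 has_derivative (\<lambda>v. \<sigma> *\<^sub>R frechet_derivative n (at (\<phi> y)) (D y v))) (at y)"
      by (subst has_derivative_cong_open[OF W y, of _ "\<lambda>y. \<sigma> *\<^sub>R n (\<phi> y)"]) (use n\<sigma> in auto)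
    have dn0': "frechet_derivative n\<^sub>0 (at y) v = \<sigma> *\<^sub>R frechet_derivative n (at (\<phi> y)) (D y v)" for v
      using frechet_derivative_at[OF dn0] by metis
    have "principal_curvatures A f\<^sub>0 n\<^sub>0 y = (\<lambda>l. \<sigma> * l) ` principal_curvatures A f n (\<phi> y)"
    proof (rule principal_curvatures_transition[OF _ linD[OF y0] injD[OF y0]])
      show "\<sigma> * \<sigma> = 1" using \<sigma> by auto
      show "fundamental_form_1 A f\<^sub>0 y v w = fundamental_form_1 A f (\<phi> y) (D y v) (D y w)" for v w
        unfolding fundamental_form_1_def chain[OF y0] ..
      have n0d: "n\<^sub>0 differentiable (at y)" using dn0 unfolding differentiable_def by blast
      show "fundamental_form_2 A f\<^sub>0 n\<^sub>0 y v w = \<sigma> * fundamental_form_2 A f n (\<phi> y) (D y v) (D y w)" for v w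
      proof -
        have "fundamental_form_2 A f\<^sub>0 n\<^sub>0 y v w =
            - ip A (frechet_derivative f\<^sub>0 (at y) v) (frechet_derivative n\<^sub>0 (at y) w)"
          by (rule fundamental_form_2_eq[OF U0 C2f0 yU n0d]) (rule normal0)
        moreover have "fundamental_form_2 A f n (\<phi> y) (D y v) (D y w) =
            - ip A (frechet_derivative f (at (\<phi> y)) (D y v)) (frechet_derivative n (at (\<phi> y)) (D y w))"
          by (rule fundamental_form_2_eq[OF U f_C2 \<phi>U Dn[OF \<phi>U]]) (rule normal)
        ultimately show ?thesis unfolding chain[OF y0] dn0' by (simp add: ip.scaleR_right)
      qed
    qed
    then show ?thesis by (simp add: principal_curvatures_eq[OF \<phi>U])
  qed
  have le: "l1 (\<phi> y) \<le> l2 (\<phi> y)" if "y \<in> W" for y using l1_le_l2 \<phi>[OF WW0[OF that]] by blast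
  show thesis
  proof (rule that[of W \<phi>, OF W xW \<phi>x])
    show "(\<forall>y\<in>W. lambda1 A f\<^sub>0 n\<^sub>0 y = l1 (\<phi> y) \<and> lambda2 A f\<^sub>0 n\<^sub>0 y = l2 (\<phi> y)) \<or>
     (\<forall>y\<in>W. lambda1 A f\<^sub>0 n\<^sub>0 y = - l2 (\<phi> y) \<and> lambda2 A f\<^sub>0 n\<^sub>0 y = - l1 (\<phi> y))"
      using \<sigma> unfolding lambda1_def lambda2_def by (elim disjE) (simp_all add: pc le)
  qed (use \<phi> WW0 d\<phi> W0(2) in auto)
qed

end

section \<open>The Weingarten condition and scalar flatness\<close>

theorem theorem3:
  fixes A :: ambient and S :: "(real^3) set"
  assumes "C2_surface S"
    and "A = Lorentzian \<Longrightarrow> space_like S"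
    and "C3_normal_congruence A S"
  shows "weingarten A S \<longleftrightarrow> scalar_flat_normal_congruence A S"
proof
  assume wg: "weingarten A S"
  show "scalar_flat_normal_congruence A S"
    unfolding scalar_flat_normal_congruence_def
  proof (intro allI impI ballI, elim conjE)
    fix U f n L h x
    assume c: "congruence_patch A S U f n L h" "Ck_on 3 h U" and x: "x \<in> U"
      and det: "det (induced_metric A h x) \<noteq> 0"
    interpret C3_normal_patch A U f n
      by (rule congruence_patch_triple_metric(1)[OF c assms(2)])
    have g: "induced_metric A h z $ i $ j = triple (f' i z) (n' j z) (n z) + triple (f' j z) (n' i z) (n z)"
      if "z \<in> U" for z i j
      by (rule congruence_patch_triple_metric(2)[OF c assms(2) that])
    \<comment> \<open>A nondegenerate metric excludes umbilic points, so the principal curvatures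
      are differentiable at \<open>x\<close> and the Weingarten condition applies.\<close>
    have xV: "x \<in> V" using det_triple_metric_umbilic[of x "induced_metric A h", OF x _ g[OF x]] det by blast
    have lam: "frechet_derivative (lambda1 A f n) (at x) = frechet_derivative l1 (at x)"
      "frechet_derivative (lambda2 A f n) (at x) = frechet_derivative l2 (at x)"
      "lambda1 A f n differentiable (at x)" "lambda2 A f n differentiable (at x)"
      using frechet_derivative_cong_open[OF U x, of "lambda1 A f n" l1] frechet_derivative_cong_open[OF U x, of "lambda2 A f n" l2]
        has_derivative_cong_open[OF U x, of "lambda1 A f n" l1] has_derivative_cong_open[OF U x, of "lambda2 A f n" l2]
        l_differentiable[OF xV]
      by (simp_all add: lambda_eq differentiable_def)
    have "wedge_d l1 l2 x v w = 0" for v w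
    proof -
      have "wedge_d (lambda1 A f n) (lambda2 A f n) x v w = 0"
        using wg congruence_patch_normal_patch[OF c(1)] x lam(3,4) unfolding weingarten_def by blast
      then show ?thesis unfolding wedge_d_def lam(1,2) .
    qed
    then show "scalar_curvature (induced_metric A h) x = 0"
      using wedge_d_eq_0_iff_scalar_curvature_eq_0[of x "induced_metric A h", OF xV g] by blast
  qed
next
  assume flat: "scalar_flat_normal_congruence A S"
  show "weingarten A S"
    unfolding weingarten_def
  proof (intro allI impI ballI, elim conjE)
    fix U\<^sub>0 f\<^sub>0 n\<^sub>0 x v w
    assume np: "normal_patch A S U\<^sub>0 f\<^sub>0 n\<^sub>0" and x: "x \<in> U\<^sub>0"
      and d: "lambda1 A f\<^sub>0 n\<^sub>0 differentiable (at x)" "lambda2 A f\<^sub>0 n\<^sub>0 differentiable (at x)"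
    have "f\<^sub>0 x \<in> S"
      using np x openin_imp_subset unfolding normal_patch_def C2_patch_def by blast
    then obtain U f n L h where c: "congruence_patch A S U f n L h" "Ck_on 3 h U" and "f\<^sub>0 x \<in> f ` U"
      using assms(3) unfolding C3_normal_congruence_def by metis
    then obtain x' where x': "x' \<in> U" "f x' = f\<^sub>0 x" by force
    interpret C3_normal_patch A U f n
      by (rule congruence_patch_triple_metric(1)[OF c assms(2)])
    have g: "induced_metric A h z $ i $ j = triple (f' i z) (n' j z) (n z) + triple (f' j z) (n' i z) (n z)"
      if "z \<in> U" for z i j
      by (rule congruence_patch_triple_metric(2)[OF c assms(2) that])
    obtain W \<phi> where W: "open W" "x \<in> W" and \<phi>x: "\<phi> x = x'" and \<phi>: "\<And>y. y \<in> W \<Longrightarrow> \<phi> y \<in> U"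
      and d\<phi>: "\<phi> differentiable (at x)"
      and lam: "(\<forall>y\<in>W. lambda1 A f\<^sub>0 n\<^sub>0 y = l1 (\<phi> y) \<and> lambda2 A f\<^sub>0 n\<^sub>0 y = l2 (\<phi> y)) \<or>
        (\<forall>y\<in>W. lambda1 A f\<^sub>0 n\<^sub>0 y = - l2 (\<phi> y) \<and> lambda2 A f\<^sub>0 n\<^sub>0 y = - l1 (\<phi> y))"
      by (rule principal_curvature_functions_transition[OF np congruence_patch_C2_patch[OF c(1)] x x']) (rule that)
    show "wedge_d (lambda1 A f\<^sub>0 n\<^sub>0) (lambda2 A f\<^sub>0 n\<^sub>0) x v w = 0"
    proof (cases "x' \<in> V")
      case False
      \<comment> \<open>At an umbilic point flatness gives no information; the inequality between
        the two functions suffices.\<close>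
      have "lambda1 A f\<^sub>0 n\<^sub>0 y \<le> lambda2 A f\<^sub>0 n\<^sub>0 y" if "y \<in> W" for y
        using lam l1_le_l2[OF \<phi>[OF that]] that by auto
      moreover have "lambda1 A f\<^sub>0 n\<^sub>0 x = lambda2 A f\<^sub>0 n\<^sub>0 x"
        using lam l_eq_outside_V[OF x'(1) False] W(2) \<phi>x by auto
      ultimately show ?thesis using wedge_d_eq_0_of_touching[OF W] d by blast
    next
      case True
      have "scalar_curvature (induced_metric A h) x' = 0"
        using flat c x'(1) scalar_curvature_triple_metric(2)[of x' "induced_metric A h", OF True g]
        unfolding scalar_flat_normal_congruence_def by blast
      then have w0: "wedge_d l1 l2 x' v w = 0" for v w
        using wedge_d_eq_0_iff_scalar_curvature_eq_0[of x' "induced_metric A h", OF True g] by blast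
      define D where "D = frechet_derivative \<phi> (at x)"
      have hD: "(\<phi> has_derivative D) (at x)" using d\<phi> unfolding D_def frechet_derivative_works .
      have comp: "frechet_derivative (\<lambda>y. l (\<phi> y)) (at x) u = frechet_derivative l (at x') (D u)"
        "frechet_derivative (\<lambda>y. - l (\<phi> y)) (at x) u = - frechet_derivative l (at x') (D u)"
        if "l differentiable (at x')" for l :: "real^2 \<Rightarrow> real" and u
      proof -
        have "(l has_derivative frechet_derivative l (at x')) (at (\<phi> x))"
          using that unfolding \<phi>x by (simp add: frechet_derivative_works[symmetric])
        note l = has_derivative_compose[OF hD this]
        show "frechet_derivative (\<lambda>y. l (\<phi> y)) (at x) u = frechet_derivative l (at x') (D u)"
          using fun_cong[OF frechet_derivative_at[OF l], of u] by simp
        show "frechet_derivative (\<lambda>y. - l (\<phi> y)) (at x) u = - frechet_derivative l (at x') (D u)"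
          using fun_cong[OF frechet_derivative_at[OF has_derivative_minus[OF l]], of u] by simp
      qed
      note comp1 = comp[OF l_differentiable(1)[OF True]] and comp2 = comp[OF l_differentiable(2)[OF True]]
      note cong = frechet_derivative_cong_open[OF W]
      from lam show ?thesis
      proof
        assume l: "\<forall>y\<in>W. lambda1 A f\<^sub>0 n\<^sub>0 y = l1 (\<phi> y) \<and> lambda2 A f\<^sub>0 n\<^sub>0 y = l2 (\<phi> y)"
        have "frechet_derivative (lambda1 A f\<^sub>0 n\<^sub>0) (at x) = frechet_derivative (\<lambda>y. l1 (\<phi> y)) (at x)"
          "frechet_derivative (lambda2 A f\<^sub>0 n\<^sub>0) (at x) = frechet_derivative (\<lambda>y. l2 (\<phi> y)) (at x)"
          by (rule cong; use l in blast)+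
        then show ?thesis using w0[of "D v" "D w"] unfolding wedge_d_def by (simp add: comp1 comp2)
      next
        \<comment> \<open>The two minus signs cancel, and exchanging the functions only changes the
          sign of the wedge product.\<close>
        assume l: "\<forall>y\<in>W. lambda1 A f\<^sub>0 n\<^sub>0 y = - l2 (\<phi> y) \<and> lambda2 A f\<^sub>0 n\<^sub>0 y = - l1 (\<phi> y)"
        have "frechet_derivative (lambda1 A f\<^sub>0 n\<^sub>0) (at x) = frechet_derivative (\<lambda>y. - l2 (\<phi> y)) (at x)"
          "frechet_derivative (lambda2 A f\<^sub>0 n\<^sub>0) (at x) = frechet_derivative (\<lambda>y. - l1 (\<phi> y)) (at x)"
          by (rule cong; use l in blast)+
        then show ?thesis using w0[of "D v" "D w"] unfolding wedge_d_def by (simp add: comp1 comp2 algebra_simps)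
      qed
    qed
  qed
qed

end
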